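(* Let $1<p<+\infty$, $1\le q_0\le q_1\le+\infty$, $s\ge 0$, and let $w$ be an $A_p$-weight on $\mathbf{S}^n$. Then $$HF_s^{pq_0}(w)\subset HF_s^{pq_1}(w).$$
   Context: $\mathbf{B}^n$ is the open unit ball of $\mathbf{C}^n$, $\mathbf{S}^n$ the unit sphere, $\sigma$ the normalized Lebesgue measure on $\mathbf{S}^n$, and $z\overline{\zeta}=\sum_i z_i\overline{\zeta_i}$. Nonisotropic balls are $B(\zeta,r)=\{\eta\in\mathbf{S}^n: |1-\zeta\overline{\eta}|<r\}$. A weight $w\ge 0$ on $\mathbf{S}^n$ is an $A_p$-weight if there is $C>0$ with $\left(\frac1{|B|}\int_B w\,d\sigma\right)\left(\frac1{|B|}\int_B w^{-1/(p-1)}d\sigma\right)^{p-1}\le C$ for every nonisotropic ball $B$ ($|B|$ is its Lebesgue measure). For $f=\sum_kf_k$ the homogeneous polynomial expansion of a holomorphic function, $(I+R)^tf=\sum_k(1+k)^tf_k$. Let $[s]^+$ denote the integer part of $s$ plus $1$. For $1\le q<+\infty$, $HF_s^{pq}(w)$ is the space of holomorphic functions $f$ in $\mathbf{B}^n$ with $$\|f\|_{HF_s^{pq}(w)}=\left(\int_{\mathbf{S}^n}\left(\int_0^1|((I+R)^{[s]^+}f)(r\zeta)|^q(1-r^2)^{([s]^+-s)q-1}dr\right)^{p/q}w(\zeta)\,d\sigma(\zeta)\right)^{1/p}<+\infty,$$ and $HF_s^{p\infty}(w)$ is the space of holomorphic functions $f$ in $\mathbf{B}^n$ with $$\|f\|_{HF_s^{p\infty}(w)}=\left(\int_{\mathbf{S}^n}\left(\sup_{0<r<1}|((I+R)^{[s]^+}f)(r\zeta)|(1-r^2)^{[s]^+-s}\right)^pw(\zeta)\,d\sigma(\zeta)\right)^{1/p}<+\infty.$$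 *)

theory Defs
  imports "HOL-Analysis.Analysis"
begin

definition hprod :: "complex ^ 'n \<Rightarrow> complex ^ 'n \<Rightarrow> complex"
  where "hprod z \<zeta> = (\<Sum>i\<in>UNIV. z $ i * cnj (\<zeta> $ i))"

(* The polar-coordinate description of normalized surface measure: the measure of E is
   vol {r x | x in E, 0 < r < 1} / vol (ball 0 1). The point 0 is sent to 0 by sgn and
   carries no mass. The completion makes all Lebesgue measurable sets available. *)
definition sphere_measure :: "(complex ^ 'n) measure"
  where "sphere_measure =
    completion (restrict_space (distr (uniform_measure lborel (ball 0 1)) borel sgn) (sphere 0 1))"

definition nonisotropic_ball :: "complex ^ 'n \<Rightarrow> real \<Rightarrow> (complex ^ 'n) set"
  where "nonisotropic_ball \<zeta> r = {\<eta> \<in> sphere 0 1. norm (1 - hprod \<zeta> \<eta>) < r}"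

(* Powers of extended nonnegative reals; only meaningful for exponents a > 0. *)
definition enn_powr :: "ennreal \<Rightarrow> real \<Rightarrow> ennreal"
  where "enn_powr x a = (if x = \<infinity> then \<infinity> else ennreal (enn2real x powr a))"

(* w^(-1/(p-1)) is written as an ennreal inverse, so that it is infinite where w = 0;
   the real power would give 0 there. *)
definition Ap_weight :: "real \<Rightarrow> (complex ^ 'n \<Rightarrow> real) \<Rightarrow> bool"
  where "Ap_weight p w \<longleftrightarrow>
    w \<in> borel_measurable sphere_measure \<and> (\<forall>\<zeta>\<in>sphere 0 1. 0 \<le> w \<zeta>) \<and>
    (\<exists>C>0. \<forall>\<zeta>\<in>sphere 0 1. \<forall>r>0. let B = nonisotropic_ball \<zeta> r in
      ((\<integral>\<^sup>+\<eta>\<in>B. ennreal (w \<eta>) \<partial>sphere_measure) / emeasure sphere_measure B) *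
      enn_powr ((\<integral>\<^sup>+\<eta>\<in>B. inverse (ennreal (w \<eta> powr (1 / (p - 1)))) \<partial>sphere_measure)
                  / emeasure sphere_measure B) (p - 1)
      \<le> ennreal C)"

definition holomorphic_ball :: "(complex ^ 'n \<Rightarrow> complex) \<Rightarrow> bool"
  where "holomorphic_ball f \<longleftrightarrow>
    (\<forall>z\<in>ball 0 1. \<exists>D. (f has_derivative D) (at z) \<and> (\<forall>c v. D (c *s v) = c * D v))"

definition homogeneous_poly :: "nat \<Rightarrow> (complex ^ 'n \<Rightarrow> complex) \<Rightarrow> bool"
  where "homogeneous_poly k P \<longleftrightarrow>
    (\<exists>c :: ('n \<Rightarrow> nat) \<Rightarrow> complex.
      \<forall>z. P z = (\<Sum>\<alpha>\<in>{\<alpha>. (\<Sum>i\<in>UNIV. \<alpha> i) = k}. c \<alpha> * (\<Prod>i\<in>UNIV. (z $ i) ^ \<alpha> i)))"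

(* Every holomorphic f on the ball has exactly one such expansion. *)
definition homogeneous_expansion ::
    "(complex ^ 'n \<Rightarrow> complex) \<Rightarrow> nat \<Rightarrow> complex ^ 'n \<Rightarrow> complex"
  where "homogeneous_expansion f =
    (THE F. (\<forall>k. homogeneous_poly k (F k)) \<and> (\<forall>z\<in>ball 0 1. (\<lambda>k. F k z) sums f z))"

(* (I+R)^t *)
definition radial_power :: "real \<Rightarrow> (complex ^ 'n \<Rightarrow> complex) \<Rightarrow> complex ^ 'n \<Rightarrow> complex"
  where "radial_power t f z =
    (\<Sum>k. of_real ((1 + real k) powr t) * homogeneous_expansion f k z)"

definition int_plus :: "real \<Rightarrow> real"
  where "int_plus s = of_int \<lfloor>s\<rfloor> + 1"

definition HF_norm ::
    "real \<Rightarrow> ennreal \<Rightarrow> real \<Rightarrow> (complex ^ 'n \<Rightarrow> real) \<Rightarrow> (complex ^ 'n \<Rightarrow> complex) \<Rightarrow> ennreal"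
  where "HF_norm p q s w f =
    (let g = (\<lambda>r \<zeta>. norm (radial_power (int_plus s) f (r *\<^sub>R \<zeta>))) in
     if q = \<infinity> then
       enn_powr (\<integral>\<^sup>+\<zeta>. enn_powr (SUP r\<in>{0<..<1}. ennreal (g r \<zeta> * (1 - r\<^sup>2) powr (int_plus s - s))) p
                    * ennreal (w \<zeta>) \<partial>sphere_measure) (1 / p)
     else
       let q' = enn2real q in
       enn_powr (\<integral>\<^sup>+\<zeta>. enn_powr (\<integral>\<^sup>+r\<in>{0<..<1}.
                        ennreal (g r \<zeta> powr q' * (1 - r\<^sup>2) powr ((int_plus s - s) * q' - 1)) \<partial>lborel)
                      (p / q')
                    * ennreal (w \<zeta>) \<partial>sphere_measure) (1 / p))"

(* Only the values of f on the unit ball matter. *)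
definition HF :: "real \<Rightarrow> ennreal \<Rightarrow> real \<Rightarrow> (complex ^ 'n \<Rightarrow> real) \<Rightarrow> (complex ^ 'n \<Rightarrow> complex) set"
  where "HF p q s w = {f. holomorphic_ball f \<and> HF_norm p q s w f < \<infinity>}"

end

theory Submission
  imports Defs "HOL-Complex_Analysis.Complex_Analysis"
begin

unbundle no fps_syntax

text \<open>
  Let \<open>G = (I + R)\<^sup>N f\<close> with \<open>N = int_plus s\<close>, and let \<open>d = N - s > 0\<close>. For finite \<open>q\<close> the norm is that
  of \<open>A q powr (1 / q)\<close> in \<open>L\<^sup>p(w)\<close>, where \<open>A q\<close> (\<open>radial_integral\<close>) is the integral of
  \<open>\<bar>G(\<rho>\<zeta>)\<bar> powr q * (1 - \<rho>\<^sup>2) powr (d * q - 1)\<close> over the radius; for \<open>q = \<infinity>\<close> it is that of the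
  supremum \<open>M\<close> (\<open>radial_sup\<close>) of \<open>\<bar>G(\<rho>\<zeta>)\<bar> * (1 - \<rho>\<^sup>2) powr d\<close>. The integrand of \<open>A q1\<close> is that of
  \<open>A q0\<close> times the power \<open>q1 - q0\<close> of the quantity whose supremum is \<open>M\<close>, so that
  \<open>A q1 \<le> M powr (q1 - q0) * A q0\<close> (\<open>radial_integral_le_sup\<close>). Hence the inclusion for finite \<open>q1\<close>
  follows by interpolation from the case \<open>q1 = \<infinity>\<close>: if \<open>A q0 powr (1 / q0)\<close> lies in \<open>L\<^sup>p(w)\<close>, then so does
  \<open>M\<close> (\<open>radial_sup_integral_finite\<close>).

  That case is a maximal inequality. A holomorphic function has the sub-mean value property over
  translates of every balanced set, hence over boxes of size \<open>1 - r\<close> in the complex direction of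
  \<open>\<zeta>\<close> and \<open>sqrt (1 - r)\<close> in the orthogonal directions. In polar coordinates such a box around
  \<open>r\<zeta>\<close> lies over a nonisotropic ball of radius comparable to \<open>1 - r\<close>, and within it \<open>1 - \<rho>\<^sup>2\<close> is
  comparable to \<open>1 - r\<close>. So \<open>\<bar>G(r\<zeta>)\<bar> * (1 - r) powr d\<close> is at most a constant times the average
  of \<open>A q powr (1 / q)\<close> over the nonisotropic ball, and \<open>M\<close> is dominated by a Hardy-Littlewood
  maximal function.

  The full theorem of Muckenhoupt, that this maximal operator is bounded on \<open>L\<^sup>p(w)\<close>, is usually
  derived from a reverse Hoelder inequality. It is avoided by a gain in the exponent: the sub-mean value
  property persists, up to a constant, for \<open>sqrt \<bar>G\<bar>\<close> (\<open>sqrt_sub_mean_value\<close>). Then \<open>sqrt M\<close> is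
  dominated by averages of \<open>A q powr (1 / (2 * q))\<close> (\<open>sqrt_le_nonisotropic_average\<close>), and only
  boundedness on \<open>L\<^sup>2\<^sup>p(w)\<close> is required. For a weight in \<open>A\<^sub>p\<close> the weak type inequality on \<open>L\<^sup>p(w)\<close> follows
  directly from the defining condition and a Vitali covering argument (\<open>weighted_weak_type\<close>), and
  integrating over levels turns it into the strong inequality on \<open>L\<^sup>2\<^sup>p(w)\<close>
  (\<open>weighted_strong_type\<close>).

  Before any of this, \<open>G\<close> must be shown to be the expected function. The homogeneous expansion is
  introduced by a description, so its existence and uniqueness have to be proved: the Taylor
  coefficients of \<open>\<mu> \<mapsto> f (\<mu> z)\<close> are entire on complex lines and homogeneous, hence
  polynomials in each variable by Liouville's theorem, hence polynomials.
\<close>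

section \<open>Homogeneous polynomials\<close>

lemma norm_vector_scalar_mult: "norm (c *s (z :: complex ^ 'n)) = cmod c * norm z"
proof -
  have "norm (c *s z) = L2_set (\<lambda>i. norm (c * z $ i)) UNIV"
    by (simp add: norm_vec_def)
  also have "\<dots> = L2_set (\<lambda>i. cmod c * norm (z $ i)) UNIV"
    by (simp add: norm_mult)
  also have "\<dots> = cmod c * L2_set (\<lambda>i. norm (z $ i)) UNIV"
    by (simp add: L2_set_right_distrib)
  finally show ?thesis by (simp add: norm_vec_def)
qed

lemma scaleR_eq_vector_scalar_mult: "r *\<^sub>R (z :: complex ^ 'n) = complex_of_real r *s z"
proof -
  have "(r *\<^sub>R z) $ i = (complex_of_real r *s z) $ i" for i
    unfolding vector_scaleR_component vector_smult_component by (rule scaleR_conv_of_real)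
  then show ?thesis by (simp add: vec_eq_iff)
qed

lemma finite_multi_indices: "finite {\<alpha> :: 'n::finite \<Rightarrow> nat. (\<Sum>i\<in>UNIV. \<alpha> i) = k}"
proof (rule finite_subset)
  show "{\<alpha> :: 'n \<Rightarrow> nat. (\<Sum>i\<in>UNIV. \<alpha> i) = k} \<subseteq> PiE UNIV (\<lambda>_. {..k})"
    by (auto intro!: member_le_sum)
  show "finite (PiE UNIV (\<lambda>_ :: 'n. {..k}))"
    by (intro finite_PiE) auto
qed

lemma homogeneous_poly_zero: "homogeneous_poly k (\<lambda>_. 0)"
  unfolding homogeneous_poly_def by (rule exI[of _ "\<lambda>_. 0"]) simp

lemma homogeneous_poly_add:
  assumes "homogeneous_poly k P" "homogeneous_poly k Q"
  shows "homogeneous_poly k (\<lambda>z. P z + Q z)"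
proof -
  obtain c d where
    "\<And>z. P z = (\<Sum>\<alpha>\<in>{\<alpha>. (\<Sum>i\<in>UNIV. \<alpha> i) = k}. c \<alpha> * (\<Prod>i\<in>UNIV. (z $ i) ^ \<alpha> i))"
    "\<And>z. Q z = (\<Sum>\<alpha>\<in>{\<alpha>. (\<Sum>i\<in>UNIV. \<alpha> i) = k}. d \<alpha> * (\<Prod>i\<in>UNIV. (z $ i) ^ \<alpha> i))"
    using assms unfolding homogeneous_poly_def by blast
  then show ?thesis
    unfolding homogeneous_poly_def
    by (intro exI[of _ "\<lambda>\<alpha>. c \<alpha> + d \<alpha>"]) (simp add: sum.distrib algebra_simps)
qed

lemma homogeneous_poly_cmult:
  assumes "homogeneous_poly k P"
  shows "homogeneous_poly k (\<lambda>z. a * P z)"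
proof -
  obtain c where
    "\<And>z. P z = (\<Sum>\<alpha>\<in>{\<alpha>. (\<Sum>i\<in>UNIV. \<alpha> i) = k}. c \<alpha> * (\<Prod>i\<in>UNIV. (z $ i) ^ \<alpha> i))"
    using assms unfolding homogeneous_poly_def by blast
  then show ?thesis
    unfolding homogeneous_poly_def
    by (intro exI[of _ "\<lambda>\<alpha>. a * c \<alpha>"]) (simp add: sum_distrib_left algebra_simps)
qed

lemma homogeneous_poly_const: "homogeneous_poly 0 (\<lambda>_ :: complex ^ 'n. a)"
proof -
  have "{\<alpha> :: 'n \<Rightarrow> nat. \<forall>i. \<alpha> i = 0} = {\<lambda>_. 0}"
    by (auto simp: fun_eq_iff)
  then show ?thesis
    unfolding homogeneous_poly_def by (intro exI[of _ "\<lambda>_. a"]) simp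
qed

text \<open>On coefficients, multiplication by a coordinate is a shift of the multi-indices.\<close>

lemma homogeneous_poly_times_coordinate:
  fixes P :: "complex ^ 'n \<Rightarrow> complex"
  assumes "homogeneous_poly k P"
  shows "homogeneous_poly (Suc k) (\<lambda>z. z $ j * P z)"
proof -
  let ?A = "\<lambda>k. {\<alpha> :: 'n \<Rightarrow> nat. (\<Sum>i\<in>UNIV. \<alpha> i) = k}"
  obtain c where c:
    "\<And>z. P z = (\<Sum>\<alpha>\<in>?A k. c \<alpha> * (\<Prod>i\<in>UNIV. (z $ i) ^ \<alpha> i))"
    using assms unfolding homogeneous_poly_def by blast
  define up where "up = (\<lambda>\<alpha> :: 'n \<Rightarrow> nat. \<alpha>(j := Suc (\<alpha> j)))"
  define d where "d = (\<lambda>\<alpha> :: 'n \<Rightarrow> nat. if \<alpha> j = 0 then 0 else c (\<alpha>(j := \<alpha> j - 1)))"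
  have sum_up: "(\<Sum>i\<in>UNIV. up \<alpha> i) = Suc (\<Sum>i\<in>UNIV. \<alpha> i)" for \<alpha>
  proof -
    have "(\<Sum>i\<in>UNIV. up \<alpha> i) = Suc (\<alpha> j) + (\<Sum>i\<in>UNIV - {j}. up \<alpha> i)"
      by (subst sum.remove[of _ j]) (auto simp: up_def)
    also have "(\<Sum>i\<in>UNIV - {j}. up \<alpha> i) = (\<Sum>i\<in>UNIV - {j}. \<alpha> i)"
      by (rule sum.cong) (auto simp: up_def)
    also have "Suc (\<alpha> j) + (\<Sum>i\<in>UNIV - {j}. \<alpha> i) = Suc (\<Sum>i\<in>UNIV. \<alpha> i)"
      by (subst (2) sum.remove[of _ j]) auto
    finally show ?thesis .
  qed
  have prod_up: "(\<Prod>i\<in>UNIV. (z $ i) ^ up \<alpha> i) = z $ j * (\<Prod>i\<in>UNIV. (z $ i) ^ \<alpha> i)" for \<alpha> and z :: "complex ^ 'n"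
  proof -
    have "(\<Prod>i\<in>UNIV. (z $ i) ^ up \<alpha> i) = z $ j ^ Suc (\<alpha> j) * (\<Prod>i\<in>UNIV - {j}. (z $ i) ^ up \<alpha> i)"
      by (subst prod.remove[of _ j]) (auto simp: up_def)
    also have "(\<Prod>i\<in>UNIV - {j}. (z $ i) ^ up \<alpha> i) = (\<Prod>i\<in>UNIV - {j}. (z $ i) ^ \<alpha> i)"
      by (rule prod.cong) (auto simp: up_def)
    also have "z $ j ^ Suc (\<alpha> j) * (\<Prod>i\<in>UNIV - {j}. (z $ i) ^ \<alpha> i) = z $ j * (\<Prod>i\<in>UNIV. (z $ i) ^ \<alpha> i)"
      by (subst (2) prod.remove[of _ j]) auto
    finally show ?thesis .
  qed
  have inj: "inj_on up (?A k)"
  proof (rule inj_onI)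
    fix \<alpha> \<beta> assume "up \<alpha> = up \<beta>"
    then have "up \<alpha> i = up \<beta> i" for i by simp
    then have "\<alpha> i = \<beta> i" for i
      unfolding up_def by (metis fun_upd_apply nat.inject)
    then show "\<alpha> = \<beta>" by auto
  qed
  have "z $ j * P z = (\<Sum>\<alpha>\<in>?A (Suc k). d \<alpha> * (\<Prod>i\<in>UNIV. (z $ i) ^ \<alpha> i))" for z
  proof -
    have "z $ j * P z = (\<Sum>\<alpha>\<in>?A k. c \<alpha> * (\<Prod>i\<in>UNIV. (z $ i) ^ up \<alpha> i))"
      by (simp add: c prod_up sum_distrib_left algebra_simps)
    also have "\<dots> = (\<Sum>\<alpha>\<in>?A k. d (up \<alpha>) * (\<Prod>i\<in>UNIV. (z $ i) ^ up \<alpha> i))"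
      by (rule sum.cong) (auto simp: d_def up_def)
    also have "\<dots> = (\<Sum>\<alpha>\<in>up ` ?A k. d \<alpha> * (\<Prod>i\<in>UNIV. (z $ i) ^ \<alpha> i))"
      using inj by (simp add: sum.reindex)
    also have "\<dots> = (\<Sum>\<alpha>\<in>?A (Suc k). d \<alpha> * (\<Prod>i\<in>UNIV. (z $ i) ^ \<alpha> i))"
    proof (rule sum.mono_neutral_left)
      show "finite (?A (Suc k))" by (rule finite_multi_indices)
      show "up ` ?A k \<subseteq> ?A (Suc k)" using sum_up by auto
      show "\<forall>\<alpha>\<in>?A (Suc k) - up ` ?A k. d \<alpha> * (\<Prod>i\<in>UNIV. (z $ i) ^ \<alpha> i) = 0"
      proof
        fix \<alpha> assume \<alpha>: "\<alpha> \<in> ?A (Suc k) - up ` ?A k"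
        have "\<alpha> j = 0"
        proof (rule ccontr)
          assume "\<alpha> j \<noteq> 0"
          then have eq: "\<alpha> = up (\<alpha>(j := \<alpha> j - 1))" by (auto simp: up_def)
          have "(\<Sum>i\<in>UNIV. (\<alpha>(j := \<alpha> j - 1)) i) = k"
            using sum_up[of "\<alpha>(j := \<alpha> j - 1)"] eq \<alpha> by auto
          then show False using eq \<alpha> by blast
        qed
        then show "d \<alpha> * (\<Prod>i\<in>UNIV. (z $ i) ^ \<alpha> i) = 0" by (simp add: d_def)
      qed
    qed
    finally show ?thesis .
  qed
  then show ?thesis unfolding homogeneous_poly_def by blast
qed

lemma homogeneous_poly_homogeneous:
  assumes "homogeneous_poly k P"
  shows "P (c *s z) = c ^ k * P z"
proof -
  obtain a where a:
    "\<And>z. P z = (\<Sum>\<alpha>\<in>{\<alpha>. (\<Sum>i\<in>UNIV. \<alpha> i) = k}. a \<alpha> * (\<Prod>i\<in>UNIV. (z $ i) ^ \<alpha> i))"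
    using assms unfolding homogeneous_poly_def by blast
  have "(\<Prod>i\<in>UNIV. ((c *s z) $ i) ^ \<alpha> i) = c ^ k * (\<Prod>i\<in>UNIV. (z $ i) ^ \<alpha> i)"
    if "(\<Sum>i\<in>UNIV. \<alpha> i) = k" for \<alpha>
    using that by (simp add: power_mult_distrib prod.distrib power_sum[symmetric])
  then show ?thesis unfolding a
    by (auto simp: sum_distrib_left intro!: sum.cong)
qed

lemma continuous_on_homogeneous_poly:
  assumes "homogeneous_poly k P"
  shows "continuous_on S P"
proof -
  obtain a where a:
    "\<And>z. P z = (\<Sum>\<alpha>\<in>{\<alpha>. (\<Sum>i\<in>UNIV. \<alpha> i) = k}. a \<alpha> * (\<Prod>i\<in>UNIV. (z $ i) ^ \<alpha> i))"
    using assms unfolding homogeneous_poly_def by blast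
  then have "P = (\<lambda>z. \<Sum>\<alpha>\<in>{\<alpha>. (\<Sum>i\<in>UNIV. \<alpha> i) = k}. a \<alpha> * (\<Prod>i\<in>UNIV. (z $ i) ^ \<alpha> i))"
    by blast
  then show ?thesis by (auto intro!: continuous_intros)
qed

text \<open>The functions obtained from constants by addition and by multiplication with a coordinate
  are the polynomials; this presentation makes it immediate that each of them is a finite sum of
  homogeneous ones.\<close>

inductive polynomial_map :: "(complex ^ 'n \<Rightarrow> complex) \<Rightarrow> bool" where
  const: "polynomial_map (\<lambda>_. a)"
| add: "polynomial_map P \<Longrightarrow> polynomial_map Q \<Longrightarrow> polynomial_map (\<lambda>z. P z + Q z)"
| cmult: "polynomial_map P \<Longrightarrow> polynomial_map (\<lambda>z. a * P z)"
| coordinate: "polynomial_map P \<Longrightarrow> polynomial_map (\<lambda>z. z $ i * P z)"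

lemma polynomial_map_sum:
  "(\<And>x. x \<in> A \<Longrightarrow> polynomial_map (P x)) \<Longrightarrow> polynomial_map (\<lambda>z. \<Sum>x\<in>A. P x z)"
  by (induction A rule: infinite_finite_induct) (auto intro: polynomial_map.intros)

lemma polynomial_map_power: "polynomial_map P \<Longrightarrow> polynomial_map (\<lambda>z. z $ i ^ l * P z)"
proof (induction l)
  case (Suc l)
  have "polynomial_map (\<lambda>z. z $ i * (z $ i ^ l * P z))"
    using Suc by (intro polynomial_map.intros) auto
  then show ?case by (simp add: mult.assoc)
qed auto

lemma polynomial_map_homogeneous_parts:
  assumes "polynomial_map P"
  shows "\<exists>d H. (\<forall>k. homogeneous_poly k (H k)) \<and> (\<forall>k>d. H k = (\<lambda>_. 0)) \<and> (\<forall>z. P z = (\<Sum>k\<le>d. H k z))"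
  using assms
proof induction
  case (const a)
  show ?case
    by (rule exI[of _ 0], rule exI[of _ "\<lambda>k. if k = 0 then (\<lambda>_. a) else (\<lambda>_. 0)"])
      (auto simp: homogeneous_poly_const homogeneous_poly_zero)
next
  case (add P Q)
  then obtain d H e K where H: "\<forall>k. homogeneous_poly k (H k)" "\<forall>k>d. H k = (\<lambda>_. 0)" "\<forall>z. P z = (\<Sum>k\<le>d. H k z)"
    and K: "\<forall>k. homogeneous_poly k (K k)" "\<forall>k>e. K k = (\<lambda>_. 0)" "\<forall>z. Q z = (\<Sum>k\<le>e. K k z)"
    by blast
  have 1: "(\<Sum>k\<le>d. H k z) = (\<Sum>k\<le>max d e. H k z)" for z
    by (rule sum.mono_neutral_left) (use H in auto)
  have 2: "(\<Sum>k\<le>e. K k z) = (\<Sum>k\<le>max d e. K k z)" for z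
    by (rule sum.mono_neutral_left) (use K in auto)
  show ?case
    by (rule exI[of _ "max d e"], rule exI[of _ "\<lambda>k z. H k z + K k z"])
      (use H K in \<open>auto simp: 1 2 sum.distrib intro!: homogeneous_poly_add\<close>)
next
  case (cmult P a)
  then obtain d H where H: "\<forall>k. homogeneous_poly k (H k)" "\<forall>k>d. H k = (\<lambda>_. 0)" "\<forall>z. P z = (\<Sum>k\<le>d. H k z)"
    by blast
  show ?case
    by (rule exI[of _ d], rule exI[of _ "\<lambda>k z. a * H k z"])
      (use H in \<open>auto simp: sum_distrib_left intro!: homogeneous_poly_cmult\<close>)
next
  case (coordinate P i)
  then obtain d H where H: "\<forall>k. homogeneous_poly k (H k)" "\<forall>k>d. H k = (\<lambda>_. 0)" "\<forall>z. P z = (\<Sum>k\<le>d. H k z)"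
    by blast
  define K where "K = (\<lambda>k. if k = 0 then (\<lambda>_. 0) else (\<lambda>z. z $ i * H (k - 1) z))"
  have "homogeneous_poly k (K k)" for k
    using homogeneous_poly_times_coordinate[of "k - 1" "H (k - 1)" i] H(1)
    by (cases k) (auto simp: K_def homogeneous_poly_zero)
  moreover have "\<forall>k>Suc d. K k = (\<lambda>_. 0)" using H(2) by (auto simp: K_def)
  moreover have "z $ i * P z = (\<Sum>k\<le>Suc d. K k z)" for z
    by (subst sum.atMost_Suc_shift) (auto simp: K_def H(3) sum_distrib_left)
  ultimately show ?case by blast
qed

text \<open>Evaluating along a line through the origin, compare coefficients of the powers of the scalar:
  only the part of degree \<open>k\<close> of \<open>P\<close> can survive.\<close>

lemma homogeneous_poly_if_polynomial_map:
  assumes P: "polynomial_map P" and hom: "\<And>c z. P (c *s z) = c ^ k * P z"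
  shows "homogeneous_poly k P"
proof -
  obtain d H where H: "\<And>k. homogeneous_poly k (H k)" "\<And>k. k > d \<Longrightarrow> H k = (\<lambda>_. 0)"
    and PH: "\<And>z. P z = (\<Sum>k\<le>d. H k z)"
    using polynomial_map_homogeneous_parts[OF P] by blast
  have "P z = H k z" for z
  proof -
    let ?e = "max d k"
    have "\<forall>x. (\<Sum>l\<le>?e. H l z * x ^ l) = (\<Sum>l\<le>?e. (if l = k then P z else 0) * x ^ l)"
    proof
      fix x
      have "(\<Sum>l\<le>?e. H l z * x ^ l) = (\<Sum>l\<le>?e. H l (x *s z))"
        using homogeneous_poly_homogeneous[OF H(1)] by (simp add: mult.commute)
      also have "\<dots> = P (x *s z)" unfolding PH
        by (rule sum.mono_neutral_right) (auto simp: H(2))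
      also have "\<dots> = (\<Sum>l\<le>?e. (if l = k then P z else 0) * x ^ l)"
        by (simp add: hom if_distrib[of "\<lambda>y. y * _"] cong: if_cong)
      finally show "(\<Sum>l\<le>?e. H l z * x ^ l) = (\<Sum>l\<le>?e. (if l = k then P z else 0) * x ^ l)" .
    qed
    then have "\<forall>l\<le>?e. H l z = (if l = k then P z else 0)"
      by (subst (asm) polyfun_eq_coeffs)
    then show ?thesis by force
  qed
  then have "P = H k" by auto
  then show ?thesis using H(1) by simp
qed

text \<open>The interpolation nodes are \<open>0, \<dots>, k\<close>; the coefficients \<open>b j l\<close> are those of the Lagrange
  basis polynomials.\<close>

lemma interpolation:
  "\<exists>b :: nat \<Rightarrow> nat \<Rightarrow> complex. \<forall>c x. (\<Sum>l\<le>k. c l * x ^ l)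
     = (\<Sum>j\<le>k. (\<Sum>i\<le>k. c i * of_nat j ^ i) * (\<Sum>l\<le>k. b j l * x ^ l))"
proof -
  define L :: "nat \<Rightarrow> complex poly" where
    "L j = (\<Prod>i\<in>{..k} - {j}. smult (1 / (of_nat j - of_nat i)) [:- of_nat i, 1:])" for j
  have degL: "degree (L j) \<le> k" if "j \<le> k" for j
  proof -
    have "degree (L j) \<le> (\<Sum>i\<in>{..k} - {j}. degree (smult (1 / (of_nat j - of_nat i)) [:- of_nat i, 1 :: complex:]))"
      unfolding L_def by (rule order.trans[OF degree_prod_sum_le]) (auto simp: o_def simp del: smult_pCons)
    also have "\<dots> \<le> (\<Sum>i\<in>{..k} - {j}. 1)"
      by (rule sum_mono) auto
    also have "\<dots> = k" using that by (simp add: card_Diff_singleton)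
    finally show ?thesis .
  qed
  have Lval: "poly (L j) (of_nat i) = (if i = j then 1 else 0)" if "i \<le> k" "j \<le> k" for i j
  proof (cases "i = j")
    case True
    then show ?thesis by (auto simp: L_def poly_prod simp flip: diff_divide_distrib intro!: prod.neutral)
  next
    case False
    then have "i \<in> {..k} - {j}" using that by auto
    then have "poly (L j) (of_nat i) = 0"
      unfolding L_def poly_prod by (intro prod_zero) (auto intro!: bexI[of _ i])
    then show ?thesis using False by simp
  qed
  have "(\<Sum>l\<le>k. c l * x ^ l) = (\<Sum>j\<le>k. (\<Sum>i\<le>k. c i * of_nat j ^ i) * (\<Sum>l\<le>k. coeff (L j) l * x ^ l))" for c x
  proof -
    define p where "p = (\<Sum>l\<le>k. monom (c l) l)"
    define q where "q = p - (\<Sum>j\<le>k. smult (poly p (of_nat j)) (L j))"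
    have polyp: "poly p y = (\<Sum>l\<le>k. c l * y ^ l)" for y
      by (simp add: p_def poly_sum poly_monom)
    have "degree p \<le> k" unfolding p_def
      by (intro degree_sum_le) (auto intro: order.trans[OF degree_monom_le])
    moreover have "degree (\<Sum>j\<le>k. smult (poly p (of_nat j)) (L j)) \<le> k"
      by (intro degree_sum_le) (auto intro: order.trans[OF degree_smult_le] degL)
    ultimately have degq: "degree q \<le> k"
      unfolding q_def by (rule degree_diff_le)
    have "poly q (of_nat i) = 0" if "i \<le> k" for i
    proof -
      have "(\<Sum>j\<le>k. poly p (of_nat j) * poly (L j) (of_nat i)) = (\<Sum>j\<le>k. if j = i then poly p (of_nat j) else 0)"
        by (rule sum.cong) (use that Lval in auto)
      then show ?thesis using that by (simp add: q_def poly_sum)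
    qed
    then have "of_nat ` {..k} \<subseteq> {x. poly q x = 0}" by auto
    have "q = 0"
    proof (rule ccontr)
      assume q: "q \<noteq> 0"
      have "card (of_nat ` {..k} :: complex set) = Suc k"
        by (subst card_image) (auto simp: inj_on_def)
      then have "Suc k \<le> card {x. poly q x = 0}"
        using card_mono[OF poly_roots_finite[OF q] \<open>of_nat ` {..k} \<subseteq> {x. poly q x = 0}\<close>] by simp
      also have "\<dots> \<le> degree q" using q by (rule card_poly_roots_bound)
      finally show False using degq by simp
    qed
    then have "p = (\<Sum>j\<le>k. smult (poly p (of_nat j)) (L j))"
      by (simp add: q_def)
    then have "poly p x = poly (\<Sum>j\<le>k. smult (poly p (of_nat j)) (L j)) x"
      by (rule arg_cong)
    then have "poly p x = (\<Sum>j\<le>k. poly p (of_nat j) * poly (L j) x)"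
      by (simp add: poly_sum)
    also have "\<dots> = (\<Sum>j\<le>k. poly p (of_nat j) * (\<Sum>l\<le>k. coeff (L j) l * x ^ l))"
    proof (rule sum.cong)
      fix j assume "j \<in> {..k}"
      then have "poly (L j) x = (\<Sum>l\<le>k. coeff (L j) l * x ^ l)"
        unfolding poly_altdef using degL[of j]
        by (intro sum.mono_neutral_left) (auto intro: coeff_eq_0)
      then show "poly p (of_nat j) * poly (L j) x = poly p (of_nat j) * (\<Sum>l\<le>k. coeff (L j) l * x ^ l)"
        by simp
    qed simp
    finally show ?thesis by (simp add: polyp)
  qed
  then show ?thesis by (intro exI[of _ "\<lambda>j. coeff (L j)"]) blast
qed

text \<open>Interpolation in one variable after the other expresses the function by its values on a finite
  grid. The induction runs over the set of variables that are not held fixed at \<open>y\<close>.\<close>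

lemma polynomial_map_if_separately:
  fixes F :: "complex ^ 'n \<Rightarrow> complex"
  assumes sep: "\<And>a i. \<exists>c. \<forall>x. F (\<chi> l. if l = i then x else a $ l) = (\<Sum>l\<le>k. c l * x ^ l)"
  shows "polynomial_map F"
proof -
  obtain b :: "nat \<Rightarrow> nat \<Rightarrow> complex" where b: "\<And>c x. (\<Sum>l\<le>k. c l * x ^ l)
     = (\<Sum>j\<le>k. (\<Sum>i\<le>k. c i * of_nat j ^ i) * (\<Sum>l\<le>k. b j l * x ^ l))"
    using interpolation[of k] by blast
  have inter: "F (\<chi> l. if l = i then x else a $ l)
      = (\<Sum>j\<le>k. F (\<chi> l. if l = i then of_nat j else a $ l) * (\<Sum>l\<le>k. b j l * x ^ l))" for a i x
  proof -
    obtain c where c: "\<And>x. F (\<chi> l. if l = i then x else a $ l) = (\<Sum>l\<le>k. c l * x ^ l)"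
      using sep by blast
    show ?thesis unfolding c by (rule b)
  qed
  have "polynomial_map (\<lambda>z. F (\<chi> l. if l \<in> I then z $ l else y $ l))" for I y
    using finite[of I]
  proof (induction I arbitrary: y rule: finite_induct)
    case empty
    show ?case by (simp add: polynomial_map.const)
  next
    case (insert i I)
    have eq: "F (\<chi> l. if l \<in> insert i I then z $ l else y $ l)
      = (\<Sum>j\<le>k. \<Sum>l\<le>k. b j l * (z $ i ^ l * F (\<chi> l. if l \<in> I then z $ l else (\<chi> l. if l = i then of_nat j else y $ l) $ l)))" for z
    proof -
      define a where "a = (\<chi> l. if l \<in> I then z $ l else y $ l)"
      have 1: "(\<chi> l. if l \<in> insert i I then z $ l else y $ l) = (\<chi> l. if l = i then z $ i else a $ l)"
        by (auto simp: vec_eq_iff a_def)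
      have 2: "(\<chi> l. if l = i then of_nat j else a $ l)
        = (\<chi> l. if l \<in> I then z $ l else (\<chi> l. if l = i then of_nat j else y $ l) $ l)" for j
        using insert(2) by (auto simp: vec_eq_iff a_def)
      show ?thesis unfolding 1 inter 2
        by (intro sum.cong refl) (simp add: sum_distrib_left sum_distrib_right algebra_simps)
    qed
    show ?case unfolding eq
      by (intro polynomial_map_sum polynomial_map.cmult polynomial_map_power insert.IH)
  qed
  from this[of UNIV] show ?thesis by simp
qed

section \<open>The homogeneous expansion of a holomorphic function\<close>

text \<open>Holomorphy on complex lines is the form in which holomorphic functions are used throughout:
  it passes to locally uniform limits by the one-variable theorem.\<close>

definition line_holomorphic :: "(complex ^ 'n \<Rightarrow> complex) \<Rightarrow> (complex ^ 'n) set \<Rightarrow> bool" where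
  "line_holomorphic f S \<longleftrightarrow> (\<forall>a b. (\<lambda>\<mu>. f (a + \<mu> *s b)) holomorphic_on {\<mu>. a + \<mu> *s b \<in> S})"

lemma continuous_on_line: "continuous_on A (\<lambda>\<mu>. a + \<mu> *s (b :: complex ^ 'n))"
  unfolding vector_scalar_mult_def by (intro continuous_intros continuous_on_vec_lambda)

lemma open_line_preimage:
  assumes "open S"
  shows "open {\<mu>. a + \<mu> *s (b :: complex ^ 'n) \<in> S}"
  using open_vimage[OF assms continuous_on_line[of UNIV a b]] by (simp add: vimage_def)

lemma line_holomorphic_if_holomorphic_ball:
  fixes f :: "complex ^ 'n \<Rightarrow> complex"
  assumes "holomorphic_ball f"
  shows "line_holomorphic f (ball 0 1)"
  unfolding line_holomorphic_def
proof (intro allI)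
  fix a b :: "complex ^ 'n"
  show "(\<lambda>\<mu>. f (a + \<mu> *s b)) holomorphic_on {\<mu>. a + \<mu> *s b \<in> ball 0 1}"
  proof (subst holomorphic_on_open[OF open_line_preimage[OF open_ball]], intro ballI)
    fix \<mu> assume "\<mu> \<in> {\<mu>. a + \<mu> *s b \<in> ball 0 1}"
    then obtain D where D: "(f has_derivative D) (at (a + \<mu> *s b))" "\<And>c v. D (c *s v) = c * D v"
      using assms unfolding holomorphic_ball_def by blast
    have "bounded_linear (\<lambda>h. h *s b)"
    proof (rule bounded_linear_intro[where K = "norm b"])
      show "(r *\<^sub>R x) *s b = r *\<^sub>R (x *s b)" for r x
        by (simp only: scaleR_eq_vector_scalar_mult vector_smult_assoc scaleR_conv_of_real)
    qed (simp_all add: vector_sadd_rdistrib norm_vector_scalar_mult)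
    then have "((\<lambda>\<mu>. a + \<mu> *s b) has_derivative (\<lambda>h. h *s b)) (at \<mu>)"
      using has_derivative_add[OF has_derivative_const bounded_linear_imp_has_derivative] by fastforce
    from has_derivative_compose[OF this D(1)]
    have "((\<lambda>\<mu>. f (a + \<mu> *s b)) has_derivative (\<lambda>h. D (h *s b))) (at \<mu>)" .
    moreover have "(\<lambda>h. D (h *s b)) = (*) (D b)"
      by (simp add: fun_eq_iff D(2) mult.commute)
    ultimately have "((\<lambda>\<mu>. f (a + \<mu> *s b)) has_field_derivative D b) (at \<mu>)"
      unfolding has_field_derivative_def by (simp only:)
    then show "\<exists>f'. ((\<lambda>\<mu>. f (a + \<mu> *s b)) has_field_derivative f') (at \<mu>)" ..
  qed
qed

lemma line_holomorphic_scaled: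
  assumes "line_holomorphic f S" and "\<And>\<mu>. \<mu> \<in> U \<Longrightarrow> c *s (a + \<mu> *s b) \<in> S"
  shows "(\<lambda>\<mu>. f (c *s (a + \<mu> *s b))) holomorphic_on U"
proof -
  have "(\<lambda>\<mu>. f (c *s a + \<mu> *s (c *s b))) holomorphic_on {\<mu>. c *s a + \<mu> *s (c *s b) \<in> S}"
    using assms(1) unfolding line_holomorphic_def by blast
  moreover have "c *s a + \<mu> *s (c *s b) = c *s (a + \<mu> *s b)" for \<mu>
    by (simp add: vec_eq_iff algebra_simps)
  ultimately have "(\<lambda>\<mu>. f (c *s (a + \<mu> *s b))) holomorphic_on {\<mu>. c *s (a + \<mu> *s b) \<in> S}"
    by (simp only:)
  then show ?thesis by (rule holomorphic_on_subset) (use assms(2) in blast)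
qed

lemma continuous_on_if_holomorphic_ball:
  fixes f :: "complex ^ 'n \<Rightarrow> complex"
  assumes "holomorphic_ball f"
  shows "continuous_on (ball 0 1) f"
proof (intro continuous_at_imp_continuous_on ballI)
  fix z :: "complex ^ 'n" assume "z \<in> ball 0 1"
  then obtain D where "(f has_derivative D) (at z)"
    using assms unfolding holomorphic_ball_def by blast
  then show "isCont f z" by (rule has_derivative_continuous)
qed

text \<open>The coefficient of \<open>\<mu> ^ k\<close> in \<open>f (\<mu> z)\<close>. The derivatives are taken at \<open>\<mu> = 0\<close>, so the
  definition is meaningful for all \<open>z\<close>, also outside the domain of \<open>f\<close>.\<close>

definition taylor_part :: "(complex ^ 'n \<Rightarrow> complex) \<Rightarrow> nat \<Rightarrow> complex ^ 'n \<Rightarrow> complex" where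
  "taylor_part f k z = (deriv ^^ k) (\<lambda>\<mu>. f (\<mu> *s z)) 0 / fact k"

lemma line_holomorphic_radial:
  assumes "line_holomorphic f (ball 0 1)" "norm z * r \<le> 1"
  shows "(\<lambda>\<mu>. f (\<mu> *s z)) holomorphic_on ball 0 r"
proof -
  have "(\<lambda>\<mu>. f (0 + \<mu> *s z)) holomorphic_on {\<mu>. 0 + \<mu> *s z \<in> ball 0 1}"
    using assms(1) unfolding line_holomorphic_def by blast
  moreover have "ball 0 r \<subseteq> {\<mu>. 0 + \<mu> *s z \<in> ball 0 1}"
  proof
    fix \<mu> :: complex assume "\<mu> \<in> ball 0 r"
    then have "cmod \<mu> < r" by simp
    have "cmod \<mu> * norm z < 1"
    proof (cases "norm z = 0")
      case False
      then have "cmod \<mu> * norm z < r * norm z" using \<open>cmod \<mu> < r\<close> by (intro mult_strict_right_mono) auto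
      then show ?thesis using assms(2) by (simp add: mult.commute)
    qed simp
    then show "\<mu> \<in> {\<mu>. 0 + \<mu> *s z \<in> ball 0 1}" by (simp add: norm_vector_scalar_mult)
  qed
  ultimately have "(\<lambda>\<mu>. f (0 + \<mu> *s z)) holomorphic_on ball 0 r"
    by (rule holomorphic_on_subset)
  then show ?thesis by (simp only: add_0)
qed

lemma taylor_part_sums:
  assumes f: "line_holomorphic f (ball 0 1)" and "norm z * r \<le> 1" "cmod x < r"
  shows "(\<lambda>k. taylor_part f k z * x ^ k) sums f (x *s z)"
  using holomorphic_power_series[OF line_holomorphic_radial[OF assms(1,2)], of x] assms(3)
  by (simp add: taylor_part_def)

lemma taylor_part_homogeneous:
  assumes f: "line_holomorphic f (ball 0 1)"
  shows "taylor_part f k (c *s z) = c ^ k * taylor_part f k z"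
proof -
  define r where "r = 1 / (norm z + 1)"
  define e where "e = r / (cmod c + 1)"
  have pos: "norm z + 1 > 0" "cmod c + 1 > 0"
    by (simp_all add: add_nonneg_pos)
  have r: "r > 0" "norm z * r \<le> 1" using pos by (simp_all add: r_def)
  have e: "e > 0" using r pos by (simp add: e_def)
  have "c * w \<in> ball 0 r" if "w \<in> ball 0 e" for w
  proof -
    have "cmod c * cmod w \<le> cmod c * e" using that by (intro mult_left_mono) auto
    also have "\<dots> < (cmod c + 1) * e" using e by simp
    also have "\<dots> = r" using pos by (simp add: e_def)
    finally show ?thesis by (simp add: norm_mult)
  qed
  then have "(deriv ^^ k) (\<lambda>w. (\<lambda>\<mu>. f (\<mu> *s z)) (c * w)) 0 = c ^ k * (deriv ^^ k) (\<lambda>\<mu>. f (\<mu> *s z)) (c * 0)"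
    using e by (intro higher_deriv_compose_linear[OF line_holomorphic_radial[OF f r(2)], of "ball 0 e"]) auto
  moreover have "w *s (c *s z) = (c * w) *s z" for w
    by (simp only: vector_smult_assoc mult.commute)
  ultimately have "(deriv ^^ k) (\<lambda>w. f (w *s (c *s z))) 0 = c ^ k * (deriv ^^ k) (\<lambda>\<mu>. f (\<mu> *s z)) 0"
    by (simp only: mult_zero_right)
  then show ?thesis
    unfolding taylor_part_def by (simp only: times_divide_eq_right)
qed

text \<open>On the sphere of radius \<open>\<rho>\<close> this is Cauchy's inequality for \<open>\<mu> \<mapsto> f (\<mu> z)\<close> on the unit disc;
  homogeneity carries it to all other points.\<close>

lemma taylor_part_bound:
  fixes f :: "complex ^ 'n \<Rightarrow> complex"
  assumes f: "line_holomorphic f (ball 0 1)" and \<rho>: "0 < \<rho>" "\<rho> < 1"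
    and M: "\<And>x. norm x \<le> \<rho> \<Longrightarrow> cmod (f x) \<le> M"
  shows "cmod (taylor_part f k z) \<le> M * (norm z / \<rho>) ^ k"
proof (cases "z = 0")
  case True
  have M0: "M \<ge> 0" using order.trans[OF norm_ge_zero M[of 0]] \<rho> by simp
  show ?thesis
  proof (cases k)
    case 0
    then show ?thesis using True M[of 0] \<rho> by (simp add: taylor_part_def)
  next
    case (Suc l)
    then have "taylor_part f k (0 *s z) = 0"
      by (subst taylor_part_homogeneous[OF f]) simp
    then show ?thesis using True M0 by simp
  qed
next
  case False
  define y where "y = complex_of_real (\<rho> / norm z) *s z"
  have ny: "norm y = \<rho>" using False \<rho> by (simp add: y_def norm_vector_scalar_mult norm_divide)
  have zy: "z = complex_of_real (norm z / \<rho>) *s y"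
    using False \<rho> by (simp add: y_def flip: of_real_mult del: of_real_divide)
  have hol: "(\<lambda>\<mu>. f (\<mu> *s y)) holomorphic_on ball 0 (1 / \<rho>)"
    by (rule line_holomorphic_radial[OF f]) (use ny \<rho> in auto)
  have "cmod ((deriv ^^ k) (\<lambda>\<mu>. f (\<mu> *s y)) 0) \<le> fact k * M / 1 ^ k"
  proof (rule Cauchy_inequality)
    show "(\<lambda>\<mu>. f (\<mu> *s y)) holomorphic_on ball 0 1"
      by (rule holomorphic_on_subset[OF hol]) (use \<rho> in \<open>auto simp: subset_ball\<close>)
    have "1 < 1 / \<rho>" using \<rho> by simp
    then have "cball 0 1 \<subseteq> ball (0 :: complex) (1 / \<rho>)"
      unfolding subset_eq by (auto simp only: mem_cball_0 mem_ball_0 intro: le_less_trans)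
    then show "continuous_on (cball 0 1) (\<lambda>\<mu>. f (\<mu> *s y))"
      by (intro holomorphic_on_imp_continuous_on holomorphic_on_subset[OF hol])
  qed (use M ny in \<open>auto simp: norm_vector_scalar_mult\<close>)
  then have "cmod (taylor_part f k y) \<le> M"
    by (simp add: taylor_part_def norm_divide field_simps)
  then have "(norm z / \<rho>) ^ k * cmod (taylor_part f k y) \<le> (norm z / \<rho>) ^ k * M"
    using \<rho> by (intro mult_left_mono) auto
  moreover have "cmod (taylor_part f k z) = (norm z / \<rho>) ^ k * cmod (taylor_part f k y)"
    by (subst zy, subst taylor_part_homogeneous[OF f])
      (use \<rho> in \<open>simp only: norm_mult norm_power norm_of_real, simp\<close>)
  ultimately show ?thesis by (simp only: mult.commute)
qed

lemma bounded_on_cball: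
  fixes f :: "complex ^ 'n \<Rightarrow> complex"
  assumes "continuous_on (ball 0 1) f" "\<rho> < 1"
  obtains M where "\<And>x. norm x \<le> \<rho> \<Longrightarrow> cmod (f x) \<le> M"
proof -
  have "compact (f ` cball 0 \<rho>)"
    by (intro compact_continuous_image continuous_on_subset[OF assms(1)]) (use assms(2) in auto)
  then obtain M where "\<forall>x\<in>f ` cball 0 \<rho>. cmod x \<le> M"
    using compact_imp_bounded bounded_iff by blast
  then show ?thesis by (intro that[of M]) auto
qed


text \<open>By induction on the degree: the \<open>k\<close>-th part is the uniform limit, as the scale \<open>l\<close> tends to
  zero, of \<open>f (l z)\<close> minus its expansion up to degree \<open>k - 1\<close>, divided by \<open>l ^ k\<close>. On the ball of
  radius \<open>1 / 2\<close> all parts have a common bound, so the remainder is a geometric series.\<close>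

lemma line_holomorphic_taylor_part_half:
  fixes f :: "complex ^ 'n \<Rightarrow> complex"
  assumes cont: "continuous_on (ball 0 1) f" and f: "line_holomorphic f (ball 0 1)"
  shows "line_holomorphic (taylor_part f k) (ball 0 (1 / 2))"
proof (induction k rule: less_induct)
  case (less k)
  obtain M where M: "\<And>x. norm x \<le> 1 / 2 \<Longrightarrow> cmod (f x) \<le> M"
    using bounded_on_cball[OF cont, of "1 / 2"] by auto
  have M0: "M \<ge> 0" using order.trans[OF norm_ge_zero M[of 0]] by simp
  define l where "l = (\<lambda>N. 1 / (2 + real N))"
  have l: "0 < l N" "l N \<le> 1 / 2" for N by (auto simp: l_def field_simps)
  \<comment> \<open>The difference quotients that converge to the \<open>k\<close>-th part.\<close>
  define g where "g = (\<lambda>N x. (f (of_real (l N) *s x) - (\<Sum>j<k. taylor_part f j x * of_real (l N) ^ j)) / of_real (l N) ^ k)"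
  have est: "cmod (g N x - taylor_part f k x) \<le> 2 * M * l N" if x: "norm x < 1 / 2" for N and x :: "complex ^ 'n"
  proof -
    let ?a = "\<lambda>j. taylor_part f j x"
    let ?x = "complex_of_real (l N)"
    have "norm x * 1 \<le> 1" using x by simp
    then have sums: "(\<lambda>j. ?a j * ?x ^ j) sums f (?x *s x)"
      by (rule taylor_part_sums[OF f]) (use l[of N] in auto)
    have bd: "cmod (?a j) \<le> M" for j
    proof -
      have "cmod (?a j) \<le> M * (norm x / (1 / 2)) ^ j"
        by (rule taylor_part_bound[OF f]) (use M in auto)
      also have "\<dots> \<le> M * 1" using x M0 by (intro mult_left_mono power_le_one) auto
      finally show ?thesis by simp
    qed
    have "(\<lambda>i. ?a (i + Suc k) * ?x ^ (i + Suc k)) sums (f (?x *s x) - (\<Sum>j<Suc k. ?a j * ?x ^ j))"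
      using sums by (subst sums_iff_shift) simp
    moreover have "(\<lambda>i. M * l N ^ Suc k * l N ^ i) sums (M * l N ^ Suc k * (1 / (1 - l N)))"
      by (intro sums_mult geometric_sums) (use l[of N] in auto)
    ultimately have "cmod (f (?x *s x) - (\<Sum>j<Suc k. ?a j * ?x ^ j)) \<le> M * l N ^ Suc k * (1 / (1 - l N))"
    proof (rule norm_sums_le)
      fix i
      have "cmod (?a (i + Suc k) * ?x ^ (i + Suc k)) = cmod (?a (i + Suc k)) * (l N ^ Suc k * l N ^ i)"
        using l[of N] by (simp add: norm_mult norm_power power_add)
      also have "\<dots> \<le> M * (l N ^ Suc k * l N ^ i)"
        using l[of N] bd by (intro mult_right_mono) auto
      finally show "cmod (?a (i + Suc k) * ?x ^ (i + Suc k)) \<le> M * l N ^ Suc k * l N ^ i" by simp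
    qed
    also have "\<dots> \<le> M * l N ^ Suc k * 2"
      using l[of N] M0 by (intro mult_left_mono) (auto simp: field_simps)
    finally have b: "cmod (f (?x *s x) - (\<Sum>j<Suc k. ?a j * ?x ^ j)) \<le> 2 * M * l N * l N ^ k" by simp
    have "g N x - ?a k = (f (?x *s x) - (\<Sum>j<Suc k. ?a j * ?x ^ j)) / ?x ^ k"
      using l[of N] by (simp add: g_def field_simps)
    then have "cmod (g N x - ?a k) = cmod (f (?x *s x) - (\<Sum>j<Suc k. ?a j * ?x ^ j)) / l N ^ k"
      using l[of N] by (simp add: norm_divide norm_power)
    also have "\<dots> \<le> 2 * M * l N" using b l[of N] by (simp add: field_simps)
    finally show ?thesis .
  qed
  have "(\<lambda>N. 2 * M * l N) \<longlonglongrightarrow> 0"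
    unfolding l_def by real_asymp
  then have small: "\<forall>\<^sub>F N in sequentially. 2 * M * l N < e" if "e > 0" for e
    using that by (rule order_tendstoD)
  show ?case unfolding line_holomorphic_def
  proof (intro allI)
    fix a b :: "complex ^ 'n"
    let ?U = "{\<mu>. a + \<mu> *s b \<in> ball 0 (1 / 2)}"
    show "(\<lambda>\<mu>. taylor_part f k (a + \<mu> *s b)) holomorphic_on ?U"
    proof (rule holomorphic_uniform_sequence[of _ "\<lambda>N \<mu>. g N (a + \<mu> *s b)"])
      show op: "open ?U" by (intro open_line_preimage open_ball)
      fix N
      have "of_real (l N) *s (a + \<mu> *s b) \<in> ball 0 1" if "\<mu> \<in> ?U" for \<mu>
      proof -
        have "l N * norm (a + \<mu> *s b) \<le> 1 / 2 * (1 / 2)"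
          using that l[of N] by (intro mult_mono) auto
        moreover have "norm (of_real (l N) *s (a + \<mu> *s b)) = l N * norm (a + \<mu> *s b)"
          unfolding norm_vector_scalar_mult norm_of_real using l[of N] by simp
        ultimately show ?thesis by simp
      qed
      then have "(\<lambda>\<mu>. f (of_real (l N) *s (a + \<mu> *s b))) holomorphic_on ?U"
        by (rule line_holomorphic_scaled[OF f])
      moreover have "(\<lambda>\<mu>. taylor_part f j (a + \<mu> *s b)) holomorphic_on ?U" if "j < k" for j
        using less[OF that] unfolding line_holomorphic_def by blast
      ultimately show "(\<lambda>\<mu>. g N (a + \<mu> *s b)) holomorphic_on ?U"
        unfolding g_def using l[of N] by (intro holomorphic_intros) auto
    next
      fix \<mu> assume \<mu>: "\<mu> \<in> ?U"
      have "open ?U" by (intro open_line_preimage open_ball)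
      then obtain d where d: "d > 0" "cball \<mu> d \<subseteq> ?U" using \<mu> open_contains_cball by blast
      have "uniform_limit (cball \<mu> d) (\<lambda>N \<mu>. g N (a + \<mu> *s b)) (\<lambda>\<mu>. taylor_part f k (a + \<mu> *s b)) sequentially"
      proof (rule uniform_limitI)
        fix e :: real assume "e > 0"
        show "\<forall>\<^sub>F N in sequentially. \<forall>\<mu>\<in>cball \<mu> d. dist (g N (a + \<mu> *s b)) (taylor_part f k (a + \<mu> *s b)) < e"
          using small[OF \<open>e > 0\<close>]
        proof eventually_elim
          case (elim N)
          have "dist (g N (a + \<nu> *s b)) (taylor_part f k (a + \<nu> *s b)) < e" if "\<nu> \<in> cball \<mu> d" for \<nu>
          proof -
            have "norm (a + \<nu> *s b) < 1 / 2" using that d(2) by auto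
            from est[OF this, of N] show ?thesis using elim by (simp add: dist_norm)
          qed
          then show ?case by blast
        qed
      qed
      then show "\<exists>d>0. cball \<mu> d \<subseteq> ?U \<and>
          uniform_limit (cball \<mu> d) (\<lambda>N \<mu>. g N (a + \<mu> *s b)) (\<lambda>\<mu>. taylor_part f k (a + \<mu> *s b)) sequentially"
        using d by blast
    qed
  qed
qed

text \<open>Homogeneity shrinks any disc on a complex line into the ball of radius \<open>1 / 2\<close>.\<close>

lemma taylor_part_entire:
  fixes f :: "complex ^ 'n \<Rightarrow> complex"
  assumes cont: "continuous_on (ball 0 1) f" and f: "line_holomorphic f (ball 0 1)"
  shows "(\<lambda>\<mu>. taylor_part f k (a + \<mu> *s b)) holomorphic_on UNIV"
proof -
  have "(\<lambda>\<mu>. taylor_part f k (a + \<mu> *s b)) field_differentiable at \<mu>0" for \<mu>0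
  proof -
    define R where "R = norm \<mu>0 + 1"
    define D where "D = norm a + R * norm b + 1"
    have D: "D > 0" by (auto simp: D_def R_def intro!: add_nonneg_pos)
    define e where "e = complex_of_real (1 / (2 * D))"
    have e: "e \<noteq> 0" using D by (simp add: e_def)
    have "e *s (a + \<mu> *s b) \<in> ball 0 (1 / 2)" if "\<mu> \<in> ball 0 R" for \<mu>
    proof -
      have "norm (a + \<mu> *s b) \<le> norm a + cmod \<mu> * norm b"
        using norm_triangle_ineq[of a "\<mu> *s b"] by (simp add: norm_vector_scalar_mult)
      also have "\<dots> \<le> norm a + R * norm b" using that by (intro add_left_mono mult_right_mono) auto
      finally have "norm (a + \<mu> *s b) < D" by (simp add: D_def)
      moreover have "norm (e *s (a + \<mu> *s b)) = norm (a + \<mu> *s b) / (2 * D)"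
        unfolding norm_vector_scalar_mult e_def norm_of_real using D by simp
      ultimately show ?thesis using D by (simp add: divide_less_eq)
    qed
    then have "(\<lambda>\<mu>. taylor_part f k (e *s (a + \<mu> *s b))) holomorphic_on ball 0 R"
      by (rule line_holomorphic_scaled[OF line_holomorphic_taylor_part_half[OF cont f]])
    then have "(\<lambda>\<mu>. inverse (e ^ k) * taylor_part f k (e *s (a + \<mu> *s b))) holomorphic_on ball 0 R"
      by (intro holomorphic_intros)
    moreover have "inverse (e ^ k) * taylor_part f k (e *s z) = taylor_part f k z" for z
      using e by (simp add: taylor_part_homogeneous[OF f])
    ultimately have "(\<lambda>\<mu>. taylor_part f k (a + \<mu> *s b)) holomorphic_on ball 0 R"
      by (simp only:)
    then show ?thesis
      by (rule holomorphic_on_imp_differentiable_at) (auto simp: R_def)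
  qed
  then show ?thesis by (simp add: holomorphic_on_def)
qed

text \<open>Along a coordinate line the \<open>k\<close>-th part is entire and grows like the \<open>k\<close>-th power, so by
  Liouville it is a polynomial of degree at most \<open>k\<close> in that coordinate.\<close>

lemma homogeneous_poly_taylor_part:
  fixes f :: "complex ^ 'n \<Rightarrow> complex"
  assumes cont: "continuous_on (ball 0 1) f" and f: "line_holomorphic f (ball 0 1)"
  shows "homogeneous_poly k (taylor_part f k)"
proof (rule homogeneous_poly_if_polynomial_map[OF polynomial_map_if_separately taylor_part_homogeneous[OF f]])
  fix a :: "complex ^ 'n" and i
  define a' where "a' = (\<chi> l. if l = i then 0 else a $ l)"
  have eq: "(\<chi> l. if l = i then x else a $ l) = a' + x *s axis i 1" for x
    by (auto simp: vec_eq_iff a'_def axis_def)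
  obtain M where M: "\<And>x. norm x \<le> 1 / 2 \<Longrightarrow> cmod (f x) \<le> M"
    using bounded_on_cball[OF cont, of "1 / 2"] by auto
  have M0: "M \<ge> 0" using order.trans[OF norm_ge_zero M[of 0]] by simp
  have "taylor_part f k (a' + x *s axis i 1) =
      (\<Sum>l\<le>k. (deriv ^^ l) (\<lambda>x. taylor_part f k (a' + x *s axis i 1)) 0 / fact l * x ^ l)" for x
  proof (rule Liouville_polynomial[OF taylor_part_entire[OF cont f]])
    fix x :: complex assume x: "1 \<le> norm x"
    have "norm (a' + x *s axis i 1) \<le> norm a' + cmod x"
      using norm_triangle_ineq[of a' "x *s axis i 1"] by (simp add: norm_vector_scalar_mult)
    also have "\<dots> \<le> (norm a' + 1) * cmod x"
      using x mult_left_mono[OF x, of "norm a'"] by (simp add: algebra_simps)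
    finally have le: "norm (a' + x *s axis i 1) \<le> (norm a' + 1) * cmod x" .
    have "cmod (taylor_part f k (a' + x *s axis i 1)) \<le> M * (norm (a' + x *s axis i 1) / (1 / 2)) ^ k"
      by (rule taylor_part_bound[OF f]) (use M in auto)
    also have "\<dots> \<le> M * (2 * (norm a' + 1) * cmod x) ^ k"
    proof (intro mult_left_mono power_mono M0)
      show "norm (a' + x *s axis i 1) / (1 / 2) \<le> 2 * (norm a' + 1) * cmod x"
        using mult_left_mono[OF le, of 2] by simp (simp add: algebra_simps)
    qed auto
    also have "\<dots> = M * (2 * (norm a' + 1)) ^ k * cmod x ^ k"
      by (simp only: power_mult_distrib mult.assoc)
    finally show "cmod (taylor_part f k (a' + x *s axis i 1)) \<le> M * (2 * (norm a' + 1)) ^ k * cmod x ^ k" .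
  qed
  then show "\<exists>c. \<forall>x. taylor_part f k (\<chi> l. if l = i then x else a $ l) = (\<Sum>l\<le>k. c l * x ^ l)"
    unfolding eq by (intro exI allI)
qed

text \<open>Any two expansions agree: on \<open>\<mu> z\<close> with small \<open>\<mu>\<close> they are power series in \<open>\<mu>\<close> with the same
  sum. Since \<open>z\<close> may lie outside the ball, this determines the polynomials everywhere.\<close>

lemma homogeneous_expansion_eq_taylor_part:
  fixes f :: "complex ^ 'n \<Rightarrow> complex"
  assumes cont: "continuous_on (ball 0 1) f" and f: "line_holomorphic f (ball 0 1)"
  shows "homogeneous_expansion f = taylor_part f"
  unfolding homogeneous_expansion_def
proof (rule the_equality)
  have "(\<lambda>k. taylor_part f k z) sums f z" if z: "z \<in> ball 0 1" for z
  proof (cases "z = 0")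
    case True
    then show ?thesis using taylor_part_sums[OF f, of z 2 1] by simp
  next
    case False
    then show ?thesis using z taylor_part_sums[OF f, of z "1 / norm z" 1] by simp
  qed
  then show "(\<forall>k. homogeneous_poly k (taylor_part f k)) \<and> (\<forall>z\<in>ball 0 1. (\<lambda>k. taylor_part f k z) sums f z)"
    using homogeneous_poly_taylor_part[OF cont f] by blast
next
  fix F assume F: "(\<forall>k. homogeneous_poly k (F k)) \<and> (\<forall>z\<in>ball 0 1. (\<lambda>k. F k z) sums f z)"
  have "F k z = taylor_part f k z" for k z
  proof (rule ccontr)
    assume ne: "F k z \<noteq> taylor_part f k z"
    define r where "r = 1 / (norm z + 1)"
    have pos: "norm z + 1 > 0" by (simp add: add_nonneg_pos)
    then have r: "r > 0" "norm z * r \<le> 1" by (simp_all add: r_def)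
    define d where "d = (\<lambda>k. F k z - taylor_part f k z)"
    have sums: "(\<lambda>k. d k * (x - 0) ^ k) sums 0" if x: "norm (x - 0) < r" for x
    proof -
      have "cmod x * norm z \<le> r * norm z" using x by (intro mult_right_mono) auto
      also have "\<dots> < 1" using pos by (simp add: r_def)
      finally have "x *s z \<in> ball 0 1" by (simp add: norm_vector_scalar_mult)
      then have "(\<lambda>k. F k (x *s z)) sums f (x *s z)" using F by blast
      then have "(\<lambda>k. F k z * x ^ k) sums f (x *s z)"
        using homogeneous_poly_homogeneous[of k "F k" x z for k] F by (simp add: mult.commute)
      from sums_diff[OF this taylor_part_sums[OF f r(2), of x]] show ?thesis
        using x by (simp add: d_def algebra_simps)
    qed
    have d0: "d 0 = 0"
      using sums[of 0] r(1) by (auto simp: powser_sums_zero_iff)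
    show False
    proof (cases "k = 0")
      case True
      then show False using d0 ne by (simp add: d_def)
    next
      case False
      obtain s where s: "0 < s" "\<And>z. z \<in> cball 0 s - {0 :: complex} \<Longrightarrow> (\<lambda>_. 0 :: complex) z \<noteq> 0"
        by (rule powser_0_nonzero[OF r(1), of 0 d "\<lambda>_. 0" k]) (use sums ne False in \<open>auto simp: d_def\<close>)
      show False using s(2)[of "complex_of_real s"] s(1) by simp
    qed
  qed
  then show "F = taylor_part f" by blast
qed

lemma summable_powr_times_power:
  assumes x: "0 < x" "x < (1 :: real)"
  shows "summable (\<lambda>k. (1 + real k) powr t * x ^ k)"
proof (rule summable_comparison_test_ev)
  define q where "q = sqrt x"
  have q: "0 < q" "q < 1" "x = q * q" using x by (auto simp: q_def)
  have "(\<lambda>k. (1 + real k) powr t * q ^ k) \<longlonglongrightarrow> 0"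
    using q by real_asymp
  then have "\<forall>\<^sub>F k in sequentially. (1 + real k) powr t * q ^ k < 1"
    by (rule order_tendstoD) simp
  then show "\<forall>\<^sub>F k in sequentially. norm ((1 + real k) powr t * x ^ k) \<le> q ^ k"
  proof eventually_elim
    case (elim k)
    have "(1 + real k) powr t * x ^ k = ((1 + real k) powr t * q ^ k) * q ^ k"
      by (simp add: q power_mult_distrib)
    also have "\<dots> \<le> 1 * q ^ k" using elim q by (intro mult_right_mono) auto
    finally show ?case using x by simp
  qed
  show "summable (\<lambda>k. q ^ k)" using q by simp
qed

text \<open>The parts decay geometrically on a smaller ball, which absorbs the polynomially growing factors.\<close>

lemma radial_power_uniform_limit:
  fixes f :: "complex ^ 'n \<Rightarrow> complex"
  assumes cont: "continuous_on (ball 0 1) f" and f: "line_holomorphic f (ball 0 1)" and \<rho>: "0 < \<rho>" "\<rho> < 1"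
  shows "uniform_limit (cball 0 \<rho>)
    (\<lambda>n z. \<Sum>k<n. of_real ((1 + real k) powr t) * taylor_part f k z) (radial_power t f) sequentially"
proof -
  define \<rho>' where "\<rho>' = (1 + \<rho>) / 2"
  have \<rho>': "\<rho> < \<rho>'" "0 < \<rho>'" "\<rho>' < 1" using \<rho> by (auto simp: \<rho>'_def)
  obtain M where M: "\<And>x. norm x \<le> \<rho>' \<Longrightarrow> cmod (f x) \<le> M"
    using bounded_on_cball[OF cont \<rho>'(3)] by auto
  have M0: "M \<ge> 0" using order.trans[OF norm_ge_zero M[of 0]] \<rho>' by simp
  have "uniform_limit (cball 0 \<rho>)
    (\<lambda>n z. \<Sum>k<n. of_real ((1 + real k) powr t) * taylor_part f k z)
    (\<lambda>z. \<Sum>k. of_real ((1 + real k) powr t) * taylor_part f k z) sequentially"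
  proof (rule Weierstrass_m_test)
    show "summable (\<lambda>k. M * ((1 + real k) powr t * (\<rho> / \<rho>') ^ k))"
      using \<rho> \<rho>' by (intro summable_mult summable_powr_times_power) auto
    fix k and z :: "complex ^ 'n" assume z: "z \<in> cball 0 \<rho>"
    have "cmod (taylor_part f k z) \<le> M * (norm z / \<rho>') ^ k"
      by (rule taylor_part_bound[OF f]) (use M \<rho>' in auto)
    also have "\<dots> \<le> M * (\<rho> / \<rho>') ^ k"
      using z M0 \<rho>' by (intro mult_left_mono power_mono divide_right_mono) auto
    finally have "(1 + real k) powr t * cmod (taylor_part f k z) \<le> (1 + real k) powr t * (M * (\<rho> / \<rho>') ^ k)"
      by (intro mult_left_mono) auto
    then show "cmod (of_real ((1 + real k) powr t) * taylor_part f k z) \<le> M * ((1 + real k) powr t * (\<rho> / \<rho>') ^ k)"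
      by (simp add: norm_mult mult_ac)
  qed
  then show ?thesis
    by (simp add: radial_power_def[abs_def] homogeneous_expansion_eq_taylor_part[OF cont f])
qed

lemma continuous_on_radial_power:
  fixes f :: "complex ^ 'n \<Rightarrow> complex"
  assumes cont: "continuous_on (ball 0 1) f" and f: "line_holomorphic f (ball 0 1)"
  shows "continuous_on (ball 0 1) (radial_power t f)"
proof (rule continuous_at_imp_continuous_on, rule ballI)
  fix z :: "complex ^ 'n" assume z: "z \<in> ball 0 1"
  define \<rho> where "\<rho> = (1 + norm z) / 2"
  have \<rho>: "0 < \<rho>" "\<rho> < 1" "norm z < \<rho>" using z by (auto simp: \<rho>_def intro: add_pos_nonneg)
  have "continuous_on (cball 0 \<rho>) (radial_power t f)"
    by (rule uniform_limit_theorem[OF _ radial_power_uniform_limit[OF cont f \<rho>(1,2)]])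
      (auto intro!: always_eventually continuous_intros
          continuous_on_homogeneous_poly[OF homogeneous_poly_taylor_part[OF cont f]])
  then have "continuous_on (ball 0 \<rho>) (radial_power t f)"
    by (rule continuous_on_subset) auto
  then show "isCont (radial_power t f) z"
    using \<rho>(3) by (simp add: continuous_on_eq_continuous_at)
qed

lemma line_holomorphic_radial_power:
  fixes f :: "complex ^ 'n \<Rightarrow> complex"
  assumes cont: "continuous_on (ball 0 1) f" and f: "line_holomorphic f (ball 0 1)"
  shows "line_holomorphic (radial_power t f) (ball 0 1)"
  unfolding line_holomorphic_def
proof (intro allI)
  fix a b :: "complex ^ 'n"
  let ?U = "{\<mu>. a + \<mu> *s b \<in> ball 0 1}"
  let ?S = "\<lambda>n z. \<Sum>k<n. of_real ((1 + real k) powr t) * taylor_part f k z"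
  show "(\<lambda>\<mu>. radial_power t f (a + \<mu> *s b)) holomorphic_on ?U"
  proof (rule holomorphic_uniform_sequence[of _ "\<lambda>n \<mu>. ?S n (a + \<mu> *s b)"])
    show "open ?U" by (intro open_line_preimage open_ball)
    show "(\<lambda>\<mu>. ?S n (a + \<mu> *s b)) holomorphic_on ?U" for n
      by (intro holomorphic_intros holomorphic_on_subset[OF taylor_part_entire[OF cont f]]) auto
  next
    fix \<mu> assume \<mu>: "\<mu> \<in> ?U"
    define \<rho> where "\<rho> = (1 + norm (a + \<mu> *s b)) / 2"
    have \<rho>: "0 < \<rho>" "\<rho> < 1" "norm (a + \<mu> *s b) < \<rho>" using \<mu> by (auto simp: \<rho>_def intro: add_pos_nonneg)
    have "open {\<mu>. a + \<mu> *s b \<in> ball 0 \<rho>}" by (intro open_line_preimage open_ball)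
    then obtain d where d: "d > 0" "cball \<mu> d \<subseteq> {\<mu>. a + \<mu> *s b \<in> ball 0 \<rho>}"
      using \<rho>(3) by (auto simp: open_contains_cball)
    have "cball \<mu> d \<subseteq> ?U" using d(2) \<rho>(2) by auto
    moreover have "uniform_limit (cball \<mu> d) (\<lambda>n \<mu>. ?S n (a + \<mu> *s b)) (\<lambda>\<mu>. radial_power t f (a + \<mu> *s b)) sequentially"
    proof (rule uniform_limitI)
      fix e :: real assume "e > 0"
      with radial_power_uniform_limit[OF cont f \<rho>(1,2), of t]
      have "\<forall>\<^sub>F n in sequentially. \<forall>z\<in>cball 0 \<rho>. dist (?S n z) (radial_power t f z) < e"
        unfolding uniform_limit_iff by blast
      then show "\<forall>\<^sub>F n in sequentially. \<forall>\<mu>\<in>cball \<mu> d. dist (?S n (a + \<mu> *s b)) (radial_power t f (a + \<mu> *s b)) < e"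
        by eventually_elim (use d(2) in force)
    qed
    ultimately show "\<exists>d>0. cball \<mu> d \<subseteq> ?U \<and> uniform_limit (cball \<mu> d) (\<lambda>n \<mu>. ?S n (a + \<mu> *s b))
        (\<lambda>\<mu>. radial_power t f (a + \<mu> *s b)) sequentially"
      using d(1) by blast
  qed
qed

section \<open>Mean values of holomorphic functions over balanced sets\<close>

lemma nn_integral_lborel_affine:
  fixes t :: "'a::euclidean_space"
  assumes [measurable]: "f \<in> borel_measurable borel" and c: "c \<noteq> 0"
  shows "(\<integral>\<^sup>+x. f x \<partial>lborel) = ennreal (\<bar>c\<bar> ^ DIM('a)) * (\<integral>\<^sup>+x. f (t + c *\<^sub>R x) \<partial>lborel)"
  by (subst lborel_affine[OF c, of t])
     (simp add: nn_integral_density nn_integral_distr nn_integral_cmult)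

lemma nn_integral_lborel_translate:
  fixes t :: "'a::euclidean_space"
  assumes "f \<in> borel_measurable borel"
  shows "(\<integral>\<^sup>+x. f (t + x) \<partial>lborel) = (\<integral>\<^sup>+x. f x \<partial>lborel)"
  using nn_integral_lborel_affine[OF assms, of 1 t] by simp

lemma nn_integral_lborel_reflect:
  fixes t :: "'a::euclidean_space"
  assumes "f \<in> borel_measurable borel"
  shows "(\<integral>\<^sup>+x. f (t - x) \<partial>lborel) = (\<integral>\<^sup>+x. f x \<partial>lborel)"
  using nn_integral_lborel_affine[OF assms, of "-1" t] by simp

lemma emeasure_lborel_scaled:
  fixes K :: "'a::euclidean_space set"
  assumes K: "K \<in> sets borel" and c: "c > 0"
  shows "emeasure lborel {x. (1 / c) *\<^sub>R x \<in> K} = ennreal (c ^ DIM('a)) * emeasure lborel K"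
proof -
  have [measurable]: "{x. (1 / c) *\<^sub>R x \<in> K} \<in> sets borel"
    using measurable_sets_borel[of "\<lambda>x :: 'a. (1 / c) *\<^sub>R x" borel K] K by (simp add: vimage_def)
  have "emeasure lborel {x. (1 / c) *\<^sub>R x \<in> K} = (\<integral>\<^sup>+x. indicator {x. (1 / c) *\<^sub>R x \<in> K} x \<partial>lborel)"
    by simp
  also have "\<dots> = ennreal (\<bar>c\<bar> ^ DIM('a)) * (\<integral>\<^sup>+x. indicator {x. (1 / c) *\<^sub>R x \<in> K} (0 + c *\<^sub>R x) \<partial>lborel)"
    by (rule nn_integral_lborel_affine) (use c in auto)
  also have "(\<integral>\<^sup>+x. indicator {x. (1 / c) *\<^sub>R x \<in> K} (0 + c *\<^sub>R x) \<partial>lborel) = (\<integral>\<^sup>+x. indicator K x \<partial>lborel)"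
    using c by (intro nn_integral_cong) (auto simp: indicator_def)
  finally show ?thesis using c K by simp
qed

text \<open>Uniqueness of Haar measure in the form needed here: both sides, multiplied by the volume of
  the unit ball, equal the integral of \<open>f (T x) * indicator (ball 0 1) (T x + y)\<close> over all pairs
  \<open>(x, y)\<close>, computed in the two possible orders.\<close>

lemma nn_integral_lborel_linear_isometry:
  fixes T U :: "'a::euclidean_space \<Rightarrow> 'a"
  assumes T: "linear T" "\<And>x. norm (T x) = norm x" and UT: "\<And>x. T (U x) = x"
    and f[measurable]: "f \<in> borel_measurable borel"
  shows "(\<integral>\<^sup>+x. f (T x) \<partial>lborel) = (\<integral>\<^sup>+x. f x \<partial>lborel)"
proof -
  have Tm[measurable]: "T \<in> borel_measurable borel"
    using T(1) by (intro borel_measurable_continuous_onI linear_continuous_on) (simp add: linear_conv_bounded_linear)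
  define g :: "'a \<Rightarrow> ennreal" where "g = indicator (ball 0 1)"
  have g[measurable]: "g \<in> borel_measurable borel" unfolding g_def by (rule borel_measurable_indicator) simp
  let ?V = "emeasure lborel (ball 0 1 :: 'a set)"
  have gT: "(\<integral>\<^sup>+x. g (T x) \<partial>lborel) = ?V"
  proof -
    have "g (T x) = g x" for x by (simp add: g_def indicator_def T(2))
    then show ?thesis by (simp add: g_def)
  qed
  have "(\<integral>\<^sup>+x. f (T x) \<partial>lborel) * ?V = (\<integral>\<^sup>+x. \<integral>\<^sup>+y. f (T x) * g (T x + y) \<partial>lborel \<partial>lborel)"
  proof -
    have "(\<integral>\<^sup>+y. f (T x) * g (T x + y) \<partial>lborel) = f (T x) * ?V" for x
      using nn_integral_lborel_translate[OF g, of "T x"]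
      by (simp add: nn_integral_cmult) (simp add: g_def)
    then show ?thesis by (simp add: nn_integral_multc)
  qed
  also have "\<dots> = (\<integral>\<^sup>+y. \<integral>\<^sup>+x. f (T x) * g (T x + y) \<partial>lborel \<partial>lborel)"
    by (rule lborel_pair.Fubini'[symmetric]) measurable
  also have "\<dots> = (\<integral>\<^sup>+y. \<integral>\<^sup>+x. f (T x - y) * g (T x) \<partial>lborel \<partial>lborel)"
  proof (rule nn_integral_cong)
    fix y
    have "(\<integral>\<^sup>+x. f (T x) * g (T x + y) \<partial>lborel) = (\<integral>\<^sup>+x. f (T (- U y + x)) * g (T (- U y + x) + y) \<partial>lborel)"
      by (rule nn_integral_lborel_translate[symmetric]) measurable
    then show "(\<integral>\<^sup>+x. f (T x) * g (T x + y) \<partial>lborel) = (\<integral>\<^sup>+x. f (T x - y) * g (T x) \<partial>lborel)"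
      by (simp add: linear_add[OF T(1)] linear_neg[OF T(1)] linear_diff[OF T(1)] UT)
  qed
  also have "\<dots> = (\<integral>\<^sup>+x. \<integral>\<^sup>+y. f (T x - y) * g (T x) \<partial>lborel \<partial>lborel)"
    by (rule lborel_pair.Fubini') measurable
  also have "\<dots> = (\<integral>\<^sup>+y. f y \<partial>lborel) * ?V"
    by (simp add: nn_integral_multc nn_integral_cmult nn_integral_lborel_reflect[OF f] gT)
  finally have "(\<integral>\<^sup>+x. f (T x) \<partial>lborel) * ?V = (\<integral>\<^sup>+y. f y \<partial>lborel) * ?V" .
  moreover have "emeasure lborel {} < ?V"
  proof -
    have "0 < measure lborel (ball 0 1 :: 'a set)" by (simp add: content_ball_pos)
    then show ?thesis by (simp add: measure_def enn2real_positive_iff)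
  qed
  moreover have "?V < \<infinity>" by (rule emeasure_lborel_ball_finite)
  ultimately show ?thesis
    using mult_divide_eq_ennreal[of ?V] by (metis emeasure_empty infinity_ennreal_def less_irrefl)
qed

lemma nn_integral_lborel_rotate:
  fixes f :: "complex ^ 'n \<Rightarrow> ennreal"
  assumes c: "cmod c = 1" and f: "f \<in> borel_measurable borel"
  shows "(\<integral>\<^sup>+x. f (c *s x) \<partial>lborel) = (\<integral>\<^sup>+x. f x \<partial>lborel)"
proof (rule nn_integral_lborel_linear_isometry[OF _ _ _ f])
  show "linear (\<lambda>x :: complex ^ 'n. c *s x)"
    by (rule linearI) (simp_all add: vector_add_ldistrib scaleR_eq_vector_scalar_mult mult.commute)
  show "norm (c *s x) = norm x" for x :: "complex ^ 'n" by (simp add: norm_vector_scalar_mult c)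
  have "c * cnj c = 1" using c by (simp add: complex_norm_square[symmetric])
  then show "c *s (cnj c *s x) = x" for x :: "complex ^ 'n" by simp
qed

definition circ :: "real \<Rightarrow> complex" where
  "circ t = exp (2 * of_real pi * \<i> * of_real t)"

lemma circle_mean_value:
  assumes h: "h holomorphic_on S" "open S" "cball 0 1 \<subseteq> S"
  shows "ennreal (cmod (h 0)) \<le> (\<integral>\<^sup>+t\<in>{0..1}. ennreal (cmod (h (circ t))) \<partial>lborel)"
proof -
  have cont: "continuous_on (cball 0 1) h"
    using h(1,3) holomorphic_on_imp_continuous_on holomorphic_on_subset by blast
  have "((\<lambda>u. h u / (u - 0)) has_contour_integral (2 * of_real pi * \<i> * h 0)) (circlepath 0 1)"
    by (rule Cauchy_integral_circlepath[OF cont])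
      (use h(3) ball_subset_cball in \<open>force intro!: holomorphic_on_subset[OF h(1)]\<close>)+
  then have "contour_integral (circlepath 0 1) (\<lambda>u. h u / (u - 0)) = 2 * of_real pi * \<i> * h 0"
    by (rule contour_integral_unique)
  then have "2 * of_real pi * \<i> * h 0
    = integral {0..1} (\<lambda>t. h (circlepath 0 1 t) / (circlepath 0 1 t - 0) * vector_derivative (circlepath 0 1) (at t))"
    by (simp only: contour_integral_integral)
  also have "\<dots> = integral {0..1} (\<lambda>t. (2 * of_real pi * \<i>) * h (circ t))"
    by (intro integral_cong) (simp only: vector_derivative_circlepath, simp add: circlepath circ_def)
  also have "\<dots> = (2 * of_real pi * \<i>) * integral {0..1} (\<lambda>t. h (circ t))"
    by (rule integral_mult_right)
  finally have eq: "h 0 = integral {0..1} (\<lambda>t. h (circ t))" by simp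
  have contc: "continuous_on {0..1} (\<lambda>t. h (circ t))"
    by (rule continuous_on_compose2[OF cont]) (auto intro!: continuous_intros simp: circ_def)
  have "cmod (h 0) \<le> integral {0..1} (\<lambda>t. cmod (h (circ t)))"
    unfolding eq by (intro integral_norm_bound_integral integrable_continuous_interval contc continuous_on_norm) auto
  also have "ennreal \<dots> = (\<integral>\<^sup>+t\<in>{0..1}. ennreal (cmod (h (circ t))) \<partial>lborel)"
    by (rule nn_integral_has_integral_lebesgue'[symmetric])
      (auto intro!: integrable_integral integrable_continuous_interval contc continuous_on_norm)
  finally show ?thesis by (simp add: ennreal_leI)
qed

lemma mult_right_mono_indicator:
  fixes a b :: ennreal
  shows "(x \<in> K \<Longrightarrow> a \<le> b) \<Longrightarrow> a * indicator K x \<le> b * indicator K x"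
  by (cases "x \<in> K") auto

text \<open>A set invariant under unimodular scalars, together with the invariance of Lebesgue measure under
  them, turns mean values over circles into mean values over the set.\<close>

lemma volume_mean_value:
  fixes \<phi> :: "complex ^ 'n \<Rightarrow> ennreal"
  assumes [measurable]: "\<phi> \<in> borel_measurable borel" "K \<in> sets borel"
    and circled: "\<And>c u. cmod c = 1 \<Longrightarrow> u \<in> K \<Longrightarrow> c *s u \<in> K"
    and mean: "\<And>u. u \<in> K \<Longrightarrow> \<phi> z \<le> (\<integral>\<^sup>+t\<in>{0..1}. \<phi> (z + circ t *s u) \<partial>lborel)"
  shows "\<phi> z * emeasure lborel K \<le> (\<integral>\<^sup>+u\<in>K. \<phi> (z + u) \<partial>lborel)"
proof -
  have [measurable]: "(\<lambda>x. circ (fst x) *s snd x) \<in> borel_measurable (borel \<Otimes>\<^sub>M (borel :: (complex ^ 'n) measure))"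
    unfolding borel_prod vector_scalar_mult_def circ_def
    by (intro borel_measurable_continuous_onI continuous_intros continuous_on_vec_lambda)
  have [measurable]: "(\<lambda>x. circ (snd x) *s fst x) \<in> borel_measurable ((borel :: (complex ^ 'n) measure) \<Otimes>\<^sub>M borel)"
    unfolding borel_prod vector_scalar_mult_def circ_def
    by (intro borel_measurable_continuous_onI continuous_intros continuous_on_vec_lambda)
  have [measurable]: "(\<lambda>t. circ t *s u) \<in> borel_measurable borel" for u :: "complex ^ 'n"
    unfolding vector_scalar_mult_def circ_def
    by (intro borel_measurable_continuous_onI continuous_intros continuous_on_vec_lambda)
  have c1: "cmod (circ t) = 1" for t by (simp add: circ_def norm_exp_eq_Re)
  have K_iff: "indicator K (circ t *s u) = (indicator K u :: ennreal)" for t u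
  proof -
    have "circ t *s u \<in> K \<Longrightarrow> cnj (circ t) *s (circ t *s u) \<in> K"
      by (rule circled) (use c1 in \<open>simp_all only: complex_mod_cnj\<close>)
    moreover have "cnj (circ t) * circ t = 1"
      using c1[of t] by (metis complex_norm_square mult.commute of_real_1 one_power2)
    ultimately show ?thesis using circled[OF c1, of u t] by (auto simp: indicator_def)
  qed
  have "\<phi> z * emeasure lborel K = (\<integral>\<^sup>+u. \<phi> z * indicator K u \<partial>lborel)"
    by (simp add: nn_integral_cmult)
  also have "\<dots> \<le> (\<integral>\<^sup>+u. (\<integral>\<^sup>+t\<in>{0..1}. \<phi> (z + circ t *s u) \<partial>lborel) * indicator K u \<partial>lborel)"
    by (intro nn_integral_mono mult_right_mono_indicator mean)
  also have "\<dots> = (\<integral>\<^sup>+u. \<integral>\<^sup>+t. \<phi> (z + circ t *s u) * indicator {0..1} t * indicator K u \<partial>lborel \<partial>lborel)"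
    by (intro nn_integral_cong nn_integral_multc[symmetric]) measurable
  also have "\<dots> = (\<integral>\<^sup>+t. \<integral>\<^sup>+u. \<phi> (z + circ t *s u) * indicator {0..1} t * indicator K u \<partial>lborel \<partial>lborel)"
    by (rule lborel_pair.Fubini'[symmetric]) measurable
  also have "\<dots> = (\<integral>\<^sup>+t. (\<integral>\<^sup>+u\<in>K. \<phi> (z + u) \<partial>lborel) * indicator {0..1} (t :: real) \<partial>lborel)"
  proof (rule nn_integral_cong)
    fix t :: real
    have "(\<integral>\<^sup>+u. \<phi> (z + circ t *s u) * indicator {0..1} t * indicator K u \<partial>lborel)
        = (\<integral>\<^sup>+u. (\<lambda>u. \<phi> (z + u) * indicator K u * indicator {0..1} t) (circ t *s u) \<partial>lborel)"
      by (intro nn_integral_cong) (simp add: K_iff mult_ac)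
    also have "\<dots> = (\<integral>\<^sup>+u. \<phi> (z + u) * indicator K u * indicator {0..1} t \<partial>lborel)"
      by (rule nn_integral_lborel_rotate[OF c1]) measurable
    also have "\<dots> = (\<integral>\<^sup>+u\<in>K. \<phi> (z + u) \<partial>lborel) * indicator {0..1} t"
      by (rule nn_integral_multc) measurable
    finally show "(\<integral>\<^sup>+u. \<phi> (z + circ t *s u) * indicator {0..1} t * indicator K u \<partial>lborel)
       = (\<integral>\<^sup>+u\<in>K. \<phi> (z + u) \<partial>lborel) * indicator {0..1} t" .
  qed
  also have "\<dots> = (\<integral>\<^sup>+u\<in>K. \<phi> (z + u) \<partial>lborel)"
    by (simp add: nn_integral_cmult)
  finally show ?thesis .
qed

lemma sub_mean_value:
  fixes G :: "complex ^ 'n \<Rightarrow> complex"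
  assumes cont: "continuous_on (ball 0 1) G" and hol: "line_holomorphic G (ball 0 1)"
    and K[measurable]: "K \<in> sets borel"
    and balanced: "\<And>c u. cmod c \<le> 1 \<Longrightarrow> u \<in> K \<Longrightarrow> c *s u \<in> K"
    and sub: "\<And>u. u \<in> K \<Longrightarrow> z + u \<in> ball 0 1" and z: "z \<in> ball 0 1"
  shows "ennreal (cmod (G z)) * emeasure lborel K \<le> (\<integral>\<^sup>+u\<in>K. ennreal (cmod (G (z + u))) \<partial>lborel)"
proof -
  define \<phi> where "\<phi> x = ennreal (cmod (indicator (ball 0 1) x *\<^sub>R G x))" for x
  have G[measurable]: "(\<lambda>x. indicator (ball 0 1) x *\<^sub>R G x) \<in> borel_measurable borel"
    by (rule borel_measurable_continuous_on_indicator) (use cont in auto)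
  have [measurable]: "\<phi> \<in> borel_measurable borel" unfolding \<phi>_def by measurable
  have "\<phi> z * emeasure lborel K \<le> (\<integral>\<^sup>+u\<in>K. \<phi> (z + u) \<partial>lborel)"
  proof (rule volume_mean_value)
    fix u assume u: "u \<in> K"
    have c1: "cmod (circ t) = 1" for t by (simp add: circ_def norm_exp_eq_Re)
    let ?S = "{\<mu>. z + \<mu> *s u \<in> ball 0 1}"
    have in_ball: "z + \<mu> *s u \<in> ball 0 1" if "cmod \<mu> \<le> 1" for \<mu>
      using sub[OF balanced[OF that u]] .
    have "ennreal (cmod (G (z + 0 *s u))) \<le> (\<integral>\<^sup>+t\<in>{0..1}. ennreal (cmod (G (z + circ t *s u))) \<partial>lborel)"
    proof (rule circle_mean_value)
      show "(\<lambda>\<mu>. G (z + \<mu> *s u)) holomorphic_on ?S"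
        using hol unfolding line_holomorphic_def by blast
      show "open ?S" by (intro open_line_preimage open_ball)
      show "cball 0 1 \<subseteq> ?S" using in_ball by (auto simp only: mem_cball_0 mem_Collect_eq subset_eq)
    qed
    moreover have "\<phi> (z + circ t *s u) = ennreal (cmod (G (z + circ t *s u)))" for t
      using in_ball[of "circ t"] c1 by (simp only: \<phi>_def indicator_simps order_refl scaleR_one)
    moreover have "\<phi> z = ennreal (cmod (G (z + 0 *s u)))" using z by (simp add: \<phi>_def)
    ultimately show "\<phi> z \<le> (\<integral>\<^sup>+t\<in>{0..1}. \<phi> (z + circ t *s u) \<partial>lborel)" by simp
  qed (use balanced in auto)
  moreover have "(\<integral>\<^sup>+u\<in>K. \<phi> (z + u) \<partial>lborel) = (\<integral>\<^sup>+u\<in>K. ennreal (cmod (G (z + u))) \<partial>lborel)"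
    by (intro nn_integral_cong) (use sub in \<open>auto simp: \<phi>_def indicator_def\<close>)
  ultimately show ?thesis using z by (simp add: \<phi>_def)
qed


text \<open>An argument of Hardy and Littlewood. Let \<open>m\<close> be the dimension and \<open>s\<close> the supremum of
  \<open>\<bar>G (z + t x)\<bar>\<close>, weighted by \<open>(1 - t) ^ (2 * m)\<close>, over \<open>x\<close> in \<open>K\<close> and \<open>t < 1\<close>. The sub-mean value
  property at \<open>z + t x\<close> over a small copy of \<open>K\<close>, with one of the two factors \<open>sqrt \<bar>G\<bar>\<close> of the
  integrand estimated by \<open>sqrt s\<close>, bounds \<open>s\<close> by \<open>sqrt s\<close> times the integral of \<open>sqrt \<bar>G\<bar>\<close>. As \<open>s\<close>
  is finite, \<open>sqrt s\<close> cancels.\<close>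

lemma sqrt_sub_mean_value:
  fixes G :: "complex ^ 'n \<Rightarrow> complex"
  assumes cont: "continuous_on (ball 0 1) G" and hol: "line_holomorphic G (ball 0 1)"
    and K: "open K" "convex K" and balanced: "\<And>c u. cmod c \<le> 1 \<Longrightarrow> u \<in> K \<Longrightarrow> c *s u \<in> K"
    and Kfin: "0 < emeasure lborel K" "emeasure lborel K < \<infinity>"
    and sub: "\<And>u. u \<in> K \<Longrightarrow> z + u \<in> ball 0 1"
    and bound: "\<And>u. u \<in> K \<Longrightarrow> cmod (G (z + u)) \<le> M"
  shows "ennreal (sqrt (cmod (G z))) * emeasure lborel K
    \<le> ennreal (4 ^ DIM(complex ^ 'n)) * (\<integral>\<^sup>+u\<in>K. ennreal (sqrt (cmod (G (z + u)))) \<partial>lborel)"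
proof -
  define m where "m = DIM(complex ^ 'n)"
  have Kb[measurable]: "K \<in> sets borel" using K(1) by simp
  have "K \<noteq> {}" using Kfin(1) by auto
  then obtain k0 where "k0 \<in> K" by blast
  then have "0 *s k0 \<in> K" by (intro balanced) auto
  then have K0: "0 \<in> K" by simp
  have Kr: "t *\<^sub>R u \<in> K" if "0 \<le> t" "t \<le> 1" "u \<in> K" for t u
    unfolding scaleR_eq_vector_scalar_mult by (rule balanced) (use that in auto)
  obtain v where v: "emeasure lborel K = ennreal v" "v > 0"
    using Kfin by (cases "emeasure lborel K") auto
  have M0: "M \<ge> 0" using bound[OF K0] norm_ge_zero order.trans by blast
  define \<psi> where "\<psi> w = ennreal (sqrt (cmod (indicator (ball 0 1) (z + w) *\<^sub>R G (z + w)))) * indicator K w" for w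
  have G[measurable]: "(\<lambda>x. indicator (ball 0 1) x *\<^sub>R G x) \<in> borel_measurable borel"
    by (rule borel_measurable_continuous_on_indicator) (use cont in auto)
  have [measurable]: "(\<lambda>w. indicator (ball 0 1) (z + w) *\<^sub>R G (z + w)) \<in> borel_measurable borel"
    by (rule measurable_compose[OF _ G]) measurable
  have \<psi>m[measurable]: "\<psi> \<in> borel_measurable borel" unfolding \<psi>_def by measurable
  have \<psi>eq: "\<psi> w = ennreal (sqrt (cmod (G (z + w)))) * indicator K w" for w
    using sub[of w] by (auto simp: \<psi>_def indicator_def)
  define I where "I = (\<integral>\<^sup>+u\<in>K. ennreal (sqrt (cmod (G (z + u)))) \<partial>lborel)"
  have I\<psi>: "I = (\<integral>\<^sup>+u. \<psi> u \<partial>lborel)" unfolding I_def \<psi>eq ..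
  have "I \<le> (\<integral>\<^sup>+u\<in>K. ennreal (sqrt M) \<partial>lborel)"
    unfolding I_def by (intro nn_integral_mono mult_right_mono_indicator ennreal_leI real_sqrt_le_mono bound)
  also have "\<dots> = ennreal (sqrt M) * emeasure lborel K" by (simp add: nn_integral_cmult)
  also have "\<dots> < \<infinity>" using Kfin(2) by (simp add: ennreal_mult_less_top)
  finally obtain J where J: "I = ennreal J" "J \<ge> 0" by (cases I) auto
  define A where "A = {(1 - t) ^ (2 * m) * cmod (G (z + t *\<^sub>R x)) | t x. 0 \<le> t \<and> t < 1 \<and> x \<in> K}"
  define s where "s = Sup A"
  have bdd: "bdd_above A"
  proof (rule bdd_aboveI[of _ M])
    fix y assume "y \<in> A"
    then obtain t x where tx: "y = (1 - t) ^ (2 * m) * cmod (G (z + t *\<^sub>R x))" "0 \<le> t" "t < 1" "x \<in> K"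
      by (auto simp: A_def)
    have "y \<le> 1 * M" unfolding tx(1)
      using tx bound[OF Kr[of t x]] by (intro mult_mono power_le_one) auto
    then show "y \<le> M" by simp
  qed
  have le_s: "(1 - t) ^ (2 * m) * cmod (G (z + t *\<^sub>R x)) \<le> s" if "0 \<le> t" "t < 1" "x \<in> K" for t x
    unfolding s_def by (rule cSup_upper[OF _ bdd]) (use that in \<open>auto simp: A_def\<close>)
  have Gs: "cmod (G z) \<le> s" using le_s[of 0 0] K0 by simp
  then have s0: "s \<ge> 0" using norm_ge_zero order.trans by blast
  have key: "(1 - t) ^ (2 * m) * cmod (G (z + t *\<^sub>R x)) * v \<le> 4 ^ m * sqrt s * J"
    if t: "0 \<le> t" "t < 1" and x: "x \<in> K" for t x
  proof -
    \<comment> \<open>Half the remaining room: the copy of \<open>K\<close> scaled by \<open>\<kappa>\<close> around \<open>t x\<close> stays in \<open>t' K\<close>, and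
      \<open>1 - t' = \<kappa>\<close> as well.\<close>
    define \<kappa> where "\<kappa> = (1 - t) / 2"
    define t' where "t' = (1 + t) / 2"
    have \<kappa>: "\<kappa> > 0" "t + \<kappa> = t'" "1 - t' = \<kappa>" "0 < t'" "t' < 1" using t by (auto simp: \<kappa>_def t'_def field_simps)
    let ?K = "{u. (1 / \<kappa>) *\<^sub>R u \<in> K}"
    let ?y = "z + t *\<^sub>R x"
    have incl: "\<exists>x'\<in>K. t *\<^sub>R x + u = t' *\<^sub>R x'" if "u \<in> ?K" for u
    proof
      let ?x' = "(t / t') *\<^sub>R x + (\<kappa> / t') *\<^sub>R ((1 / \<kappa>) *\<^sub>R u)"
      show "?x' \<in> K"
        by (rule convexD[OF K(2)]) (use that x t \<kappa> in \<open>auto simp flip: add_divide_distrib\<close>)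
      show "t *\<^sub>R x + u = t' *\<^sub>R ?x'" using \<kappa> by (simp add: scaleR_add_right)
    qed
    have inK: "t *\<^sub>R x + u \<in> K" if "u \<in> ?K" for u
      using incl[OF that] Kr[of t'] \<kappa> by force
    have bnd: "sqrt (cmod (G (z + (t *\<^sub>R x + u)))) \<le> sqrt s / \<kappa> ^ m" if "u \<in> ?K" for u
    proof -
      obtain x' where "x' \<in> K" "t *\<^sub>R x + u = t' *\<^sub>R x'" using incl[OF \<open>u \<in> ?K\<close>] by blast
      then have "(\<kappa> ^ m)\<^sup>2 * cmod (G (z + (t *\<^sub>R x + u))) \<le> s"
        using le_s[of t' x'] \<kappa> by (simp add: power_mult mult.commute[of 2] power_even_eq)
      then have "sqrt ((\<kappa> ^ m)\<^sup>2 * cmod (G (z + (t *\<^sub>R x + u)))) \<le> sqrt s" by (rule real_sqrt_le_mono)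
      then show ?thesis using \<kappa> by (simp add: real_sqrt_mult field_simps)
    qed
    have "(\<lambda>u :: complex ^ 'n. (1 / \<kappa>) *\<^sub>R u) \<in> borel_measurable borel" by measurable
    from measurable_sets_borel[OF this Kb]
    have [measurable]: "?K \<in> sets borel" by (simp add: vimage_def)
    have "ennreal (cmod (G ?y)) * emeasure lborel ?K \<le> (\<integral>\<^sup>+u\<in>?K. ennreal (cmod (G (?y + u))) \<partial>lborel)"
    proof (rule sub_mean_value[OF cont hol])
      show "c *s u \<in> ?K" if "cmod c \<le> 1" "u \<in> ?K" for c u
      proof -
        have "c *s ((1 / \<kappa>) *\<^sub>R u) \<in> K" using that by (intro balanced) auto
        then show ?thesis by (simp add: scaleR_eq_vector_scalar_mult mult.commute)
      qed
      show "?y + u \<in> ball 0 1" if "u \<in> ?K" for u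
        using sub[OF inK[OF that]] by (simp add: add.assoc)
      show "?y \<in> ball 0 1" using sub[OF Kr[of t x]] t x by simp
    qed measurable
    also have "\<dots> \<le> (\<integral>\<^sup>+u. ennreal (sqrt s / \<kappa> ^ m) * \<psi> (t *\<^sub>R x + u) \<partial>lborel)"
    proof (rule nn_integral_mono)
      fix u
      show "ennreal (cmod (G (?y + u))) * indicator ?K u \<le> ennreal (sqrt s / \<kappa> ^ m) * \<psi> (t *\<^sub>R x + u)"
      proof (cases "u \<in> ?K")
        case True
        have "cmod (G (?y + u)) = sqrt (cmod (G (z + (t *\<^sub>R x + u)))) * sqrt (cmod (G (z + (t *\<^sub>R x + u))))"
          by (simp add: add.assoc)
        also have "\<dots> \<le> (sqrt s / \<kappa> ^ m) * sqrt (cmod (G (z + (t *\<^sub>R x + u))))"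
          by (intro mult_right_mono bnd True) auto
        finally have "ennreal (cmod (G (?y + u))) \<le> ennreal (sqrt s / \<kappa> ^ m) * ennreal (sqrt (cmod (G (z + (t *\<^sub>R x + u)))))"
          using s0 \<kappa> by (subst ennreal_mult[symmetric]) (auto intro: ennreal_leI)
        then show ?thesis using True inK[OF True] by (simp add: \<psi>eq)
      qed simp
    qed
    also have "\<dots> = ennreal (sqrt s / \<kappa> ^ m) * (\<integral>\<^sup>+u. \<psi> (t *\<^sub>R x + u) \<partial>lborel)"
      by (rule nn_integral_cmult) measurable
    also have "(\<integral>\<^sup>+u. \<psi> (t *\<^sub>R x + u) \<partial>lborel) = ennreal J"
      by (subst nn_integral_lborel_translate[OF \<psi>m]) (simp add: I\<psi>[symmetric] J)
    also have "emeasure lborel ?K = ennreal (\<kappa> ^ m * v)"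
      using \<kappa> v by (subst emeasure_lborel_scaled[OF Kb]) (auto simp: m_def ennreal_mult)
    finally have "ennreal (cmod (G ?y) * (\<kappa> ^ m * v)) \<le> ennreal (sqrt s / \<kappa> ^ m * J)"
      using \<kappa> v s0 J(2) by (simp add: ennreal_mult[symmetric])
    then have "cmod (G ?y) * (\<kappa> ^ m * v) \<le> sqrt s / \<kappa> ^ m * J"
      using \<kappa> s0 J(2) by (subst (asm) ennreal_le_iff) auto
    then have "cmod (G ?y) * \<kappa> ^ (2 * m) * v \<le> sqrt s * J"
      unfolding mult_2 power_add using \<kappa> by (simp add: field_simps)
    moreover have "(1 - t) ^ (2 * m) = 4 ^ m * \<kappa> ^ (2 * m)"
      by (simp add: \<kappa>_def power_divide power_mult)
    ultimately show ?thesis by (simp add: mult_ac)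
  qed
  have "s \<le> 4 ^ m * sqrt s * J / v"
    unfolding s_def
  proof (rule cSup_least)
    have "(1 - 0) ^ (2 * m) * cmod (G (z + 0 *\<^sub>R 0)) \<in> A"
      unfolding A_def using K0 zero_less_one[where 'a = real] by blast
    then show "A \<noteq> {}" by blast
    fix y assume "y \<in> A"
    then obtain t x where tx: "y = (1 - t) ^ (2 * m) * cmod (G (z + t *\<^sub>R x))" "0 \<le> t" "t < 1" "x \<in> K"
      by (auto simp: A_def)
    show "y \<le> 4 ^ m * sqrt (Sup A) * J / v"
      using key[OF tx(2-4)] v(2) by (simp add: tx(1) s_def field_simps)
  qed
  then have "sqrt s * (sqrt s * v) \<le> sqrt s * (4 ^ m * J)"
    using v(2) s0 by (simp add: field_simps flip: mult.assoc)
  then have "sqrt s * v \<le> 4 ^ m * J"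
    using s0 J(2) by (cases "s = 0") auto
  moreover have "sqrt (cmod (G z)) * v \<le> sqrt s * v"
    using Gs v(2) by (intro mult_right_mono) auto
  ultimately have "ennreal (sqrt (cmod (G z)) * v) \<le> ennreal (4 ^ m * J)"
    by (intro ennreal_leI) simp
  then show ?thesis
    unfolding I_def[symmetric] m_def[symmetric] using v J by (simp add: ennreal_mult)
qed

section \<open>Surface measure and polar coordinates\<close>

lemma measurable_sgn_vec [measurable]: "sgn \<in> borel_measurable (borel :: 'a::euclidean_space measure)"
  unfolding sgn_div_norm[abs_def] by measurable

lemma space_sphere_measure: "space (sphere_measure :: (complex ^ 'n) measure) = sphere 0 1"
  by (simp add: sphere_measure_def space_restrict_space)

lemma measurable_sphere_measure:
  assumes "f \<in> borel_measurable borel"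
  shows "f \<in> borel_measurable (sphere_measure :: (complex ^ 'n) measure)"
  unfolding sphere_measure_def
  by (intro measurable_completion measurable_restrict_space1) (use assms in simp)

lemma borel_Int_sphere_in_sets:
  assumes "A \<in> sets borel"
  shows "A \<inter> sphere 0 1 \<in> sets (sphere_measure :: (complex ^ 'n) measure)"
  unfolding sphere_measure_def
  by (rule sets_completionI_sets) (use assms in \<open>auto simp: sets_restrict_space\<close>)

definition unit_ball_volume :: "'n::finite itself \<Rightarrow> real" where
  "unit_ball_volume _ = measure lborel (ball 0 1 :: (complex ^ 'n) set)"

lemma unit_ball_volume:
  "emeasure lborel (ball 0 1 :: (complex ^ 'n) set) = ennreal (unit_ball_volume TYPE('n))"
  "unit_ball_volume TYPE('n) > 0"
  unfolding unit_ball_volume_def using emeasure_lborel_ball_finite[of "0 :: complex ^ 'n" 1]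
  by (simp_all add: emeasure_eq_ennreal_measure content_ball_pos)

text \<open>The origin, which \<open>sgn\<close> maps outside the sphere, is a null set.\<close>

lemma nn_integral_sphere_measure:
  fixes F :: "complex ^ 'n \<Rightarrow> ennreal"
  assumes F[measurable]: "F \<in> borel_measurable borel"
  shows "ennreal (unit_ball_volume TYPE('n)) * (\<integral>\<^sup>+\<eta>. F \<eta> \<partial>sphere_measure)
    = (\<integral>\<^sup>+x\<in>ball 0 1. F (sgn x) \<partial>lborel)"
proof -
  let ?V = "emeasure lborel (ball 0 1 :: (complex ^ 'n) set)"
  let ?U = "uniform_measure lborel (ball 0 1) :: (complex ^ 'n) measure"
  have [measurable]: "sphere 0 1 \<in> sets (borel :: (complex ^ 'n) measure)" by (rule borel_closed) simp
  have [measurable]: "ball 0 1 \<in> sets (borel :: (complex ^ 'n) measure)" by simp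
  have sm[measurable]: "sgn \<in> ?U \<rightarrow>\<^sub>M (borel :: (complex ^ 'n) measure)"
    by (simp add: measurable_sgn_vec cong: measurable_cong_sets)
  have "(\<integral>\<^sup>+\<eta>. F \<eta> \<partial>sphere_measure) = (\<integral>\<^sup>+\<eta>. F \<eta> * indicator (sphere 0 1) \<eta> \<partial>distr ?U borel sgn)"
    unfolding sphere_measure_def nn_integral_completion
    by (rule nn_integral_restrict_space) simp
  also have "\<dots> = (\<integral>\<^sup>+x. F (sgn x) * indicator (sphere 0 1) (sgn x) \<partial>?U)"
    by (rule nn_integral_distr[OF sm]) measurable
  also have "\<dots> = (\<integral>\<^sup>+x. F (sgn x) * indicator (sphere 0 1) (sgn x) * indicator (ball 0 1) x \<partial>lborel) / ?V"
    by (rule nn_integral_uniform_measure) measurable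
  also have "(\<integral>\<^sup>+x. F (sgn x) * indicator (sphere 0 1) (sgn x) * indicator (ball 0 1) x \<partial>lborel)
      = (\<integral>\<^sup>+x\<in>ball 0 1. F (sgn x) \<partial>lborel)"
  proof (rule nn_integral_cong_AE)
    show "AE x in lborel. F (sgn x) * indicator (sphere 0 1) (sgn x) * indicator (ball 0 1) x
        = F (sgn x) * indicator (ball 0 1) (x :: complex ^ 'n)"
      using AE_lborel_singleton[of "0 :: complex ^ 'n"]
      by eventually_elim (simp add: norm_sgn)
  qed
  finally show ?thesis
    unfolding unit_ball_volume(1) using unit_ball_volume(2)[where 'n = 'n]
    by (simp add: ennreal_times_divide mult.commute[of "ennreal _"] mult_divide_eq_ennreal)
qed

lemma emeasure_space_sphere_measure: "emeasure sphere_measure (sphere 0 1 :: (complex ^ 'n) set) = 1"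
proof -
  let ?s = "sphere_measure :: (complex ^ 'n) measure"
  have "ennreal (unit_ball_volume TYPE('n)) * (\<integral>\<^sup>+\<eta>. 1 \<partial>?s) = (\<integral>\<^sup>+x\<in>ball 0 1. 1 \<partial>(lborel :: (complex ^ 'n) measure))"
    by (rule nn_integral_sphere_measure) simp
  also have "\<dots> = ennreal (unit_ball_volume TYPE('n))"
    by (simp add: unit_ball_volume)
  finally have "ennreal (unit_ball_volume TYPE('n)) * emeasure ?s (space ?s) = ennreal (unit_ball_volume TYPE('n)) * 1"
    by simp
  then have "emeasure ?s (space ?s) = 1"
    using unit_ball_volume(2)[where 'n = 'n] by (simp only: ennreal_mult_cancel_left) auto
  then show ?thesis by (simp add: space_sphere_measure)
qed

lemma finite_sphere_measure: "finite_measure (sphere_measure :: (complex ^ 'n) measure)"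
  by (rule finite_measureI) (simp add: space_sphere_measure emeasure_space_sphere_measure)

lemma emeasure_sphere_measure_le_1: "emeasure sphere_measure (A :: (complex ^ 'n) set) \<le> 1"
  using emeasure_space[of "sphere_measure :: (complex ^ 'n) measure" A]
  by (simp add: space_sphere_measure emeasure_space_sphere_measure)

lemma nn_integral_power_tail:
  fixes a m :: real
  assumes "a > 0" "m > 0"
  shows "(\<integral>\<^sup>+t. indicator {a<..} t * ennreal (t powr (-1 - m)) \<partial>lborel) = ennreal (a powr (-m) / m)"
proof -
  have "(\<integral>\<^sup>+t. indicator {a<..} t * ennreal (t powr (-1 - m)) \<partial>lborel)
      = (\<integral>\<^sup>+t. ennreal (t powr (-1 - m)) * indicator {a..} t \<partial>lborel)"
  proof (rule nn_integral_cong_AE)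
    show "AE t in lborel. indicator {a<..} t * ennreal (t powr (-1 - m)) = ennreal (t powr (-1 - m)) * indicator {a..} t"
      using AE_lborel_singleton[of a] by eventually_elim (auto simp: indicator_def)
  qed
  also have "\<dots> = ennreal (0 - (- (a powr (-m) / m)))"
  proof (rule nn_integral_FTC_atLeast)
    show "(\<lambda>t. t powr (-1 - m)) \<in> borel_measurable borel" by measurable
    fix t assume "a \<le> t"
    then have "t > 0" using assms by simp
    then show "DERIV (\<lambda>t. - (t powr (-m) / m)) t :> t powr (-1 - m)"
      using assms by (auto intro!: derivative_eq_intros simp: field_simps powr_diff powr_minus)
  next
    show "((\<lambda>t. - (t powr (-m) / m)) \<longlongrightarrow> 0) at_top"
      using assms(2) by real_asymp
  qed simp
  finally show ?thesis by simp
qed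

text \<open>Substituting \<open>\<rho> = t * norm x\<close> in the inner integral on the left turns it into an integral
  over all pairs \<open>(t, x)\<close> of a function of \<open>t *\<^sub>R x\<close> and the two norms; substituting
  \<open>y = t *\<^sub>R x\<close> and integrating out \<open>t\<close> leaves the right-hand side.\<close>

lemma polar_coordinates:
  fixes F :: "complex ^ 'n \<Rightarrow> ennreal"
  assumes F[measurable]: "F \<in> borel_measurable borel"
  defines "m \<equiv> real DIM(complex ^ 'n)"
  shows "ennreal (m * unit_ball_volume TYPE('n)) *
      (\<integral>\<^sup>+\<eta>. (\<integral>\<^sup>+\<rho>\<in>{0<..<1}. F (\<rho> *\<^sub>R \<eta>) \<partial>lborel) \<partial>sphere_measure)
    = (\<integral>\<^sup>+y\<in>ball 0 1. F y * ennreal (norm y powr (1 - m)) \<partial>lborel)"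
proof -
  have m: "m > 0" by (simp add: m_def)
  have [measurable]: "ball 0 1 \<in> sets (borel :: (complex ^ 'n) measure)" by simp
  have [measurable]: "Measurable.pred borel (\<lambda>x :: complex ^ 'n. norm x < 1)" by measurable
  \<comment> \<open>\<open>H x t\<close> is the integrand after the first substitution, \<open>g t y\<close> its value for \<open>y = t *\<^sub>R x\<close>,
    up to powers of \<open>t\<close>.\<close>
  define H where "H x t = (if norm x < 1 \<and> 0 < t \<and> t * norm x < 1 then ennreal (norm x) * F (t *\<^sub>R x) else 0)"
    for x :: "complex ^ 'n" and t :: real
  define g where "g t y = (if norm y < 1 \<and> norm y < t then ennreal (norm y) * F y else 0)"
    for y :: "complex ^ 'n" and t :: real
  have Hm[measurable]: "case_prod H \<in> borel_measurable (borel \<Otimes>\<^sub>M borel)"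
    unfolding H_def by measurable
  have gm[measurable]: "case_prod g \<in> borel_measurable (borel \<Otimes>\<^sub>M borel)"
    unfolding g_def by measurable
  have "ennreal (unit_ball_volume TYPE('n)) *
      (\<integral>\<^sup>+\<eta>. (\<integral>\<^sup>+\<rho>\<in>{0<..<1}. F (\<rho> *\<^sub>R \<eta>) \<partial>lborel) \<partial>sphere_measure)
    = (\<integral>\<^sup>+x\<in>ball 0 1. (\<integral>\<^sup>+\<rho>\<in>{0<..<1}. F (\<rho> *\<^sub>R sgn x) \<partial>lborel) \<partial>lborel)"
    by (rule nn_integral_sphere_measure) measurable
  also have "\<dots> = (\<integral>\<^sup>+x. (\<integral>\<^sup>+t. H x t \<partial>lborel) \<partial>lborel)"
  proof (rule nn_integral_cong_AE)
    show "AE x in lborel. (\<integral>\<^sup>+\<rho>\<in>{0<..<1}. F (\<rho> *\<^sub>R sgn x) \<partial>lborel) * indicator (ball 0 1) x = (\<integral>\<^sup>+t. H x t \<partial>lborel)"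
      using AE_lborel_singleton[of "0 :: complex ^ 'n"]
    proof eventually_elim
      case (elim x)
      have "(\<integral>\<^sup>+\<rho>\<in>{0<..<1}. F (\<rho> *\<^sub>R sgn x) \<partial>lborel)
          = ennreal \<bar>norm x\<bar> * (\<integral>\<^sup>+t. F ((0 + norm x * t) *\<^sub>R sgn x) * indicator {0<..<1} (0 + norm x * t) \<partial>lborel)"
        by (rule nn_integral_real_affine) (use elim in auto)
      also have "\<dots> = (\<integral>\<^sup>+t. ennreal (norm x) * (F ((0 + norm x * t) *\<^sub>R sgn x) * indicator {0<..<1} (0 + norm x * t)) \<partial>lborel)"
        unfolding abs_norm_cancel by (rule nn_integral_cmult[symmetric]) measurable
      finally have "(\<integral>\<^sup>+\<rho>\<in>{0<..<1}. F (\<rho> *\<^sub>R sgn x) \<partial>lborel) * indicator (ball 0 1) x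
          = (\<integral>\<^sup>+t. ennreal (norm x) * (F ((0 + norm x * t) *\<^sub>R sgn x) * indicator {0<..<1} (0 + norm x * t)) * indicator (ball 0 1) x \<partial>lborel)"
        by (subst nn_integral_multc) auto
      also have "\<dots> = (\<integral>\<^sup>+t. H x t \<partial>lborel)"
      proof (rule nn_integral_cong)
        fix t
        have eq: "(0 + norm x * t) *\<^sub>R sgn x = t *\<^sub>R x" using elim by (simp add: sgn_div_norm)
        show "ennreal (norm x) * (F ((0 + norm x * t) *\<^sub>R sgn x) * indicator {0<..<1} (0 + norm x * t)) * indicator (ball 0 1) x = H x t"
          unfolding eq using elim by (auto simp: H_def indicator_def zero_less_mult_iff mult.commute)
      qed
      finally show ?case .
    qed
  qed
  also have "\<dots> = (\<integral>\<^sup>+t. (\<integral>\<^sup>+x. H x t \<partial>lborel) \<partial>lborel)"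
    by (rule lborel_pair.Fubini'[symmetric]) measurable
  also have "\<dots> = (\<integral>\<^sup>+t. (\<integral>\<^sup>+y. g t y * ennreal (t powr (-1 - m)) \<partial>lborel) \<partial>lborel)"
  proof (rule nn_integral_cong)
    fix t :: real
    show "(\<integral>\<^sup>+x. H x t \<partial>lborel) = (\<integral>\<^sup>+y. g t y * ennreal (t powr (-1 - m)) \<partial>lborel)"
    proof (cases "t > 0")
      case False
      then have "H x t = 0" "g t x = 0" for x
        using norm_ge_zero[of x] by (auto simp: H_def g_def simp del: norm_ge_zero)
      then show ?thesis by simp
    next
      case True
      have gt: "(\<lambda>y. g t y) \<in> borel_measurable borel" by measurable
      have "t powr (-1 - m) * t ^ DIM(complex ^ 'n) = 1 / t"
        using True by (simp add: m_def powr_realpow[symmetric] powr_add[symmetric] powr_minus_divide)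
      moreover have "(\<integral>\<^sup>+y. g t y \<partial>lborel) = ennreal (t ^ DIM(complex ^ 'n)) * (\<integral>\<^sup>+x. g t (t *\<^sub>R x) \<partial>lborel)"
        using nn_integral_lborel_affine[OF gt, of t 0] True by simp
      ultimately have "ennreal (t powr (-1 - m)) * (\<integral>\<^sup>+y. g t y \<partial>lborel) = ennreal (1 / t) * (\<integral>\<^sup>+x. g t (t *\<^sub>R x) \<partial>lborel)"
        using True by (simp only: mult.assoc[symmetric] ennreal_mult[symmetric] powr_ge_zero zero_le_power less_imp_le)
      also have "\<dots> = (\<integral>\<^sup>+x. ennreal (1 / t) * g t (t *\<^sub>R x) \<partial>lborel)"
        by (rule nn_integral_cmult[symmetric]) measurable
      also have "\<dots> = (\<integral>\<^sup>+x. H x t \<partial>lborel)"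
      proof (rule nn_integral_cong)
        fix x :: "complex ^ 'n"
        have "ennreal (1 / t) * (ennreal (t * norm x) * F (t *\<^sub>R x)) = ennreal (norm x) * F (t *\<^sub>R x)"
          using True by (simp add: mult.assoc[symmetric] ennreal_mult[symmetric])
        then show "ennreal (1 / t) * g t (t *\<^sub>R x) = H x t"
          using True by (auto simp: g_def H_def)
      qed
      finally show ?thesis by (subst nn_integral_multc) (auto simp: mult.commute)
    qed
  qed
  also have "\<dots> = (\<integral>\<^sup>+y. (\<integral>\<^sup>+t. g t y * ennreal (t powr (-1 - m)) \<partial>lborel) \<partial>lborel)"
    by (rule lborel_pair.Fubini') measurable
  also have "\<dots> = (\<integral>\<^sup>+y. ennreal (1 / m) * (F y * ennreal (norm y powr (1 - m)) * indicator (ball 0 1) y) \<partial>lborel)"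
  proof (rule nn_integral_cong_AE)
    show "AE y in lborel. (\<integral>\<^sup>+t. g t y * ennreal (t powr (-1 - m)) \<partial>lborel)
        = ennreal (1 / m) * (F y * ennreal (norm y powr (1 - m)) * indicator (ball 0 1) y)"
      using AE_lborel_singleton[of "0 :: complex ^ 'n"]
    proof eventually_elim
      case (elim y)
      have "(\<integral>\<^sup>+t. g t y * ennreal (t powr (-1 - m)) \<partial>lborel)
         = (\<integral>\<^sup>+t. indicator (ball 0 1) y * ennreal (norm y) * F y * (indicator {norm y<..} t * ennreal (t powr (-1 - m))) \<partial>lborel)"
        by (rule nn_integral_cong) (auto simp: g_def indicator_def)
      also have "\<dots> = indicator (ball 0 1) y * ennreal (norm y) * F y * ennreal (norm y powr (-m) / m)"
        using elim m by (subst nn_integral_cmult) (auto simp: nn_integral_power_tail)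
      also have "\<dots> = indicator (ball 0 1) y * F y * (ennreal (norm y) * ennreal (norm y powr (-m) / m))"
        by (simp add: mult_ac)
      also have "ennreal (norm y) * ennreal (norm y powr (-m) / m) = ennreal (1 / m) * ennreal (norm y powr (1 - m))"
        using elim m by (simp add: ennreal_mult[symmetric] powr_diff powr_minus_divide)
      finally show ?case by (simp add: mult_ac)
    qed
  qed
  also have "\<dots> = ennreal (1 / m) * (\<integral>\<^sup>+y\<in>ball 0 1. F y * ennreal (norm y powr (1 - m)) \<partial>lborel)"
    by (rule nn_integral_cmult) measurable
  finally have "ennreal m * (ennreal (unit_ball_volume TYPE('n)) *
      (\<integral>\<^sup>+\<eta>. (\<integral>\<^sup>+\<rho>\<in>{0<..<1}. F (\<rho> *\<^sub>R \<eta>) \<partial>lborel) \<partial>sphere_measure))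
    = ennreal m * (ennreal (1 / m) * (\<integral>\<^sup>+y\<in>ball 0 1. F y * ennreal (norm y powr (1 - m)) \<partial>lborel))"
    by simp
  then show ?thesis
    using m unit_ball_volume(2)[where 'n = 'n]
    by (simp add: mult.assoc[symmetric] ennreal_mult[symmetric])
qed

section \<open>Geometry of nonisotropic balls\<close>

lemma hprod_add_left: "hprod (x + y) z = hprod x z + hprod y z"
  by (simp add: hprod_def algebra_simps sum.distrib)

lemma hprod_add_right: "hprod x (y + z) = hprod x y + hprod x z"
  by (simp add: hprod_def algebra_simps sum.distrib)

lemma hprod_diff_left: "hprod (x - y) z = hprod x z - hprod y z"
  by (simp add: hprod_def algebra_simps sum_subtractf)

lemma hprod_smult_left: "hprod (c *s x) z = c * hprod x z"
  by (simp add: hprod_def sum_distrib_left mult.assoc)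

lemma hprod_scaleR_left: "hprod (r *\<^sub>R x) z = of_real r * hprod x z"
  by (simp add: scaleR_eq_vector_scalar_mult hprod_smult_left)

lemma cnj_hprod: "cnj (hprod x z) = hprod z x"
  by (simp add: hprod_def mult.commute)

lemma hprod_diff_right: "hprod x (y - z) = hprod x y - hprod x z"
  by (simp add: hprod_def algebra_simps sum_subtractf)

lemma hprod_smult_right: "hprod x (c *s z) = cnj c * hprod x z"
  by (simp add: hprod_def sum_distrib_left mult_ac)

lemma hprod_scaleR_right: "hprod x (r *\<^sub>R z) = of_real r * hprod x z"
  by (simp add: scaleR_eq_vector_scalar_mult hprod_smult_right)

lemma cmod_hprod_commute: "cmod (hprod x z) = cmod (hprod z x)"
  by (metis cnj_hprod complex_mod_cnj)

lemma Re_hprod: "Re (hprod x z) = x \<bullet> z"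
  by (simp add: hprod_def inner_vec_def inner_complex_def)

lemma hprod_self: "hprod x x = complex_of_real ((norm x)\<^sup>2)"
proof (rule complex_eqI)
  show "Re (hprod x x) = Re (complex_of_real ((norm x)\<^sup>2))"
    by (simp add: Re_hprod power2_norm_eq_inner)
  have "Im (hprod x x) = - Im (hprod x x)"
    using arg_cong[OF cnj_hprod[of x x], of Im] by simp
  then show "Im (hprod x x) = Im (complex_of_real ((norm x)\<^sup>2))" by simp
qed

lemma hprod_self_unit: "norm x = 1 \<Longrightarrow> hprod x x = 1"
  by (simp add: hprod_self)

lemma cmod_hprod_le: "cmod (hprod x z) \<le> norm x * norm z"
proof (cases "hprod x z = 0")
  case False
  define c where "c = cnj (hprod x z) / of_real (cmod (hprod x z))"
  have c: "cmod c = 1" using False by (simp add: c_def norm_divide)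
  have "hprod (c *s x) z = of_real (cmod (hprod x z))"
    using False complex_norm_square[of "hprod x z"]
    by (simp add: hprod_smult_left c_def field_simps power2_eq_square)
  then have "cmod (hprod x z) = (c *s x) \<bullet> z"
    by (metis Re_hprod Re_complex_of_real)
  also have "\<dots> \<le> norm (c *s x) * norm z" by (rule norm_cauchy_schwarz)
  finally show ?thesis by (simp add: norm_vector_scalar_mult c)
qed simp

lemma norm_add_squared: "(norm (x + y))\<^sup>2 = (norm x)\<^sup>2 + 2 * Re (hprod x y) + (norm y)\<^sup>2"
  by (simp add: Re_hprod power2_norm_eq_inner inner_add inner_commute)

lemma continuous_on_hprod: "continuous_on A (hprod \<zeta>)" "continuous_on A (\<lambda>x. hprod x \<zeta>)"
  unfolding hprod_def[abs_def] by (intro continuous_intros)+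

lemma measurable_hprod [measurable]: "hprod \<zeta> \<in> borel_measurable borel"
  by (intro borel_measurable_continuous_onI continuous_on_hprod)

text \<open>The orthogonal decompositions of \<open>\<zeta>\<close> and \<open>\<omega>\<close> along \<open>\<eta>\<close> leave remainders of
  squared length \<open>1 - \<bar>a\<bar>\<^sup>2 \<le> 2 \<bar>1 - a\<bar>\<close>, and these enter only through their product.\<close>

lemma nonisotropic_quasi_triangle:
  fixes \<zeta> \<eta> \<omega> :: "complex ^ 'n"
  assumes "norm \<zeta> = 1" "norm \<eta> = 1" "norm \<omega> = 1"
  shows "cmod (1 - hprod \<zeta> \<omega>) \<le> 2 * (cmod (1 - hprod \<zeta> \<eta>) + cmod (1 - hprod \<eta> \<omega>))"
proof -
  define a where "a = hprod \<zeta> \<eta>"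
  define b where "b = hprod \<eta> \<omega>"
  have rest: "(norm (x - hprod x \<eta> *s \<eta>))\<^sup>2 \<le> 2 * cmod (1 - hprod x \<eta>)" if "norm x = 1" for x :: "complex ^ 'n"
  proof -
    let ?h = "hprod x \<eta>"
    have "complex_of_real ((norm (x - ?h *s \<eta>))\<^sup>2) = hprod (x - ?h *s \<eta>) (x - ?h *s \<eta>)"
      by (simp only: hprod_self)
    also have "\<dots> = 1 - ?h * cnj ?h"
      using that assms(2)
      by (simp add: hprod_diff_left hprod_diff_right hprod_smult_left hprod_smult_right hprod_self_unit cnj_hprod algebra_simps)
    also have "\<dots> = complex_of_real (1 - (cmod ?h)\<^sup>2)" by (simp add: complex_norm_square[symmetric])
    finally have "(norm (x - ?h *s \<eta>))\<^sup>2 = 1 - (cmod ?h)\<^sup>2" by (simp only: of_real_eq_iff)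
    also have "\<dots> = (1 - cmod ?h) * (1 + cmod ?h)" by (simp add: power2_eq_square algebra_simps)
    also have "\<dots> \<le> cmod (1 - ?h) * 2"
    proof (rule mult_mono)
      show "1 - cmod ?h \<le> cmod (1 - ?h)" using norm_triangle_ineq2[of 1 ?h] by simp
      show "1 + cmod ?h \<le> 2" using cmod_hprod_le[of x \<eta>] that assms(2) by simp
    qed auto
    finally show ?thesis by simp
  qed
  define \<zeta>' where "\<zeta>' = \<zeta> - hprod \<zeta> \<eta> *s \<eta>"
  define \<omega>' where "\<omega>' = \<omega> - hprod \<omega> \<eta> *s \<eta>"
  have "(norm \<zeta>')\<^sup>2 \<le> 2 * cmod (1 - a)" unfolding \<zeta>'_def a_def by (rule rest[OF assms(1)])
  moreover have "(norm \<omega>')\<^sup>2 \<le> 2 * cmod (1 - b)"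
  proof -
    have "cmod (1 - hprod \<omega> \<eta>) = cmod (cnj (1 - hprod \<omega> \<eta>))" by (simp only: complex_mod_cnj)
    also have "\<dots> = cmod (1 - b)" by (simp add: cnj_hprod b_def)
    finally show ?thesis unfolding \<omega>'_def using rest[OF assms(3)] by simp
  qed
  moreover have "2 * (norm \<zeta>' * norm \<omega>') \<le> (norm \<zeta>')\<^sup>2 + (norm \<omega>')\<^sup>2"
    using sum_squares_bound[of "norm \<zeta>'" "norm \<omega>'"] by simp
  moreover have "cmod (hprod \<zeta>' \<omega>') \<le> norm \<zeta>' * norm \<omega>'" by (rule cmod_hprod_le)
  ultimately have 1: "cmod (hprod \<zeta>' \<omega>') \<le> cmod (1 - a) + cmod (1 - b)" by linarith
  have "hprod \<zeta>' \<omega>' = hprod \<zeta> \<omega> - a * b"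
    using assms(2)
    by (simp add: \<zeta>'_def \<omega>'_def a_def b_def hprod_diff_left hprod_diff_right hprod_smult_left
        hprod_smult_right hprod_self_unit cnj_hprod algebra_simps)
  then have "1 - hprod \<zeta> \<omega> = (1 - a) + a * (1 - b) - hprod \<zeta>' \<omega>'"
    by (simp add: algebra_simps)
  then have 2: "cmod (1 - hprod \<zeta> \<omega>) \<le> cmod (1 - a) + cmod (a * (1 - b)) + cmod (hprod \<zeta>' \<omega>')"
    by (metis norm_triangle_ineq norm_triangle_ineq4 add_right_mono order.trans)
  have 3: "cmod (a * (1 - b)) \<le> 1 * cmod (1 - b)"
    unfolding norm_mult using cmod_hprod_le[of \<zeta> \<eta>] assms by (intro mult_right_mono) (auto simp: a_def)
  have arith: "x \<le> A + X + H \<Longrightarrow> X \<le> 1 * B \<Longrightarrow> H \<le> A + B \<Longrightarrow> x \<le> 2 * (A + B)" for x A X H B :: real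
    by simp
  show ?thesis using arith[OF 2 3 1] unfolding a_def b_def .
qed

lemma cmod_one_minus_hprod_commute: "cmod (1 - hprod x z) = cmod (1 - hprod z x)"
  by (metis cnj_hprod complex_mod_cnj complex_cnj_diff complex_cnj_one)

lemma nonisotropic_ball_engulfing:
  assumes "\<zeta> \<in> sphere 0 1" "\<zeta>' \<in> sphere 0 1" "R \<le> R'"
    and "nonisotropic_ball \<zeta> R \<inter> nonisotropic_ball \<zeta>' R' \<noteq> {}"
  shows "nonisotropic_ball \<zeta> R \<subseteq> nonisotropic_ball \<zeta>' (10 * R')"
proof
  fix x assume "x \<in> nonisotropic_ball \<zeta> R"
  then have x: "norm x = 1" "cmod (1 - hprod \<zeta> x) < R" by (auto simp: nonisotropic_ball_def)
  obtain y where y: "norm y = 1" "cmod (1 - hprod \<zeta> y) < R" "cmod (1 - hprod \<zeta>' y) < R'"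
    using assms(4) by (auto simp: nonisotropic_ball_def)
  have 1: "cmod (1 - hprod y x) \<le> 2 * (cmod (1 - hprod \<zeta> y) + cmod (1 - hprod \<zeta> x))"
    using assms x y by (subst cmod_one_minus_hprod_commute[of \<zeta> y], intro nonisotropic_quasi_triangle) auto
  have 2: "cmod (1 - hprod \<zeta>' x) \<le> 2 * (cmod (1 - hprod \<zeta>' y) + cmod (1 - hprod y x))"
    using assms x y by (intro nonisotropic_quasi_triangle) auto
  have arith: "a \<le> 2 * (b + c) \<Longrightarrow> d \<le> 2 * (e + a) \<Longrightarrow> b < R \<Longrightarrow> c < R \<Longrightarrow> e < R' \<Longrightarrow> d < 10 * R'"
    for a b c d e :: real
    using assms(3) by simp
  have "cmod (1 - hprod \<zeta>' x) < 10 * R'"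
    by (rule arith[OF 1 2 y(2) x(2) y(3)])
  then show "x \<in> nonisotropic_ball \<zeta>' (10 * R')" using x(1) by (simp add: nonisotropic_ball_def)
qed

lemma nonisotropic_ball_eq_Int: "nonisotropic_ball \<zeta> R = {\<eta>. cmod (1 - hprod \<zeta> \<eta>) < R} \<inter> sphere 0 1"
  by (auto simp: nonisotropic_ball_def)

lemma nonisotropic_ball_in_sets: "nonisotropic_ball \<zeta> R \<in> sets sphere_measure"
proof -
  have "{\<eta>. cmod (1 - hprod \<zeta> \<eta>) < R} \<in> sets borel" by measurable
  then show ?thesis unfolding nonisotropic_ball_eq_Int by (rule borel_Int_sphere_in_sets)
qed

lemma nonisotropic_ball_mono: "R \<le> R' \<Longrightarrow> nonisotropic_ball \<zeta> R \<subseteq> nonisotropic_ball \<zeta> R'"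
  by (auto simp: nonisotropic_ball_def)

text \<open>The sets that take the role of nonisotropic balls for volumes in \<open>\<complex>\<^sup>n\<close>: the extent is
  \<open>R\<close> in the complex direction of \<open>\<zeta>\<close> and \<open>sqrt R\<close> in the orthogonal ones. They are convex
  and balanced, which makes them admissible for the mean value inequality.\<close>

definition tangent_box :: "complex ^ 'n \<Rightarrow> real \<Rightarrow> (complex ^ 'n) set" where
  "tangent_box \<zeta> R = {u. cmod (hprod u \<zeta>) < R \<and> (norm u)\<^sup>2 < R}"

lemma open_tangent_box: "open (tangent_box \<zeta> R)"
  unfolding tangent_box_def
  by (intro open_Collect_conj open_Collect_less continuous_intros continuous_on_hprod)

lemma tangent_box_eq_ball:
  fixes \<zeta> :: "complex ^ 'n"
  shows "tangent_box \<zeta> R = {u. cmod (hprod u \<zeta>) < R} \<inter> ball 0 (sqrt R)"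
proof -
  have "(norm u)\<^sup>2 < R \<longleftrightarrow> norm u < sqrt R" for u :: "complex ^ 'n"
    using real_sqrt_less_iff[of "(norm u)\<^sup>2" R] by simp
  then show ?thesis by (simp add: tangent_box_def set_eq_iff)
qed

lemma convex_tangent_box: "convex (tangent_box \<zeta> R)"
proof -
  have "{u. cmod (hprod u \<zeta>) < R} = (\<lambda>u. hprod u \<zeta>) -` ball 0 R" by auto
  moreover have "convex ((\<lambda>u. hprod u \<zeta>) -` ball 0 R)"
    by (intro convex_linear_vimage linearI)
      (simp_all add: hprod_add_left hprod_scaleR_left scaleR_conv_of_real[where 'a = complex])
  ultimately show ?thesis
    unfolding tangent_box_eq_ball by (intro convex_Int) auto
qed

lemma balanced_tangent_box:
  assumes "cmod c \<le> 1" "u \<in> tangent_box \<zeta> R"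
  shows "c *s u \<in> tangent_box \<zeta> R"
proof -
  have "cmod (hprod (c *s u) \<zeta>) \<le> cmod (hprod u \<zeta>)"
    using assms by (simp add: hprod_smult_left norm_mult mult_left_le_one_le)
  moreover have "(norm (c *s u))\<^sup>2 \<le> (norm u)\<^sup>2"
    using assms by (intro power_mono) (auto simp: norm_vector_scalar_mult mult_left_le_one_le)
  ultimately show ?thesis
    using assms unfolding tangent_box_def mem_Collect_eq by linarith
qed

lemma zero_in_tangent_box: "R > 0 \<Longrightarrow> 0 \<in> tangent_box \<zeta> R"
  by (simp add: tangent_box_def hprod_def)

lemma emeasure_tangent_box_finite:
  fixes \<zeta> :: "complex ^ 'n"
  shows "emeasure lborel (tangent_box \<zeta> R) < \<infinity>"
proof -
  have "emeasure lborel (tangent_box \<zeta> R) \<le> emeasure lborel (ball 0 (sqrt R) :: (complex ^ 'n) set)"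
    using tangent_box_eq_ball[of \<zeta> R] by (intro emeasure_mono) auto
  then show ?thesis using emeasure_lborel_ball_finite order.strict_trans1 by blast
qed

lemma emeasure_tangent_box_pos:
  assumes "R > 0"
  shows "0 < emeasure lborel (tangent_box \<zeta> R)"
proof -
  have "tangent_box \<zeta> R \<notin> null_sets lborel"
    using open_not_negligible[OF open_tangent_box] zero_in_tangent_box[OF assms]
    by (metis empty_iff negligible_iff_null_sets null_sets_completionI)
  then show ?thesis using open_tangent_box[of \<zeta> R]
    by (auto simp: null_sets_def zero_less_iff_neq_zero)
qed

lemma emeasure_tangent_box: "emeasure lborel (tangent_box \<zeta> R) = ennreal (measure lborel (tangent_box \<zeta> R))"
  using emeasure_tangent_box_finite[of \<zeta> R] by (simp add: emeasure_eq_ennreal_measure)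

text \<open>A box enlarged by a factor \<open>c \<ge> 1\<close> lies in the isotropic dilation by \<open>c\<close>, since \<open>sqrt c \<le> c\<close>.\<close>

lemma measure_tangent_box_scale:
  fixes \<zeta> :: "complex ^ 'n"
  assumes "1 \<le> c" "0 < R"
  shows "measure lborel (tangent_box \<zeta> (c * R)) \<le> c ^ DIM(complex ^ 'n) * measure lborel (tangent_box \<zeta> R)"
proof -
  have "tangent_box \<zeta> (c * R) \<subseteq> {x. (1 / c) *\<^sub>R x \<in> tangent_box \<zeta> R}"
  proof
    fix x assume x: "x \<in> tangent_box \<zeta> (c * R)"
    have "cmod (hprod ((1 / c) *\<^sub>R x) \<zeta>) = cmod (hprod x \<zeta>) / c"
      using assms by (simp add: hprod_scaleR_left norm_mult norm_divide)
    moreover have "(norm ((1 / c) *\<^sub>R x))\<^sup>2 = (norm x)\<^sup>2 / c / c"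
      using assms by (simp add: power_divide power2_eq_square)
    moreover have "(norm x)\<^sup>2 / c < R" "cmod (hprod x \<zeta>) / c < R"
      using x assms by (auto simp: tangent_box_def field_simps)
    moreover have "(norm x)\<^sup>2 / c / c \<le> (norm x)\<^sup>2 / c"
      using assms mult_right_mono[of 1 c "(norm x)\<^sup>2"] by (simp add: field_simps)
    ultimately show "x \<in> {x. (1 / c) *\<^sub>R x \<in> tangent_box \<zeta> R}"
      by (simp add: tangent_box_def)
  qed
  moreover have "(\<lambda>x :: complex ^ 'n. (1 / c) *\<^sub>R x) \<in> borel_measurable borel" by measurable
  from measurable_sets_borel[OF this borel_open[OF open_tangent_box[of \<zeta> R]]]
  have "{x. (1 / c) *\<^sub>R x \<in> tangent_box \<zeta> R} \<in> sets borel"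
    by (simp add: vimage_def)
  ultimately have "emeasure lborel (tangent_box \<zeta> (c * R)) \<le> emeasure lborel {x. (1 / c) *\<^sub>R x \<in> tangent_box \<zeta> R}"
    by (intro emeasure_mono) auto
  also have "\<dots> = ennreal (c ^ DIM(complex ^ 'n)) * emeasure lborel (tangent_box \<zeta> R)"
    by (intro emeasure_lborel_scaled borel_open open_tangent_box) (use assms in auto)
  finally show ?thesis
    using assms unfolding emeasure_tangent_box by (simp add: ennreal_mult[symmetric] del: DIM_cart)
qed

text \<open>The part of the ball near \<open>(1 - R) *\<^sub>R \<zeta>\<close> over the nonisotropic ball of radius \<open>9 * R\<close>. For
  \<open>R \<ge> 1 / 4\<close> that ball is the whole sphere, which settles the points near the origin.\<close>

definition polar_box :: "complex ^ 'n \<Rightarrow> real \<Rightarrow> (complex ^ 'n) set" where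
  "polar_box \<zeta> R = {x. norm x < 1 \<and> R / 2 \<le> 1 - (norm x)\<^sup>2 \<and> 1 - (norm x)\<^sup>2 \<le> 3 * R
     \<and> cmod (1 - hprod \<zeta> (sgn x)) < 9 * R}"

text \<open>With \<open>x = r \<zeta> + u\<close> and \<open>r = 1 - R\<close>, expanding the square gives
  \<open>\<bar>x\<bar>\<^sup>2 = r\<^sup>2 + 2 r Re \<langle>u, \<zeta>\<rangle> + \<bar>u\<bar>\<^sup>2\<close>, where the last two terms are small multiples of \<open>R\<close>. The factor
  \<open>1 / 8\<close> keeps \<open>1 - \<bar>x\<bar>\<^sup>2\<close> above \<open>R / 2\<close> and the distance from \<open>\<zeta>\<close> to the direction of \<open>x\<close> at most
  \<open>R\<close> whenever \<open>R < 1 / 4\<close>.\<close>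

lemma translated_tangent_box_subset:
  assumes \<zeta>: "\<zeta> \<in> sphere 0 1" and R: "0 < R" "R < 1" and u: "u \<in> tangent_box \<zeta> (R / 8)"
  shows "(1 - R) *\<^sub>R \<zeta> + u \<in> polar_box \<zeta> R"
proof -
  define r where "r = 1 - R"
  define x where "x = r *\<^sub>R \<zeta> + u"
  have r: "0 < r" "r < 1" using R by (auto simp: r_def)
  have n\<zeta>: "norm \<zeta> = 1" using \<zeta> by simp
  have u1: "cmod (hprod u \<zeta>) < R / 8" and u2: "(norm u)\<^sup>2 < R / 8" using u by (auto simp: tangent_box_def)
  have "(norm x)\<^sup>2 = r\<^sup>2 + 2 * (r * Re (hprod \<zeta> u)) + (norm u)\<^sup>2"
    unfolding x_def norm_add_squared using r n\<zeta> by (simp add: hprod_scaleR_left power_mult_distrib)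
  moreover have "\<bar>r * Re (hprod \<zeta> u)\<bar> \<le> R / 8"
  proof -
    have "\<bar>r\<bar> * \<bar>Re (hprod \<zeta> u)\<bar> \<le> 1 * cmod (hprod \<zeta> u)"
      using r abs_Re_le_cmod by (intro mult_mono) auto
    then show ?thesis using u1 cmod_hprod_commute[of \<zeta> u] by (simp add: abs_mult)
  qed
  moreover have "0 \<le> (norm u)\<^sup>2" by simp
  ultimately have x2: "r\<^sup>2 - R / 4 \<le> (norm x)\<^sup>2" "(norm x)\<^sup>2 \<le> r\<^sup>2 + 3 * R / 8" using u2 by linarith+
  have r2: "1 - r\<^sup>2 = R * (1 + r)" by (simp add: r_def power2_eq_square algebra_simps)
  have "R * 1 \<le> R * (1 + r)" "R * (1 + r) \<le> R * 2" using R r by (auto intro!: mult_left_mono)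
  then have b: "R / 2 \<le> 1 - (norm x)\<^sup>2" "1 - (norm x)\<^sup>2 \<le> 3 * R" using x2 r2 by linarith+
  then have "(norm x)\<^sup>2 < 1\<^sup>2" using R by simp
  then have nx: "norm x < 1" by (rule power2_less_imp_less) simp
  have c: "cmod (1 - hprod \<zeta> (sgn x)) < 9 * R"
  proof (cases "R \<ge> 1 / 4")
    case True
    have "cmod (1 - hprod \<zeta> (sgn x)) \<le> 1 + cmod (hprod \<zeta> (sgn x))"
      using norm_triangle_ineq4[of 1 "hprod \<zeta> (sgn x)"] by simp
    also have "\<dots> \<le> 1 + 1 * 1"
      using cmod_hprod_le[of \<zeta> "sgn x"] n\<zeta> by (auto simp: norm_sgn split: if_splits)
    finally show ?thesis using True by simp
  next
    case False
    have "(1 / 2)\<^sup>2 < (norm x)\<^sup>2" using b False by (simp add: power2_eq_square)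
    then have n2: "1 / 2 < norm x" by (rule power2_less_imp_less) simp
    have "norm x * norm x - r * r = (norm x - r) * (norm x + r)" by (simp add: algebra_simps)
    moreover have "\<bar>(norm x)\<^sup>2 - r\<^sup>2\<bar> \<le> 3 * R / 8"
      using x2 R by linarith
    then have "\<bar>norm x * norm x - r * r\<bar> \<le> 3 * R / 8" by (simp only: power2_eq_square)
    ultimately have "\<bar>norm x - r\<bar> * (norm x + r) \<le> 3 * R / 8" using r by (simp add: abs_mult)
    moreover have "\<bar>norm x - r\<bar> * 1 \<le> \<bar>norm x - r\<bar> * (norm x + r)"
      using n2 False by (intro mult_left_mono) (auto simp: r_def)
    ultimately have d: "\<bar>norm x - r\<bar> \<le> 3 * R / 8" by simp
    have sx: "sgn x = (1 / norm x) *\<^sub>R x" by (simp add: sgn_div_norm inverse_eq_divide)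
    have "hprod \<zeta> x = of_real r + hprod \<zeta> u"
      using n\<zeta> by (simp add: x_def hprod_add_right hprod_scaleR_right hprod_self_unit)
    then have "of_real (norm x) * (1 - hprod \<zeta> (sgn x)) = of_real (norm x - r) - hprod \<zeta> u"
      using n2 by (auto simp: sx hprod_scaleR_right algebra_simps)
    then have "norm x * cmod (1 - hprod \<zeta> (sgn x)) = cmod (of_real (norm x - r) - hprod \<zeta> u)"
      by (metis norm_mult norm_of_real abs_norm_cancel)
    also have "\<dots> \<le> \<bar>norm x - r\<bar> + cmod (hprod \<zeta> u)"
      using norm_triangle_ineq4[of "complex_of_real (norm x - r)" "hprod \<zeta> u"] by (simp only: norm_of_real)
    also have "\<dots> \<le> R / 2" using d u1 cmod_hprod_commute[of \<zeta> u] by simp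
    finally have "norm x * cmod (1 - hprod \<zeta> (sgn x)) \<le> R / 2" .
    moreover have "1 / 2 * cmod (1 - hprod \<zeta> (sgn x)) \<le> norm x * cmod (1 - hprod \<zeta> (sgn x))"
      using n2 by (intro mult_right_mono) auto
    ultimately show ?thesis using R by simp
  qed
  show ?thesis using nx b c by (simp add: polar_box_def x_def r_def)
qed

lemma measurable_polar_box [measurable]: "polar_box \<zeta> R \<in> sets borel"
  unfolding polar_box_def by measurable

definition radial_range :: "real \<Rightarrow> real set" where
  "radial_range R = {\<rho>. 0 < \<rho> \<and> \<rho> < 1 \<and> R / 2 \<le> 1 - \<rho>\<^sup>2 \<and> 1 - \<rho>\<^sup>2 \<le> 3 * R}"

lemma measurable_radial_range [measurable]: "radial_range R \<in> sets borel"
  unfolding radial_range_def by measurable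

lemma emeasure_radial_range_le:
  assumes "0 < R"
  shows "emeasure lborel (radial_range R) \<le> ennreal (3 * R)"
proof -
  have "radial_range R \<subseteq> {1 - 3 * R .. 1}"
  proof
    fix \<rho> assume "\<rho> \<in> radial_range R"
    moreover from this have "\<rho>\<^sup>2 \<le> \<rho>" by (simp add: radial_range_def power2_eq_square mult_left_le)
    ultimately show "\<rho> \<in> {1 - 3 * R .. 1}" by (simp add: radial_range_def)
  qed
  then have "emeasure lborel (radial_range R) \<le> emeasure lborel {1 - 3 * R .. 1}" by (intro emeasure_mono) auto
  then show ?thesis using assms by simp
qed

text \<open>In polar coordinates the density \<open>norm y ^ (m - 1)\<close> of the radial part is at most 1 on the ball.\<close>

lemma nn_integral_polar_box_le:
  fixes \<phi> :: "complex ^ 'n \<Rightarrow> ennreal"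
  assumes [measurable]: "\<phi> \<in> borel_measurable borel"
  shows "(\<integral>\<^sup>+x\<in>polar_box \<zeta> R. \<phi> x \<partial>lborel) \<le> ennreal (real DIM(complex ^ 'n) * unit_ball_volume TYPE('n)) *
    (\<integral>\<^sup>+\<eta>\<in>nonisotropic_ball \<zeta> (9 * R).
       (\<integral>\<^sup>+\<rho>\<in>radial_range R. \<phi> (\<rho> *\<^sub>R \<eta>) \<partial>lborel) \<partial>sphere_measure)"
proof -
  let ?m = "real DIM(complex ^ 'n)"
  have m: "?m \<ge> 1"
    using DIM_positive[where 'a = "complex ^ 'n"] by linarith
  have "(\<integral>\<^sup>+x\<in>polar_box \<zeta> R. \<phi> x \<partial>lborel)
      \<le> (\<integral>\<^sup>+y\<in>ball 0 1. \<phi> y * indicator (polar_box \<zeta> R) y * ennreal (norm y powr (1 - ?m)) \<partial>lborel)"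
  proof (rule nn_integral_mono_AE)
    show "AE y in lborel. \<phi> y * indicator (polar_box \<zeta> R) y
        \<le> \<phi> y * indicator (polar_box \<zeta> R) y * ennreal (norm y powr (1 - ?m)) * indicator (ball 0 1) y"
      using AE_lborel_singleton[of "0 :: complex ^ 'n"]
    proof eventually_elim
      case (elim y)
      show ?case
      proof (cases "y \<in> polar_box \<zeta> R")
        case True
        then have "norm y < 1" by (simp add: polar_box_def)
        then have "norm y powr 0 \<le> norm y powr (1 - ?m)"
          using elim m by (intro powr_mono') auto
        then have "1 \<le> ennreal (norm y powr (1 - ?m))" using elim by simp
        then have "\<phi> y * 1 \<le> \<phi> y * ennreal (norm y powr (1 - ?m))" by (intro mult_left_mono) auto
        then show ?thesis using True \<open>norm y < 1\<close> by simp
      qed simp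
    qed
  qed
  also have "\<dots> = ennreal (?m * unit_ball_volume TYPE('n)) *
      (\<integral>\<^sup>+\<eta>. (\<integral>\<^sup>+\<rho>\<in>{0<..<1}. \<phi> (\<rho> *\<^sub>R \<eta>) * indicator (polar_box \<zeta> R) (\<rho> *\<^sub>R \<eta>) \<partial>lborel) \<partial>sphere_measure)"
    by (rule polar_coordinates[symmetric]) measurable
  also have "(\<integral>\<^sup>+\<eta>. (\<integral>\<^sup>+\<rho>\<in>{0<..<1}. \<phi> (\<rho> *\<^sub>R \<eta>) * indicator (polar_box \<zeta> R) (\<rho> *\<^sub>R \<eta>) \<partial>lborel) \<partial>sphere_measure)
     = (\<integral>\<^sup>+\<eta>\<in>nonisotropic_ball \<zeta> (9 * R).
       (\<integral>\<^sup>+\<rho>\<in>radial_range R. \<phi> (\<rho> *\<^sub>R \<eta>) \<partial>lborel) \<partial>sphere_measure)"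
  proof (rule nn_integral_cong)
    fix \<eta> :: "complex ^ 'n" assume "\<eta> \<in> space sphere_measure"
    then have \<eta>: "norm \<eta> = 1" by (simp add: space_sphere_measure)
    have sgn: "sgn (\<rho> *\<^sub>R \<eta>) = \<eta>" if "\<rho> > 0" for \<rho>
      using that \<eta> by (simp add: sgn_div_norm)
    show "(\<integral>\<^sup>+\<rho>\<in>{0<..<1}. \<phi> (\<rho> *\<^sub>R \<eta>) * indicator (polar_box \<zeta> R) (\<rho> *\<^sub>R \<eta>) \<partial>lborel)
      = (\<integral>\<^sup>+\<rho>\<in>radial_range R. \<phi> (\<rho> *\<^sub>R \<eta>) \<partial>lborel)
         * indicator (nonisotropic_ball \<zeta> (9 * R)) \<eta>"
      by (cases "\<eta> \<in> nonisotropic_ball \<zeta> (9 * R)")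
        (auto intro!: nn_integral_cong simp: \<eta> nonisotropic_ball_def polar_box_def radial_range_def indicator_def sgn nn_integral_0_iff_AE)
  qed
  finally show ?thesis .
qed


lemma measurable_tangent_box [measurable]: "tangent_box \<zeta> R \<in> sets borel"
  by (rule borel_open[OF open_tangent_box])

lemma emeasure_nonisotropic_ball:
  "emeasure sphere_measure (nonisotropic_ball (\<zeta> :: complex ^ 'n) R)
    = ennreal (measure sphere_measure (nonisotropic_ball \<zeta> R))"
  using finite_measure.emeasure_eq_measure[OF finite_sphere_measure] .

lemma measure_nonisotropic_ball_le_1: "measure sphere_measure (nonisotropic_ball (\<zeta> :: complex ^ 'n) R) \<le> 1"
  using emeasure_sphere_measure_le_1[of "nonisotropic_ball \<zeta> R"] by (simp add: emeasure_nonisotropic_ball)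

lemma measure_tangent_box_le_nonisotropic_ball:
  fixes \<zeta> :: "complex ^ 'n"
  assumes \<zeta>: "\<zeta> \<in> sphere 0 1" and R: "0 < R" "R < 1"
  shows "measure lborel (tangent_box \<zeta> (R / 8))
    \<le> 3 * real DIM(complex ^ 'n) * unit_ball_volume TYPE('n) * R * measure sphere_measure (nonisotropic_ball \<zeta> (9 * R))"
proof -
  let ?mV = "real DIM(complex ^ 'n) * unit_ball_volume TYPE('n)"
  let ?B = "nonisotropic_ball \<zeta> (9 * R)"
  have V: "?mV \<ge> 0" using unit_ball_volume(2)[where 'n = 'n] by simp
  have [measurable]: "?B \<in> sets sphere_measure" by (rule nonisotropic_ball_in_sets)
  have "emeasure lborel (tangent_box \<zeta> (R / 8)) = (\<integral>\<^sup>+u. indicator (tangent_box \<zeta> (R / 8)) u \<partial>lborel)"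
    by simp
  also have "\<dots> \<le> (\<integral>\<^sup>+u. indicator (polar_box \<zeta> R) ((1 - R) *\<^sub>R \<zeta> + u) \<partial>lborel)"
    using translated_tangent_box_subset[OF \<zeta> R] by (intro nn_integral_mono) (auto simp: indicator_def)
  also have "\<dots> = (\<integral>\<^sup>+x\<in>polar_box \<zeta> R. 1 \<partial>lborel)"
    by (subst nn_integral_lborel_translate) auto
  also have "\<dots> \<le> ennreal ?mV * (\<integral>\<^sup>+\<eta>\<in>?B. (\<integral>\<^sup>+\<rho>\<in>radial_range R. 1 \<partial>lborel) \<partial>sphere_measure)"
    by (rule nn_integral_polar_box_le) measurable
  also have "\<dots> \<le> ennreal ?mV * (\<integral>\<^sup>+\<eta>\<in>?B. ennreal (3 * R) \<partial>sphere_measure)"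
  proof -
    have "(\<integral>\<^sup>+\<rho>\<in>radial_range R. 1 \<partial>lborel) \<le> ennreal (3 * R)"
      using emeasure_radial_range_le[OF R(1)] by simp
    then show ?thesis by (intro mult_left_mono nn_integral_mono mult_right_mono) auto
  qed
  also have "\<dots> = ennreal ?mV * (ennreal (3 * R) * emeasure sphere_measure ?B)"
    by (simp add: nn_integral_cmult)
  also have "\<dots> = ennreal (?mV * (3 * R * measure sphere_measure ?B))"
    unfolding emeasure_nonisotropic_ball using V R by (simp add: ennreal_mult[symmetric] del: DIM_cart)
  finally have le: "emeasure lborel (tangent_box \<zeta> (R / 8)) \<le> ennreal (?mV * (3 * R * measure sphere_measure ?B))" .
  have "0 \<le> ?mV * (3 * R * measure sphere_measure ?B)"
    by (rule mult_nonneg_nonneg[OF V]) (use R in simp)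
  with le have "measure lborel (tangent_box \<zeta> (R / 8)) \<le> ?mV * (3 * R * measure sphere_measure ?B)"
    unfolding emeasure_tangent_box by (simp only: ennreal_le_iff)
  then show ?thesis by (simp add: mult_ac)
qed

text \<open>The points of the ball over the nonisotropic ball and at depth less than \<open>R\<close> lie in the
  translate of a tangent box; for \<open>R \<le> 1 / 2\<close> they have norm at least \<open>1 / 2\<close>, so the radial
  density costs only a constant.\<close>

lemma measure_nonisotropic_ball_le_small:
  fixes \<zeta> :: "complex ^ 'n"
  assumes \<zeta>: "\<zeta> \<in> sphere 0 1" and R: "0 < R" "R \<le> 1 / 2"
  shows "unit_ball_volume TYPE('n) * R * measure sphere_measure (nonisotropic_ball \<zeta> R)
    \<le> 2 ^ DIM(complex ^ 'n) * measure lborel (tangent_box \<zeta> (4 * R))"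
proof -
  define m where "m = real DIM(complex ^ 'n)"
  let ?V = "unit_ball_volume TYPE('n)"
  let ?B = "nonisotropic_ball \<zeta> R"
  have V: "?V > 0" by (rule unit_ball_volume(2))
  have m: "m \<ge> 1" using DIM_positive[where 'a = "complex ^ 'n"] unfolding m_def by linarith
  define E where "E = {x. norm x < 1 \<and> 1 - norm x < R \<and> cmod (1 - hprod \<zeta> (sgn x)) < R}"
  have [measurable]: "E \<in> sets borel" unfolding E_def by measurable
  have [measurable]: "?B \<in> sets sphere_measure" by (rule nonisotropic_ball_in_sets)
  have inner: "(\<integral>\<^sup>+\<rho>\<in>{0<..<1}. indicator E (\<rho> *\<^sub>R \<eta>) \<partial>lborel) = ennreal R * indicator ?B \<eta>"
    if "\<eta> \<in> space sphere_measure" for \<eta>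
  proof -
    have \<eta>: "norm \<eta> = 1" using that by (simp add: space_sphere_measure)
    have sgn: "sgn (\<rho> *\<^sub>R \<eta>) = \<eta>" if "\<rho> > 0" for \<rho>
      using that \<eta> by (simp add: sgn_div_norm)
    have "(\<integral>\<^sup>+\<rho>\<in>{0<..<1}. indicator E (\<rho> *\<^sub>R \<eta>) \<partial>lborel)
        = (\<integral>\<^sup>+\<rho>. indicator ?B \<eta> * indicator {1 - R<..<1} \<rho> \<partial>lborel)"
      using R by (intro nn_integral_cong) (auto simp: E_def nonisotropic_ball_def indicator_def sgn \<eta>)
    also have "\<dots> = indicator ?B \<eta> * ennreal R"
      using R by (simp add: nn_integral_cmult)
    finally show ?thesis by (simp add: mult.commute)
  qed
  have sub: "x - \<zeta> \<in> tangent_box \<zeta> (4 * R)" if "x \<in> E" for x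
  proof -
    have n\<zeta>: "norm \<zeta> = 1" using \<zeta> by simp
    define \<rho> where "\<rho> = norm x"
    have x: "\<rho> < 1" "1 - \<rho> < R" "cmod (1 - hprod \<zeta> (sgn x)) < R" using that by (auto simp: E_def \<rho>_def)
    have \<rho>: "\<rho> > 0" using x R by simp
    define h where "h = hprod (sgn x) \<zeta>"
    have h: "cmod (1 - h) < R" using x(3) cmod_one_minus_hprod_commute[of \<zeta> "sgn x"] by (simp add: h_def)
    have "x = \<rho> *\<^sub>R sgn x" using \<rho> by (simp add: \<rho>_def sgn_div_norm)
    then have hx: "hprod x \<zeta> = of_real \<rho> * h" by (metis h_def hprod_scaleR_left)
    have "hprod (x - \<zeta>) \<zeta> = - (of_real \<rho> * (1 - h) + of_real (1 - \<rho>))"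
      using n\<zeta> by (simp add: hprod_diff_left hprod_self_unit hx algebra_simps)
    then have "cmod (hprod (x - \<zeta>) \<zeta>) = cmod (of_real \<rho> * (1 - h) + of_real (1 - \<rho>))"
      by (metis norm_minus_cancel)
    also have "\<dots> \<le> cmod (of_real \<rho> * (1 - h)) + cmod (of_real (1 - \<rho>))" by (rule norm_triangle_ineq)
    also have "\<dots> = \<rho> * cmod (1 - h) + (1 - \<rho>)"
      using \<rho> x(1) by (simp only: norm_mult norm_of_real)
    also have "\<dots> < 4 * R"
    proof -
      have "\<rho> * cmod (1 - h) \<le> 1 * cmod (1 - h)" using x \<rho> by (intro mult_right_mono) auto
      then show ?thesis using h x(2) R by simp
    qed
    finally have 1: "cmod (hprod (x - \<zeta>) \<zeta>) < 4 * R" .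
    have "(norm (x - \<zeta>))\<^sup>2 = \<rho>\<^sup>2 - 2 * (x \<bullet> \<zeta>) + 1"
      using n\<zeta> by (simp add: \<rho>_def power2_norm_eq_inner inner_diff inner_commute norm_eq_1)
    also have "x \<bullet> \<zeta> = \<rho> * Re h" by (simp add: Re_hprod[symmetric] hx)
    also have "\<rho>\<^sup>2 - 2 * (\<rho> * Re h) + 1 = (1 - \<rho>) * (1 - \<rho>) + 2 * (\<rho> * (1 - Re h))"
      by (simp add: power2_eq_square algebra_simps)
    also have "\<dots> < 4 * R"
    proof -
      have 2: "(1 - \<rho>) * (1 - \<rho>) \<le> (1 - \<rho>) * 1" using x \<rho> by (intro mult_left_mono) auto
      have "1 - Re h \<le> cmod (1 - h)" using complex_Re_le_cmod[of "1 - h"] by simp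
      then have 3: "\<rho> * (1 - Re h) \<le> \<rho> * cmod (1 - h)" using \<rho> by (intro mult_left_mono) auto
      have 4: "\<rho> * cmod (1 - h) \<le> 1 * cmod (1 - h)" using x \<rho> by (intro mult_right_mono) auto
      have "a \<le> (1 - \<rho>) * 1 \<Longrightarrow> b \<le> b' \<Longrightarrow> b' \<le> 1 * d \<Longrightarrow> d < R \<Longrightarrow> a + 2 * b < 4 * R" for a b b' d
        using x(2) R by simp
      from this[OF 2 3 4 h] show ?thesis .
    qed
    finally show ?thesis using 1 by (simp add: tangent_box_def)
  qed
  have wt: "norm y powr (1 - m) \<le> 2 ^ DIM(complex ^ 'n)" if "y \<in> E" for y
  proof -
    have y: "1 / 2 \<le> norm y" "norm y < 1" using that R by (auto simp: E_def)
    have "norm y powr (1 - m) \<le> (1 / 2) powr (1 - m)"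
      using y m by (intro powr_mono2') auto
    also have "\<dots> = 2 powr (m - 1)" by (simp add: powr_divide powr_minus_divide powr_diff)
    also have "\<dots> \<le> 2 powr m" by (intro powr_mono) auto
    also have "\<dots> = 2 ^ DIM(complex ^ 'n)" unfolding m_def by (rule powr_realpow) simp
    finally show ?thesis .
  qed
  have "ennreal (m * ?V) * (ennreal R * emeasure sphere_measure ?B)
     = ennreal (m * ?V) * (\<integral>\<^sup>+\<eta>. (\<integral>\<^sup>+\<rho>\<in>{0<..<1}. indicator E (\<rho> *\<^sub>R \<eta>) \<partial>lborel) \<partial>sphere_measure)"
    by (subst nn_integral_cong[OF inner]) (simp_all add: nn_integral_cmult)
  also have "\<dots> = (\<integral>\<^sup>+y\<in>ball 0 1. indicator E y * ennreal (norm y powr (1 - m)) \<partial>lborel)"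
    unfolding m_def by (rule polar_coordinates) measurable
  also have "\<dots> \<le> (\<integral>\<^sup>+y. ennreal (2 ^ DIM(complex ^ 'n)) * indicator (tangent_box \<zeta> (4 * R)) (- \<zeta> + y) \<partial>lborel)"
  proof (rule nn_integral_mono)
    fix y :: "complex ^ 'n"
    show "indicator E y * ennreal (norm y powr (1 - m)) * indicator (ball 0 1) y
        \<le> ennreal (2 ^ DIM(complex ^ 'n)) * indicator (tangent_box \<zeta> (4 * R)) (- \<zeta> + y)"
    proof (cases "y \<in> E")
      case True
      then have "norm y < 1" by (simp add: E_def)
      then show ?thesis using True sub[OF True] wt[OF True] by (simp add: ennreal_leI del: DIM_cart)
    qed simp
  qed
  also have "\<dots> = ennreal (2 ^ DIM(complex ^ 'n)) * (\<integral>\<^sup>+y. indicator (tangent_box \<zeta> (4 * R)) (- \<zeta> + y) \<partial>lborel)"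
    by (rule nn_integral_cmult) measurable
  also have "(\<integral>\<^sup>+y. indicator (tangent_box \<zeta> (4 * R)) (- \<zeta> + y) \<partial>lborel) = emeasure lborel (tangent_box \<zeta> (4 * R))"
    by (subst nn_integral_lborel_translate) auto
  finally have "m * ?V * (R * measure sphere_measure ?B) \<le> 2 ^ DIM(complex ^ 'n) * measure lborel (tangent_box \<zeta> (4 * R))"
    unfolding emeasure_nonisotropic_ball emeasure_tangent_box
    using V m R by (simp add: ennreal_mult[symmetric] del: DIM_cart)
  moreover have "1 * (?V * R * measure sphere_measure ?B) \<le> m * (?V * R * measure sphere_measure ?B)"
    using V m R by (intro mult_right_mono) auto
  ultimately show ?thesis by (simp add: mult_ac del: DIM_cart)
qed

lemma measure_nonisotropic_ball_le_tangent_box: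
  fixes \<zeta> :: "complex ^ 'n"
  assumes \<zeta>: "\<zeta> \<in> sphere 0 1" and R: "0 < R" "R \<le> 90"
  shows "unit_ball_volume TYPE('n) * R * measure sphere_measure (nonisotropic_ball \<zeta> R)
    \<le> 90 * 8 ^ DIM(complex ^ 'n) * measure lborel (tangent_box \<zeta> R)"
proof (cases "R \<le> 1 / 2")
  case True
  have "unit_ball_volume TYPE('n) * R * measure sphere_measure (nonisotropic_ball \<zeta> R)
    \<le> 2 ^ DIM(complex ^ 'n) * measure lborel (tangent_box \<zeta> (4 * R))"
    by (rule measure_nonisotropic_ball_le_small[OF \<zeta> R(1) True])
  also have "\<dots> \<le> 2 ^ DIM(complex ^ 'n) * (4 ^ DIM(complex ^ 'n) * measure lborel (tangent_box \<zeta> R))"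
    by (intro mult_left_mono measure_tangent_box_scale) (use R in auto)
  also have "\<dots> = 1 * (8 ^ DIM(complex ^ 'n) * measure lborel (tangent_box \<zeta> R))"
    by (simp add: mult.assoc[symmetric] power_mult_distrib[symmetric] del: DIM_cart)
  also have "\<dots> \<le> 90 * (8 ^ DIM(complex ^ 'n) * measure lborel (tangent_box \<zeta> R))"
    by (rule mult_right_mono) auto
  finally show ?thesis by (simp add: mult.assoc del: DIM_cart)
next
  case False
  let ?V = "unit_ball_volume TYPE('n)"
  have V: "?V > 0" by (rule unit_ball_volume(2))
  have n\<zeta>: "norm \<zeta> = 1" using \<zeta> by simp
  have "{x. (1 / (1 / 2)) *\<^sub>R x \<in> ball 0 1} \<subseteq> tangent_box \<zeta> R"
  proof
    fix x :: "complex ^ 'n" assume "x \<in> {x. (1 / (1 / 2)) *\<^sub>R x \<in> ball 0 1}"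
    then have x: "norm x < 1 / 2" by simp
    have "(norm x)\<^sup>2 \<le> norm x" using x by (simp add: power2_eq_square mult_left_le)
    then show "x \<in> tangent_box \<zeta> R" using x False cmod_hprod_le[of x \<zeta>] n\<zeta> by (simp add: tangent_box_def)
  qed
  then have "emeasure lborel {x :: complex ^ 'n. (1 / (1 / 2)) *\<^sub>R x \<in> ball 0 1} \<le> emeasure lborel (tangent_box \<zeta> R)"
    by (intro emeasure_mono) auto
  then have "ennreal ((1 / 2) ^ DIM(complex ^ 'n)) * emeasure lborel (ball 0 1 :: (complex ^ 'n) set) \<le> emeasure lborel (tangent_box \<zeta> R)"
    by (subst (asm) emeasure_lborel_scaled) auto
  then have "(1 / 2) ^ DIM(complex ^ 'n) * ?V \<le> measure lborel (tangent_box \<zeta> R)"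
    unfolding unit_ball_volume(1) emeasure_tangent_box using V by (simp add: ennreal_mult[symmetric] del: DIM_cart)
  then have 1: "?V \<le> 2 ^ DIM(complex ^ 'n) * measure lborel (tangent_box \<zeta> R)"
    by (simp add: field_simps power_divide del: DIM_cart)
  have "?V * R * measure sphere_measure (nonisotropic_ball \<zeta> R) \<le> ?V * 90 * 1"
    using V R measure_nonisotropic_ball_le_1[of \<zeta> R] by (intro mult_mono) auto
  also have "\<dots> \<le> (2 ^ DIM(complex ^ 'n) * measure lborel (tangent_box \<zeta> R)) * 90 * 1"
    using 1 by (intro mult_right_mono) auto
  also have "\<dots> \<le> (8 ^ DIM(complex ^ 'n) * measure lborel (tangent_box \<zeta> R)) * 90 * 1"
    by (intro mult_right_mono power_mono) auto
  finally show ?thesis by (simp add: mult_ac del: DIM_cart)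
qed

text \<open>The volume of a tangent box lies between fixed multiples of \<open>R\<close> times the measure of a
  nonisotropic ball, while enlarging the box costs only a power of the factor; hence the
  doubling property. The radii \<open>9 * R\<close> belong to the boxes around \<open>(1 - R) *\<^sub>R \<zeta>\<close>, the radii \<open>90 * R\<close>
  to their enlargements in the covering argument.\<close>

lemma measure_nonisotropic_ball_le:
  fixes \<zeta> :: "complex ^ 'n"
  assumes \<zeta>: "\<zeta> \<in> sphere 0 1" and R: "0 < R" "R < 1" and c: "1 \<le> c" "c \<le> 90"
  shows "unit_ball_volume TYPE('n) * R * measure sphere_measure (nonisotropic_ball \<zeta> (c * R))
    \<le> 90 * 64 ^ DIM(complex ^ 'n) * c ^ DIM(complex ^ 'n) * measure lborel (tangent_box \<zeta> (R / 8))"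
proof -
  let ?V = "unit_ball_volume TYPE('n)"
  have V: "?V > 0" by (rule unit_ball_volume(2))
  have "?V * R * measure sphere_measure (nonisotropic_ball \<zeta> (c * R))
     \<le> ?V * (c * R) * measure sphere_measure (nonisotropic_ball \<zeta> (c * R))"
    using V R c by (intro mult_right_mono mult_left_mono) auto
  also have "\<dots> \<le> 90 * 8 ^ DIM(complex ^ 'n) * measure lborel (tangent_box \<zeta> (c * R))"
    using R c mult_mono[of c 90 R 1] by (intro measure_nonisotropic_ball_le_tangent_box[OF \<zeta>]) auto
  also have "\<dots> \<le> 90 * 8 ^ DIM(complex ^ 'n) * ((8 * c) ^ DIM(complex ^ 'n) * measure lborel (tangent_box \<zeta> (R / 8)))"
    using R c measure_tangent_box_scale[of "8 * c" "R / 8" \<zeta>] by (intro mult_left_mono) auto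
  also have "\<dots> = 90 * (8 ^ DIM(complex ^ 'n) * 8 ^ DIM(complex ^ 'n)) * c ^ DIM(complex ^ 'n) * measure lborel (tangent_box \<zeta> (R / 8))"
    by (simp only: power_mult_distrib mult_ac)
  also have "8 ^ DIM(complex ^ 'n) * 8 ^ DIM(complex ^ 'n) = (64 :: real) ^ DIM(complex ^ 'n)"
    by (simp only: power_mult_distrib[symmetric]) simp
  finally show ?thesis .
qed

lemma nonisotropic_ball_doubling:
  "\<exists>D>0. \<forall>\<zeta>\<in>sphere (0 :: complex ^ 'n) 1. \<forall>R. 0 < R \<and> R < 1 \<longrightarrow>
     measure sphere_measure (nonisotropic_ball \<zeta> (90 * R)) \<le> D * measure sphere_measure (nonisotropic_ball \<zeta> (9 * R))"
proof -
  let ?V = "unit_ball_volume TYPE('n)"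
  have V: "?V > 0" by (rule unit_ball_volume(2))
  define C :: real where "C = 90 * 64 ^ DIM(complex ^ 'n) * 90 ^ DIM(complex ^ 'n)"
  define D where "D = C * (3 * real DIM(complex ^ 'n))"
  have C: "C > 0" by (simp add: C_def)
  have "D > 0" using C by (simp add: D_def)
  moreover have "measure sphere_measure (nonisotropic_ball \<zeta> (90 * R)) \<le> D * measure sphere_measure (nonisotropic_ball \<zeta> (9 * R))"
    if \<zeta>: "\<zeta> \<in> sphere (0 :: complex ^ 'n) 1" and R: "0 < R" "R < 1" for \<zeta> R
  proof -
    have "?V * R * measure sphere_measure (nonisotropic_ball \<zeta> (90 * R)) \<le> C * measure lborel (tangent_box \<zeta> (R / 8))"
      unfolding C_def by (rule measure_nonisotropic_ball_le[OF \<zeta> R]) auto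
    also have "\<dots> \<le> C * (3 * real DIM(complex ^ 'n) * ?V * R * measure sphere_measure (nonisotropic_ball \<zeta> (9 * R)))"
      by (intro mult_left_mono measure_tangent_box_le_nonisotropic_ball[OF \<zeta> R]) (use C in auto)
    also have "\<dots> = ?V * R * (D * measure sphere_measure (nonisotropic_ball \<zeta> (9 * R)))"
      by (simp add: D_def mult_ac del: DIM_cart)
    finally show ?thesis using V R by (simp del: DIM_cart)
  qed
  ultimately show ?thesis by blast
qed

lemma measure_nonisotropic_ball_pos:
  fixes \<zeta> :: "complex ^ 'n"
  assumes \<zeta>: "\<zeta> \<in> sphere 0 1" and R: "0 < R" "R < 1"
  shows "0 < measure sphere_measure (nonisotropic_ball \<zeta> (9 * R))"
proof -
  have "0 < measure lborel (tangent_box \<zeta> (R / 8))"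
    using emeasure_tangent_box_pos[of "R / 8" \<zeta>] R unfolding emeasure_tangent_box by simp
  also note measure_tangent_box_le_nonisotropic_ball[OF \<zeta> R]
  finally show ?thesis using R unit_ball_volume(2)[where 'n = 'n] by (simp add: zero_less_mult_iff)
qed

section \<open>Powers of extended nonnegative reals\<close>

lemma enn_powr_ennreal: "x \<ge> 0 \<Longrightarrow> enn_powr (ennreal x) a = ennreal (x powr a)"
  by (simp add: enn_powr_def)

lemma enn_powr_top [simp]: "enn_powr top a = top"
  by (simp add: enn_powr_def)

lemma enn_powr_zero [simp]: "enn_powr 0 a = 0"
  by (simp add: enn_powr_def)

lemma enn_powr_one [simp]: "enn_powr x 1 = x"
  by (cases x) (simp_all add: enn_powr_ennreal)

lemma enn_powr_mono: "x \<le> y \<Longrightarrow> a > 0 \<Longrightarrow> enn_powr x a \<le> enn_powr y a"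
  by (cases x; cases y) (auto simp: enn_powr_ennreal top_unique intro!: ennreal_leI powr_mono2)

lemma enn_powr_less_top: "enn_powr x a < top \<longleftrightarrow> x < top"
  by (cases x) (simp_all add: enn_powr_ennreal)

lemma enn_powr_eq_0_iff: "enn_powr x a = 0 \<longleftrightarrow> x = 0"
  by (cases x) (auto simp: enn_powr_ennreal ennreal_eq_0_iff)

lemma enn_powr_enn_powr: "enn_powr (enn_powr x a) b = enn_powr x (a * b)"
  by (cases x) (simp_all add: enn_powr_ennreal powr_powr)

lemma enn_powr_add: "a > 0 \<Longrightarrow> b > 0 \<Longrightarrow> enn_powr x (a + b) = enn_powr x a * enn_powr x b"
  by (cases x) (simp_all add: enn_powr_ennreal powr_add ennreal_mult ennreal_top_mult)

lemma enn_powr_mult: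
  assumes "a > 0"
  shows "enn_powr (x * y) a = enn_powr x a * enn_powr y a"
proof (cases "x = 0 \<or> y = 0")
  case True
  then show ?thesis by auto
next
  case False
  then show ?thesis
    by (cases x; cases y)
      (auto simp: enn_powr_ennreal powr_mult ennreal_mult[symmetric] ennreal_mult_top ennreal_top_mult)
qed

lemma measurable_enn_powr [measurable]: "(\<lambda>x. enn_powr x a) \<in> borel_measurable borel"
  unfolding enn_powr_def by measurable

text \<open>Used for \<open>\<theta> = q0 / q1\<close> with the \<open>p\<close>-th powers of the radial quantities for the exponents
  \<open>\<infinity>\<close> and \<open>q0\<close> as \<open>x\<close> and \<open>y\<close>.\<close>

lemma enn_powr_interpolate:
  assumes "0 < \<theta>" "\<theta> < 1"
  shows "enn_powr x (1 - \<theta>) * enn_powr y \<theta> \<le> x + y"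
proof -
  have "enn_powr x (1 - \<theta>) * enn_powr y \<theta> \<le> enn_powr (max x y) (1 - \<theta>) * enn_powr (max x y) \<theta>"
    using assms by (intro mult_mono enn_powr_mono) auto
  also have "\<dots> = max x y"
    using assms enn_powr_add[of "1 - \<theta>" \<theta> "max x y"] by simp
  also have "\<dots> \<le> x + y" by (simp add: max_def add_increasing add_increasing2)
  finally show ?thesis .
qed

section \<open>The local estimate by radial integrals\<close>

definition radial_integral :: "real \<Rightarrow> real \<Rightarrow> (complex ^ 'n \<Rightarrow> complex) \<Rightarrow> complex ^ 'n \<Rightarrow> ennreal" where
  "radial_integral q d G \<eta> =
    (\<integral>\<^sup>+\<rho>\<in>{0<..<1}. ennreal (cmod (G (\<rho> *\<^sub>R \<eta>)) powr q * (1 - \<rho>\<^sup>2) powr (d * q - 1)) \<partial>lborel)"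

lemma radial_integral_cong:
  assumes "\<eta> \<in> sphere 0 1" "\<And>x. x \<in> ball 0 1 \<Longrightarrow> G x = H x"
  shows "radial_integral q d G \<eta> = radial_integral q d H \<eta>"
  unfolding radial_integral_def
  by (intro nn_integral_cong) (use assms in \<open>auto simp: indicator_def\<close>)

lemma measurable_extended_by_zero:
  fixes G :: "complex ^ 'n \<Rightarrow> complex"
  assumes "continuous_on (ball 0 1) G"
  shows "(\<lambda>x. indicator (ball 0 1) x *\<^sub>R G x) \<in> borel_measurable borel"
  by (rule borel_measurable_continuous_on_indicator) (use assms in auto)

lemma measurable_radial_integral:
  fixes G :: "complex ^ 'n \<Rightarrow> complex"
  assumes cont: "continuous_on (ball 0 1) G"
  shows "radial_integral q d G \<in> borel_measurable sphere_measure"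
proof -
  let ?H = "\<lambda>x. indicator (ball 0 1) x *\<^sub>R G x"
  have [measurable]: "?H \<in> borel_measurable borel" by (rule measurable_extended_by_zero[OF cont])
  have "(\<lambda>x. ?H (snd x *\<^sub>R fst x)) \<in> borel_measurable (borel \<Otimes>\<^sub>M borel)"
    by (rule measurable_compose[OF _ measurable_extended_by_zero[OF cont]]) measurable
  then have [measurable]: "(\<lambda>(\<eta>, \<rho>). ?H (\<rho> *\<^sub>R \<eta>)) \<in> borel_measurable (borel \<Otimes>\<^sub>M borel)"
    by (simp add: case_prod_beta)
  have "(\<lambda>\<eta>. \<integral>\<^sup>+\<rho>\<in>{0<..<1}. ennreal (cmod (?H (\<rho> *\<^sub>R \<eta>)) powr q * (1 - \<rho>\<^sup>2) powr (d * q - 1)) \<partial>lborel)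
      \<in> borel_measurable borel"
    by measurable
  then have "radial_integral q d ?H \<in> borel_measurable sphere_measure"
    unfolding radial_integral_def[abs_def] by (rule measurable_sphere_measure)
  moreover have "radial_integral q d ?H \<eta> = radial_integral q d G \<eta>" if "\<eta> \<in> space sphere_measure" for \<eta>
    using that by (intro radial_integral_cong) (auto simp: space_sphere_measure)
  ultimately show ?thesis by (simp cong: measurable_cong)
qed

text \<open>The bound by \<open>l\<close> and a multiple of \<open>g powr q\<close>, integrated and optimised over \<open>l\<close>, replaces
  Hoelder's inequality.\<close>

lemma sqrt_le_threshold:
  fixes g l q :: real
  assumes "g \<ge> 0" "l > 0" "q \<ge> 1"
  shows "sqrt g \<le> l + l powr (1 - 2 * q) * g powr q"
proof (cases "sqrt g \<le> l")
  case True
  then show ?thesis by (simp add: add_increasing2)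
next
  case False
  then have s: "sqrt g > l" using assms by simp
  moreover from this have "0 < sqrt g" using assms by linarith
  ultimately have s: "sqrt g > l" "sqrt g > 0" by auto
  have "sqrt g = sqrt g powr (1 - 2 * q) * sqrt g powr (2 * q)"
    using s by (simp add: powr_add[symmetric])
  also have "sqrt g powr (2 * q) = g powr q"
    using assms by (simp add: powr_half_sqrt[symmetric] powr_powr)
  also have "sqrt g powr (1 - 2 * q) * g powr q \<le> l powr (1 - 2 * q) * g powr q"
    using s assms by (intro mult_right_mono powr_mono2') auto
  finally show ?thesis using assms by linarith
qed

text \<open>On the range of integration \<open>1 - \<rho>\<^sup>2\<close> is comparable to \<open>R\<close>. Integrating the threshold bound gives
  at most a constant times \<open>R l\<close> plus a term with \<open>A\<close>; the two balance for
  \<open>l = R powr (- d / 2) * A powr (1 / (2 * q))\<close>.\<close>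

lemma radial_average_bound:
  fixes g :: "real \<Rightarrow> real" and d :: real
  assumes g[measurable]: "g \<in> borel_measurable borel" "\<And>\<rho>. g \<rho> \<ge> 0"
    and q: "q \<ge> 1" and R: "0 < R"
  defines "A \<equiv> (\<integral>\<^sup>+\<rho>\<in>{0<..<1}. ennreal (g \<rho> powr q * (1 - \<rho>\<^sup>2) powr (d * q - 1)) \<partial>lborel)"
  shows "(\<integral>\<^sup>+\<rho>\<in>radial_range R. ennreal (sqrt (g \<rho>)) \<partial>lborel)
    \<le> ennreal ((3 + 3 powr \<bar>1 - d * q\<bar>) * R powr (1 - d / 2)) * enn_powr A (1 / (2 * q))"
proof (cases "A = top")
  case True
  then show ?thesis using R
    by (simp add: ennreal_mult_top add_nonneg_eq_0_iff add_pos_nonneg)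
next
  case False
  then obtain a where a: "A = ennreal a" "a \<ge> 0" by (cases A) auto
  define c where "c = 3 powr \<bar>1 - d * q\<bar>"
  have c: "c > 0" by (simp add: c_def)
  have weight: "1 \<le> c * R powr (1 - d * q) * (1 - \<rho>\<^sup>2) powr (d * q - 1)" if "\<rho> \<in> radial_range R" for \<rho>
  proof -
    define x where "x = (1 - \<rho>\<^sup>2) / R"
    have x: "1 / 3 \<le> x" "x \<le> 3" "x > 0" using that R by (auto simp: x_def radial_range_def field_simps)
    have "x powr (1 - d * q) \<le> c"
    proof (cases "1 - d * q \<ge> 0")
      case True
      then show ?thesis using x powr_mono2[of "1 - d * q" x 3] by (simp add: c_def)
    next
      case False
      then have "x powr (1 - d * q) \<le> (1 / 3) powr (1 - d * q)" using x by (intro powr_mono2') auto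
      also have "\<dots> = c" using False by (simp add: c_def powr_divide powr_minus_divide[symmetric])
      finally show ?thesis .
    qed
    then have "x powr (1 - d * q) * x powr (d * q - 1) \<le> c * x powr (d * q - 1)"
      by (intro mult_right_mono) auto
    then have "1 \<le> c * x powr (d * q - 1)" using x by (simp add: powr_add[symmetric])
    also have "x powr (d * q - 1) = R powr (1 - d * q) * (1 - \<rho>\<^sup>2) powr (d * q - 1)"
      using x R by (simp add: x_def powr_divide powr_minus_divide[symmetric] field_simps powr_diff powr_add)
    finally show ?thesis by (simp add: mult.assoc)
  qed
  define J where "J = (\<integral>\<^sup>+\<rho>\<in>radial_range R. ennreal (sqrt (g \<rho>)) \<partial>lborel)"
  have J: "J \<le> ennreal (3 * R * l + l powr (1 - 2 * q) * (c * R powr (1 - d * q)) * a)" if l: "l > 0" for l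
  proof -
    define k where "k = l powr (1 - 2 * q) * (c * R powr (1 - d * q))"
    have k: "k \<ge> 0" using c by (simp add: k_def)
    have "J \<le> (\<integral>\<^sup>+\<rho>. ennreal l * indicator (radial_range R) \<rho>
        + ennreal k * (ennreal (g \<rho> powr q * (1 - \<rho>\<^sup>2) powr (d * q - 1)) * indicator {0<..<1} \<rho>) \<partial>lborel)"
      unfolding J_def
    proof (rule nn_integral_mono)
      fix \<rho>
      show "ennreal (sqrt (g \<rho>)) * indicator (radial_range R) \<rho> \<le> ennreal l * indicator (radial_range R) \<rho>
        + ennreal k * (ennreal (g \<rho> powr q * (1 - \<rho>\<^sup>2) powr (d * q - 1)) * indicator {0<..<1} \<rho>)"
      proof (cases "\<rho> \<in> radial_range R")
        case True
        have "sqrt (g \<rho>) \<le> l + l powr (1 - 2 * q) * g \<rho> powr q * 1"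
          using sqrt_le_threshold[of "g \<rho>" l q] g(2) l q by simp
        also have "\<dots> \<le> l + l powr (1 - 2 * q) * g \<rho> powr q * (c * R powr (1 - d * q) * (1 - \<rho>\<^sup>2) powr (d * q - 1))"
          using weight[OF True] by (intro add_left_mono mult_left_mono) auto
        finally have "sqrt (g \<rho>) \<le> l + k * (g \<rho> powr q * (1 - \<rho>\<^sup>2) powr (d * q - 1))"
          by (simp add: k_def mult_ac)
        then have "ennreal (sqrt (g \<rho>)) \<le> ennreal l + ennreal k * ennreal (g \<rho> powr q * (1 - \<rho>\<^sup>2) powr (d * q - 1))"
          using l k by (simp add: ennreal_mult[symmetric] ennreal_plus[symmetric] del: ennreal_plus)
        moreover have "\<rho> \<in> {0<..<1}" using True by (simp add: radial_range_def)
        ultimately show ?thesis using True by simp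
      qed simp
    qed
    also have "\<dots> = ennreal l * emeasure lborel (radial_range R) + ennreal k * A"
      by (subst nn_integral_add) (auto simp: nn_integral_cmult A_def)
    also have "\<dots> \<le> ennreal l * ennreal (3 * R) + ennreal k * ennreal a"
      using emeasure_radial_range_le[OF R] a by (intro add_mono mult_left_mono) auto
    also have "\<dots> = ennreal (3 * R * l + k * a)"
      using l k R a(2) by (simp add: ennreal_mult[symmetric] ennreal_plus[symmetric] mult_ac del: ennreal_plus)
    finally show ?thesis by (simp add: k_def)
  qed
  show ?thesis
  proof (cases "a = 0")
    case True
    have "J \<le> 0"
    proof (rule ennreal_le_epsilon)
      fix e :: real assume "e > 0"
      then show "J \<le> 0 + ennreal e" using J[of "e / (3 * R)"] R True by simp
    qed
    then show ?thesis by (simp add: J_def)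
  next
    case False
    then have a0: "a > 0" using a by simp
    define l where "l = R powr (- d / 2) * a powr (1 / (2 * q))"
    have l: "l > 0" using R a0 by (simp add: l_def)
    have "l powr (2 * q) = R powr (- d * q) * a"
      using R a0 q by (simp add: l_def powr_mult powr_powr)
    then have "l powr (1 - 2 * q) * R powr (1 - d * q) * a = l * R"
      using R a0 l by (simp add: powr_diff field_simps powr_minus powr_add[symmetric])
    then have eq: "3 * R * l + l powr (1 - 2 * q) * (c * R powr (1 - d * q)) * a = (3 + c) * (R * l)"
      by (simp add: algebra_simps)
    have "R * l = R powr (1 - d / 2) * a powr (1 / (2 * q))"
      using R powr_add[of R 1 "- d / 2"] by (simp add: l_def)
    then have "J \<le> ennreal ((3 + c) * R powr (1 - d / 2) * a powr (1 / (2 * q)))"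
      using J[OF l] unfolding eq by (simp add: mult.assoc)
    also have "\<dots> = ennreal ((3 + c) * R powr (1 - d / 2)) * enn_powr A (1 / (2 * q))"
      using c a by (simp add: enn_powr_ennreal ennreal_mult)
    finally show ?thesis by (simp add: J_def c_def)
  qed
qed

text \<open>The sub-mean value property over a tangent box, polar coordinates and the radial estimate
  combined. The volume of the box is traded for \<open>R\<close> times the measure of the nonisotropic ball.\<close>

lemma sqrt_le_nonisotropic_average:
  fixes G :: "complex ^ 'n \<Rightarrow> complex"
  assumes cont: "continuous_on (ball 0 1) G" and hol: "line_holomorphic G (ball 0 1)" and q: "q \<ge> 1"
  shows "\<exists>C>0. \<forall>\<zeta>\<in>sphere 0 1. \<forall>R. 0 < R \<and> R < 1 \<longrightarrow>
    ennreal (sqrt (cmod (G ((1 - R) *\<^sub>R \<zeta>))) * R powr (d / 2) * measure sphere_measure (nonisotropic_ball \<zeta> (9 * R)))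
    \<le> ennreal C * (\<integral>\<^sup>+\<eta>\<in>nonisotropic_ball \<zeta> (9 * R). enn_powr (radial_integral q d G \<eta>) (1 / (2 * q)) \<partial>sphere_measure)"
proof -
  define V where "V = unit_ball_volume TYPE('n)"
  have V: "V > 0" unfolding V_def by (rule unit_ball_volume(2))
  define m where "m = DIM(complex ^ 'n)"
  have m: "m > 0" unfolding m_def by (rule DIM_positive)
  define c where "c = 3 + 3 powr \<bar>1 - d * q\<bar>"
  have c: "c > 0" by (simp add: c_def add_pos_nonneg)
  define C2 :: real where "C2 = 90 * 64 ^ m * 9 ^ m"
  define C where "C = C2 * 4 ^ m * real m * c"
  have C2: "C2 > 0" by (simp add: C2_def)
  have C: "C > 0" using C2 c m by (simp add: C_def)
  let ?H = "\<lambda>x. indicator (ball 0 1) x *\<^sub>R G x"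
  have Hm[measurable]: "?H \<in> borel_measurable borel" by (rule measurable_extended_by_zero[OF cont])
  define \<phi> where "\<phi> x = ennreal (sqrt (cmod (?H x)))" for x
  have \<phi>m[measurable]: "\<phi> \<in> borel_measurable borel" unfolding \<phi>_def by measurable
  have [measurable]: "radial_integral q d G \<in> borel_measurable sphere_measure"
    by (rule measurable_radial_integral[OF cont])
  have "ennreal (sqrt (cmod (G ((1 - R) *\<^sub>R \<zeta>))) * R powr (d / 2) * measure sphere_measure (nonisotropic_ball \<zeta> (9 * R)))
    \<le> ennreal C * (\<integral>\<^sup>+\<eta>\<in>nonisotropic_ball \<zeta> (9 * R). enn_powr (radial_integral q d G \<eta>) (1 / (2 * q)) \<partial>sphere_measure)"
    if \<zeta>: "\<zeta> \<in> sphere 0 1" and R: "0 < R" "R < 1" for \<zeta> R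
  proof -
    define z where "z = (1 - R) *\<^sub>R \<zeta>"
    define K where "K = tangent_box \<zeta> (R / 8)"
    define B where "B = nonisotropic_ball \<zeta> (9 * R)"
    have [measurable]: "K \<in> sets borel" unfolding K_def by (rule measurable_tangent_box)
    have [measurable]: "B \<in> sets sphere_measure" unfolding B_def by (rule nonisotropic_ball_in_sets)
    have box: "z + u \<in> polar_box \<zeta> R" if "u \<in> K" for u
      using translated_tangent_box_subset[OF \<zeta> R] that by (simp add: z_def K_def)
    have sub: "z + u \<in> ball 0 1" if "u \<in> K" for u
      using box[OF that] by (simp add: polar_box_def)
    have "sqrt (1 - R / 2) < 1" using R by simp
    from bounded_on_cball[OF cont this]
    obtain M where M: "\<And>x. norm x \<le> sqrt (1 - R / 2) \<Longrightarrow> cmod (G x) \<le> M" by blast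
    have bound: "cmod (G (z + u)) \<le> M" if "u \<in> K" for u
    proof (rule M)
      have "(norm (z + u))\<^sup>2 \<le> 1 - R / 2" using box[OF that] by (simp add: polar_box_def)
      then show "norm (z + u) \<le> sqrt (1 - R / 2)" by (rule real_le_rsqrt)
    qed
    define X where "X = (\<integral>\<^sup>+\<eta>\<in>B. enn_powr (radial_integral q d G \<eta>) (1 / (2 * q)) \<partial>sphere_measure)"
    have "ennreal (sqrt (cmod (G z))) * emeasure lborel K
      \<le> ennreal (4 ^ m) * (\<integral>\<^sup>+u\<in>K. ennreal (sqrt (cmod (G (z + u)))) \<partial>lborel)"
      unfolding m_def
    proof (rule sqrt_sub_mean_value[OF cont hol])
      show "open K" "convex K" unfolding K_def by (rule open_tangent_box convex_tangent_box)+
      show "\<And>c u. cmod c \<le> 1 \<Longrightarrow> u \<in> K \<Longrightarrow> c *s u \<in> K" unfolding K_def by (rule balanced_tangent_box)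
      show "0 < emeasure lborel K" unfolding K_def by (rule emeasure_tangent_box_pos) (use R in simp)
      show "emeasure lborel K < \<infinity>" unfolding K_def by (rule emeasure_tangent_box_finite)
    qed (use sub bound in auto)
    also have "(\<integral>\<^sup>+u\<in>K. ennreal (sqrt (cmod (G (z + u)))) \<partial>lborel)
        \<le> (\<integral>\<^sup>+u. \<phi> (z + u) * indicator (polar_box \<zeta> R) (z + u) \<partial>lborel)"
    proof (rule nn_integral_mono)
      fix u
      show "ennreal (sqrt (cmod (G (z + u)))) * indicator K u \<le> \<phi> (z + u) * indicator (polar_box \<zeta> R) (z + u)"
      proof (cases "u \<in> K")
        case True
        then show ?thesis using box[OF True] sub[OF True] by (simp add: \<phi>_def)
      qed simp
    qed
    also have "\<dots> = (\<integral>\<^sup>+x\<in>polar_box \<zeta> R. \<phi> x \<partial>lborel)"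
      by (rule nn_integral_lborel_translate) measurable
    also have "\<dots> \<le> ennreal (real m * V) * (\<integral>\<^sup>+\<eta>\<in>B. (\<integral>\<^sup>+\<rho>\<in>radial_range R. \<phi> (\<rho> *\<^sub>R \<eta>) \<partial>lborel) \<partial>sphere_measure)"
      unfolding m_def V_def B_def by (rule nn_integral_polar_box_le) measurable
    also have "(\<integral>\<^sup>+\<eta>\<in>B. (\<integral>\<^sup>+\<rho>\<in>radial_range R. \<phi> (\<rho> *\<^sub>R \<eta>) \<partial>lborel) \<partial>sphere_measure)
       \<le> (\<integral>\<^sup>+\<eta>. ennreal (c * R powr (1 - d / 2)) * (enn_powr (radial_integral q d G \<eta>) (1 / (2 * q)) * indicator B \<eta>) \<partial>sphere_measure)"
    proof (rule nn_integral_mono)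
      fix \<eta> :: "complex ^ 'n" assume "\<eta> \<in> space sphere_measure"
      then have \<eta>: "\<eta> \<in> sphere 0 1" by (simp add: space_sphere_measure)
      have "(\<lambda>\<rho> :: real. \<rho> *\<^sub>R \<eta>) \<in> borel_measurable borel" by measurable
      from measurable_compose[OF measurable_compose[OF this Hm] borel_measurable_norm]
      have gm: "(\<lambda>\<rho>. cmod (?H (\<rho> *\<^sub>R \<eta>))) \<in> borel_measurable borel" .
      have "(\<integral>\<^sup>+\<rho>\<in>radial_range R. \<phi> (\<rho> *\<^sub>R \<eta>) \<partial>lborel)
          \<le> ennreal (c * R powr (1 - d / 2)) * enn_powr (radial_integral q d ?H \<eta>) (1 / (2 * q))"
        unfolding \<phi>_def c_def radial_integral_def
        by (rule radial_average_bound[OF gm]) (use q R in auto)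
      also have "radial_integral q d ?H \<eta> = radial_integral q d G \<eta>"
        by (rule radial_integral_cong[OF \<eta>]) simp
      finally have "(\<integral>\<^sup>+\<rho>\<in>radial_range R. \<phi> (\<rho> *\<^sub>R \<eta>) \<partial>lborel) * indicator B \<eta>
          \<le> ennreal (c * R powr (1 - d / 2)) * enn_powr (radial_integral q d G \<eta>) (1 / (2 * q)) * indicator B \<eta>"
        by (rule mult_right_mono) simp
      then show "(\<integral>\<^sup>+\<rho>\<in>radial_range R. \<phi> (\<rho> *\<^sub>R \<eta>) \<partial>lborel) * indicator B \<eta>
          \<le> ennreal (c * R powr (1 - d / 2)) * (enn_powr (radial_integral q d G \<eta>) (1 / (2 * q)) * indicator B \<eta>)"
        by (simp only: mult.assoc)
    qed
    also have "\<dots> = ennreal (c * R powr (1 - d / 2)) * X"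
      unfolding X_def by (rule nn_integral_cmult) measurable
    finally have 1: "ennreal (sqrt (cmod (G z))) * emeasure lborel K
        \<le> ennreal (4 ^ m) * (ennreal (real m * V) * (ennreal (c * R powr (1 - d / 2)) * X))"
      by (simp add: mult_left_mono)
    have 2: "V * R * measure sphere_measure B \<le> C2 * measure lborel K"
      unfolding V_def B_def C2_def K_def m_def by (rule measure_nonisotropic_ball_le[OF \<zeta> R]) auto
    define k where "k = R powr (d / 2 - 1) / V"
    have k: "k > 0" using R V by (simp add: k_def)
    have "R powr (d / 2) = R * R powr (d / 2 - 1)" using R powr_add[of R 1 "d / 2 - 1"] by simp
    then have "sqrt (cmod (G z)) * R powr (d / 2) * measure sphere_measure B
       = sqrt (cmod (G z)) * k * (V * R * measure sphere_measure B)"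
      using V by (simp add: k_def)
    also have "\<dots> \<le> sqrt (cmod (G z)) * k * (C2 * measure lborel K)"
      using k 2 by (intro mult_left_mono) auto
    finally have "ennreal (sqrt (cmod (G z)) * R powr (d / 2) * measure sphere_measure B)
        \<le> ennreal (k * C2 * (sqrt (cmod (G z)) * measure lborel K))"
      by (intro ennreal_leI) (simp add: mult_ac)
    also have "\<dots> = ennreal (k * C2) * (ennreal (sqrt (cmod (G z))) * emeasure lborel K)"
      using k C2 unfolding K_def emeasure_tangent_box by (simp add: ennreal_mult)
    also have "\<dots> \<le> ennreal (k * C2) * (ennreal (4 ^ m) * (ennreal (real m * V) * (ennreal (c * R powr (1 - d / 2)) * X)))"
      by (intro mult_left_mono 1) simp
    also have "\<dots> = ennreal (k * C2 * 4 ^ m * (real m * V) * (c * R powr (1 - d / 2))) * X"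
      using k C2 V c by (simp add: ennreal_mult mult.assoc)
    also have "k * C2 * 4 ^ m * (real m * V) * (c * R powr (1 - d / 2))
        = C * (R powr (d / 2 - 1) * R powr (1 - d / 2))"
      using V by (simp add: k_def C_def)
    also have "\<dots> = C" using R by (simp add: powr_add[symmetric])
    finally show ?thesis by (simp add: X_def z_def B_def)
  qed
  then show ?thesis using C by blast
qed

section \<open>The weighted maximal inequality\<close>

text \<open>Integrated over a ball and optimised over \<open>l\<close>, this takes the place of Hoelder's inequality for
  \<open>w\<close> and its dual weight \<open>w powr (- (1 / (p - 1)))\<close>.\<close>

lemma le_weight_threshold:
  fixes x w l p :: real
  assumes "x \<ge> 0" "w > 0" "l > 0" "p > 1"
  shows "x \<le> l * w powr (- (1 / (p - 1))) + l powr (1 - p) * (x powr p * w)"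
proof -
  define y where "y = w powr (- (1 / (p - 1)))"
  have y: "y > 0" using assms by (simp add: y_def)
  have "- (1 / (p - 1)) * (1 - p) = 1" using assms by (simp add: field_simps)
  then have w: "y powr (1 - p) = w" using assms by (simp only: y_def powr_powr) simp
  show ?thesis
  proof (cases "x \<le> l * y")
    case True
    then show ?thesis using assms by (simp add: y_def add_increasing2)
  next
    case False
    then have x: "x > 0" using y assms by (meson le_less_trans less_le_trans mult_pos_pos not_le_imp_less order_less_imp_le)
    have "x = x powr p * x powr (1 - p)" using x by (simp add: powr_add[symmetric])
    also have "\<dots> \<le> x powr p * (l * y) powr (1 - p)"
      using False y assms by (intro mult_left_mono powr_mono2') auto
    also have "\<dots> = l powr (1 - p) * (x powr p * w)"
      using assms y by (simp add: powr_mult w)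
    finally show ?thesis using assms by (simp add: add_increasing)
  qed
qed

text \<open>If both \<open>X\<close> and \<open>V\<close> are positive, the two terms balance for \<open>l powr p = X / V\<close>; otherwise letting
  \<open>l\<close> tend to zero or to infinity forces \<open>a = 0\<close>.\<close>

lemma threshold_optimize:
  fixes a X V p :: real
  assumes nn: "a \<ge> 0" "X \<ge> 0" "V \<ge> 0" and p: "p > 1"
    and le: "\<And>l. l > 0 \<Longrightarrow> a \<le> l * V + l powr (1 - p) * X"
  shows "a powr p \<le> 2 powr p * X * V powr (p - 1)"
proof -
  consider "a = 0" | "a > 0" "X = 0" | "a > 0" "X > 0" "V = 0" | "a > 0" "X > 0" "V > 0"
    using nn by linarith
  then show ?thesis
  proof cases
    case 1
    then show ?thesis using nn by simp
  next
    case 2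
    have "a / (2 * (V + 1)) > 0" using 2 nn by simp
    from le[OF this] have "a \<le> a / (2 * (V + 1)) * V" using 2 by simp
    also have "\<dots> < a" using 2 nn by (simp add: field_simps add_nonneg_pos)
    finally show ?thesis by simp
  next
    case 3
    define l where "l = (a / (2 * X)) powr (1 / (1 - p))"
    have l: "l > 0" using 3 by (simp add: l_def)
    have "l powr (1 - p) = a / (2 * X)" using 3 p by (simp add: l_def powr_powr)
    with le[OF l] have "a \<le> a / 2" using 3 by simp
    then show ?thesis using 3 by simp
  next
    case 4
    define l where "l = (X / V) powr (1 / p)"
    have l: "l > 0" using 4 by (simp add: l_def)
    have lp: "l powr p = X / V" using 4 p by (simp add: l_def powr_powr)
    have "l powr (1 - p) * X = l * V"
      using l 4 by (simp add: powr_diff lp)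
    with le[OF l] have "a \<le> 2 * (l * V)" by (simp add: mult.commute)
    then have "a powr p \<le> (2 * (l * V)) powr p" using nn p by (intro powr_mono2) auto
    also have "\<dots> = 2 powr p * (X / V * V powr p)"
      using l 4 by (simp add: powr_mult lp)
    also have "X / V * V powr p = X * V powr (p - 1)" using 4 by (simp add: powr_diff)
    finally show ?thesis by (simp add: mult.assoc)
  qed
qed

lemma measurable_weight:
  assumes "Ap_weight p w"
  shows "w \<in> borel_measurable sphere_measure"
  using assms unfolding Ap_weight_def by blast

text \<open>Where the weight vanishes the dual weight is infinite, so the pointwise bound holds only
  almost everywhere on a ball over which the dual weight is integrable. On any other ball the
  condition forces \<open>w\<close> to have integral zero, and there is nothing to prove.\<close>

lemma Ap_weight_test:
  fixes w :: "complex ^ 'n \<Rightarrow> real"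
  assumes p: "p > 1" and Ap: "Ap_weight p w"
  obtains C where "C > 0" "\<And>\<zeta> r A f. \<zeta> \<in> sphere 0 1 \<Longrightarrow> r > 0 \<Longrightarrow>
    0 < measure sphere_measure (nonisotropic_ball \<zeta> r) \<Longrightarrow> A \<in> sets sphere_measure \<Longrightarrow>
    A \<subseteq> nonisotropic_ball \<zeta> r \<Longrightarrow> f \<in> borel_measurable sphere_measure \<Longrightarrow>
    enn_powr (\<integral>\<^sup>+\<eta>\<in>A. f \<eta> \<partial>sphere_measure) p * (\<integral>\<^sup>+\<eta>\<in>nonisotropic_ball \<zeta> r. ennreal (w \<eta>) \<partial>sphere_measure)
    \<le> ennreal C * (enn_powr (emeasure sphere_measure (nonisotropic_ball \<zeta> r)) p *
        (\<integral>\<^sup>+\<eta>\<in>A. enn_powr (f \<eta>) p * ennreal (w \<eta>) \<partial>sphere_measure))"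
proof -
  let ?v = "\<lambda>\<eta>. inverse (ennreal (w \<eta> powr (1 / (p - 1))))"
  let ?s = "sphere_measure :: (complex ^ 'n) measure"
  have wm[measurable]: "w \<in> borel_measurable ?s" by (rule measurable_weight[OF Ap])
  have vm[measurable]: "?v \<in> borel_measurable ?s" by measurable
  have w0: "w \<eta> \<ge> 0" if "\<eta> \<in> sphere 0 1" for \<eta> using Ap that unfolding Ap_weight_def by blast
  obtain C0 where C0: "C0 > 0" "\<And>\<zeta> r. \<zeta> \<in> sphere 0 1 \<Longrightarrow> r > 0 \<Longrightarrow>
      ((\<integral>\<^sup>+\<eta>\<in>nonisotropic_ball \<zeta> r. ennreal (w \<eta>) \<partial>?s) / emeasure ?s (nonisotropic_ball \<zeta> r)) *
      enn_powr ((\<integral>\<^sup>+\<eta>\<in>nonisotropic_ball \<zeta> r. ?v \<eta> \<partial>?s) / emeasure ?s (nonisotropic_ball \<zeta> r)) (p - 1) \<le> ennreal C0"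
    using Ap unfolding Ap_weight_def Let_def by blast
  show thesis
  proof (rule that[of "2 powr p * C0"])
    show "2 powr p * C0 > 0" using C0 by simp
    fix \<zeta> :: "complex ^ 'n" and r and A and f :: "complex ^ 'n \<Rightarrow> ennreal"
    assume \<zeta>: "\<zeta> \<in> sphere 0 1" and r: "r > 0" and pos: "0 < measure ?s (nonisotropic_ball \<zeta> r)"
      and A[measurable]: "A \<in> sets ?s" and AB: "A \<subseteq> nonisotropic_ball \<zeta> r" and f[measurable]: "f \<in> borel_measurable ?s"
    define B where "B = nonisotropic_ball \<zeta> r"
    have B[measurable]: "B \<in> sets ?s" unfolding B_def by (rule nonisotropic_ball_in_sets)
    define M where "M = emeasure ?s B"
    have M: "M \<noteq> 0" "M \<noteq> top"
      using pos by (simp_all add: M_def B_def emeasure_nonisotropic_ball)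
    define W where "W = (\<integral>\<^sup>+\<eta>\<in>B. ennreal (w \<eta>) \<partial>?s)"
    define V where "V = (\<integral>\<^sup>+\<eta>\<in>B. ?v \<eta> \<partial>?s)"
    define a where "a = (\<integral>\<^sup>+\<eta>\<in>A. f \<eta> \<partial>?s)"
    define X where "X = (\<integral>\<^sup>+\<eta>\<in>A. enn_powr (f \<eta>) p * ennreal (w \<eta>) \<partial>?s)"
    have cond: "W / M * enn_powr (V / M) (p - 1) \<le> ennreal C0"
      using C0(2)[OF \<zeta> r] by (simp add: W_def V_def M_def B_def)
    have div: "x / M * M = x" for x
      using M by (simp add: ennreal_divide_times ennreal_divide_self top.not_eq_extremum)
    have "enn_powr a p * W \<le> ennreal (2 powr p * C0) * (enn_powr M p * X)"
    proof (cases "W = 0 \<or> X = top")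
      case True
      then show ?thesis
      proof
        assume "X = top"
        moreover have "enn_powr M p \<noteq> 0" using M by (simp add: enn_powr_eq_0_iff)
        ultimately show ?thesis using C0(1) by (simp add: ennreal_mult_top)
      qed simp
    next
      case False
      have Vfin: "V \<noteq> top"
      proof
        assume V: "V = top"
        have "W / M \<noteq> 0" using False M by (simp add: ennreal_divide_eq_0_iff)
        then show False using cond V M by (simp add: ennreal_top_divide ennreal_mult_top top_unique)
      qed
      then obtain V' where V': "V = ennreal V'" "V' \<ge> 0" by (cases V) auto
      obtain X' where X': "X = ennreal X'" "X' \<ge> 0" using False by (cases X) auto
      have ae: "AE \<eta> in ?s. ?v \<eta> * indicator B \<eta> \<noteq> \<infinity>"
        using Vfin unfolding V_def by (intro nn_integral_PInf_AE) auto
      have le: "a \<le> ennreal (l * V' + l powr (1 - p) * X')" if l: "l > 0" for l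
      proof -
        have "a \<le> (\<integral>\<^sup>+\<eta>. ennreal l * (?v \<eta> * indicator B \<eta>)
            + ennreal (l powr (1 - p)) * (enn_powr (f \<eta>) p * ennreal (w \<eta>) * indicator A \<eta>) \<partial>?s)"
          unfolding a_def
        proof (rule nn_integral_mono_AE)
          show "AE \<eta> in ?s. f \<eta> * indicator A \<eta> \<le> ennreal l * (?v \<eta> * indicator B \<eta>)
            + ennreal (l powr (1 - p)) * (enn_powr (f \<eta>) p * ennreal (w \<eta>) * indicator A \<eta>)"
            using ae
          proof eventually_elim
            case (elim \<eta>)
            show ?case
            proof (cases "\<eta> \<in> A")
              case True
              then have \<eta>: "\<eta> \<in> B" using AB by (auto simp: B_def)
              then have "\<eta> \<in> sphere 0 1" by (auto simp: B_def nonisotropic_ball_def)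
              have "w \<eta> \<noteq> 0" using elim \<eta> by auto
              then have w: "w \<eta> > 0" using w0[OF \<open>\<eta> \<in> sphere 0 1\<close>] by simp
              have v: "?v \<eta> = ennreal (w \<eta> powr (- (1 / (p - 1))))"
                using w by (simp add: inverse_ennreal powr_minus)
              have "f \<eta> \<le> ennreal l * ?v \<eta> + ennreal (l powr (1 - p)) * (enn_powr (f \<eta>) p * ennreal (w \<eta>))"
              proof (cases "f \<eta>")
                case (real x)
                have "ennreal x \<le> ennreal (l * w \<eta> powr (- (1 / (p - 1))) + l powr (1 - p) * (x powr p * w \<eta>))"
                  using le_weight_threshold[OF real(1) w l p] by (rule ennreal_leI)
                then show ?thesis
                  unfolding v real(2) using l w real(1) by (simp add: enn_powr_ennreal ennreal_mult)
              next
                case top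
                then show ?thesis using l w by (simp add: ennreal_mult_top ennreal_top_mult)
              qed
              then show ?thesis using True \<eta> by simp
            qed simp
          qed
        qed
        also have "\<dots> = ennreal l * V + ennreal (l powr (1 - p)) * X"
          unfolding V_def X_def by (subst nn_integral_add) (auto simp: nn_integral_cmult)
        finally show ?thesis
          using l V' X' by (simp add: ennreal_mult)
      qed
      have "a < top" using le[of 1] by (simp add: le_less_trans)
      then obtain a' where a': "a = ennreal a'" "a' \<ge> 0" by (cases a) auto
      have "a' powr p \<le> 2 powr p * X' * V' powr (p - 1)"
      proof (rule threshold_optimize[OF a'(2) X'(2) V'(2) p])
        fix l :: real assume l: "l > 0"
        have "l * V' + l powr (1 - p) * X' \<ge> 0" using l V' X' by simp
        then show "a' \<le> l * V' + l powr (1 - p) * X'"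
          using le[OF l] unfolding a'(1) by (simp only: ennreal_le_iff)
      qed
      then have "enn_powr a p \<le> ennreal (2 powr p) * X * enn_powr V (p - 1)"
        unfolding a'(1) V'(1) X'(1) using a' X' V' by (simp add: enn_powr_ennreal ennreal_mult[symmetric] ennreal_leI)
      then have "enn_powr a p * W \<le> ennreal (2 powr p) * X * enn_powr V (p - 1) * W"
        by (rule mult_right_mono) simp
      also have "\<dots> = ennreal (2 powr p) * X * (enn_powr (V / M * M) (p - 1) * (W / M * M))"
        unfolding div by (simp add: mult.assoc)
      also have "\<dots> = ennreal (2 powr p) * X * ((W / M * enn_powr (V / M) (p - 1)) * (enn_powr M (p - 1) * enn_powr M 1))"
        using p by (simp only: enn_powr_mult enn_powr_one diff_gt_0_iff_gt mult_ac)
      also have "\<dots> \<le> ennreal (2 powr p) * X * (ennreal C0 * (enn_powr M (p - 1) * enn_powr M 1))"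
        by (intro mult_left_mono mult_right_mono cond) auto
      also have "enn_powr M (p - 1) * enn_powr M 1 = enn_powr M p"
        using p by (subst enn_powr_add[symmetric]) auto
      finally show ?thesis using C0(1) by (simp add: ennreal_mult mult_ac)
    qed
    then show "enn_powr (\<integral>\<^sup>+\<eta>\<in>A. f \<eta> \<partial>?s) p * (\<integral>\<^sup>+\<eta>\<in>nonisotropic_ball \<zeta> r. ennreal (w \<eta>) \<partial>?s)
      \<le> ennreal (2 powr p * C0) * (enn_powr (emeasure ?s (nonisotropic_ball \<zeta> r)) p *
        (\<integral>\<^sup>+\<eta>\<in>A. enn_powr (f \<eta>) p * ennreal (w \<eta>) \<partial>?s))"
      by (simp add: a_def W_def M_def X_def B_def)
  qed
qed

text \<open>Greedy selection: keep a ball of maximal radius, which by the quasi-triangle inequality engulfs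
  in its tenfold enlargement every ball that it meets, and continue with the balls disjoint from it.\<close>

lemma finite_vitali_selection:
  fixes T :: "((complex ^ 'n) \<times> real) set"
  assumes "finite T" "\<And>x. x \<in> T \<Longrightarrow> fst x \<in> sphere 0 1 \<and> snd x > 0"
  shows "\<exists>T'\<subseteq>T. disjoint_family_on (\<lambda>x. nonisotropic_ball (fst x) (snd x)) T'
    \<and> (\<Union>x\<in>T. nonisotropic_ball (fst x) (snd x)) \<subseteq> (\<Union>x\<in>T'. nonisotropic_ball (fst x) (10 * snd x))"
  using assms
proof (induction T rule: finite_psubset_induct)
  case (psubset T)
  let ?B = "\<lambda>x :: (complex ^ 'n) \<times> real. nonisotropic_ball (fst x) (snd x)"
  show ?case
  proof (cases "T = {}")
    case True
    then show ?thesis by (intro exI[of _ "{}"]) (simp add: disjoint_family_on_def)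
  next
    case False
    obtain x0 where x0: "x0 \<in> T" "\<And>x. x \<in> T \<Longrightarrow> snd x \<le> snd x0"
    proof -
      have "Max (snd ` T) \<in> snd ` T" using psubset(1) False by (intro Max_in) auto
      then obtain x0 where "x0 \<in> T" "snd x0 = Max (snd ` T)" by auto
      then show ?thesis using psubset(1) by (intro that[of x0]) auto
    qed
    define T1 where "T1 = {x \<in> T. ?B x \<inter> ?B x0 = {}} - {x0}"
    have "T1 \<subset> T" using x0(1) by (auto simp: T1_def)
    then obtain T' where T': "T' \<subseteq> T1" "disjoint_family_on ?B T'"
      "(\<Union>x\<in>T1. ?B x) \<subseteq> (\<Union>x\<in>T'. nonisotropic_ball (fst x) (10 * snd x))"
      using psubset(2)[of T1] psubset(3) by blast
    have "disjoint_family_on ?B (insert x0 T')"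
      using T'(1,2) by (auto simp: disjoint_family_on_def T1_def)
    moreover have "?B x \<subseteq> (\<Union>x\<in>insert x0 T'. nonisotropic_ball (fst x) (10 * snd x))" if x: "x \<in> T" for x
    proof (cases "x \<in> T1")
      case True
      then show ?thesis using T'(3) by blast
    next
      case nT1: False
      have "?B x \<subseteq> nonisotropic_ball (fst x0) (10 * snd x0)"
      proof (cases "x = x0")
        case True
        have "snd x0 \<le> 10 * snd x0" using psubset(3)[OF x0(1)] by simp
        then show ?thesis unfolding True by (rule nonisotropic_ball_mono)
      next
        case False
        then show ?thesis
          using nT1 x x0 psubset(3) by (intro nonisotropic_ball_engulfing) (auto simp: T1_def)
      qed
      then show ?thesis by blast
    qed
    ultimately show ?thesis
      using x0(1) T'(1) by (intro exI[of _ "insert x0 T'"]) (auto simp: T1_def)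
  qed
qed

text \<open>The averages that occur in the local estimate: over balls of radius \<open>9 * R\<close> with \<open>R < 1\<close>,
  the range of the doubling property.\<close>

definition average_at_least :: "(complex ^ 'n \<Rightarrow> ennreal) \<Rightarrow> real \<Rightarrow> complex ^ 'n \<Rightarrow> bool" where
  "average_at_least f t \<zeta> \<longleftrightarrow> (\<exists>R. 0 < R \<and> R < 1 \<and>
    ennreal (t * measure sphere_measure (nonisotropic_ball \<zeta> (9 * R)))
      \<le> (\<integral>\<^sup>+\<eta>\<in>nonisotropic_ball \<zeta> (9 * R). f \<eta> \<partial>sphere_measure))"

text \<open>By Lindelof's theorem countably many of the given balls cover \<open>E\<close>, by
  continuity of measure it suffices to treat finitely many, and among these a disjoint family can be selected
  whose tenfold enlargements still cover.\<close>

lemma weighted_weak_type: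
  fixes w :: "complex ^ 'n \<Rightarrow> real"
  assumes p: "p > 1" and Ap: "Ap_weight p w"
  obtains C where "C > 0" "\<And>f E t. f \<in> borel_measurable sphere_measure \<Longrightarrow> E \<in> sets sphere_measure \<Longrightarrow> t > 0 \<Longrightarrow>
    (\<And>\<zeta>. \<zeta> \<in> E \<Longrightarrow> average_at_least f t \<zeta>) \<Longrightarrow>
    ennreal (t powr p) * (\<integral>\<^sup>+\<eta>\<in>E. ennreal (w \<eta>) \<partial>sphere_measure)
    \<le> ennreal C * (\<integral>\<^sup>+\<eta>. enn_powr (f \<eta>) p * ennreal (w \<eta>) \<partial>sphere_measure)"
proof -
  let ?s = "sphere_measure :: (complex ^ 'n) measure"
  have wm[measurable]: "w \<in> borel_measurable ?s" by (rule measurable_weight[OF Ap])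
  obtain C1 where C1: "C1 > 0" "\<And>\<zeta> r A f. \<zeta> \<in> sphere 0 1 \<Longrightarrow> r > 0 \<Longrightarrow>
    0 < measure ?s (nonisotropic_ball \<zeta> r) \<Longrightarrow> A \<in> sets ?s \<Longrightarrow>
    A \<subseteq> nonisotropic_ball \<zeta> r \<Longrightarrow> f \<in> borel_measurable ?s \<Longrightarrow>
    enn_powr (\<integral>\<^sup>+\<eta>\<in>A. f \<eta> \<partial>?s) p * (\<integral>\<^sup>+\<eta>\<in>nonisotropic_ball \<zeta> r. ennreal (w \<eta>) \<partial>?s)
    \<le> ennreal C1 * (enn_powr (emeasure ?s (nonisotropic_ball \<zeta> r)) p *
        (\<integral>\<^sup>+\<eta>\<in>A. enn_powr (f \<eta>) p * ennreal (w \<eta>) \<partial>?s))"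
    by (rule Ap_weight_test[OF p Ap]) blast
  obtain D where D: "D > 0" "\<And>\<zeta> R. \<zeta> \<in> sphere (0 :: complex ^ 'n) 1 \<Longrightarrow> 0 < R \<Longrightarrow> R < 1 \<Longrightarrow>
     measure ?s (nonisotropic_ball \<zeta> (90 * R)) \<le> D * measure ?s (nonisotropic_ball \<zeta> (9 * R))"
    using nonisotropic_ball_doubling by blast
  define C where "C = C1 * D powr p"
  have C: "C > 0" using C1(1) D(1) by (simp add: C_def)
  define \<nu> where "\<nu> = density ?s (\<lambda>\<eta>. ennreal (w \<eta>))"
  have \<nu>: "emeasure \<nu> A = (\<integral>\<^sup>+\<eta>\<in>A. ennreal (w \<eta>) \<partial>?s)" if "A \<in> sets ?s" for A
    using that unfolding \<nu>_def by (intro emeasure_density) auto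
  have sets\<nu>: "sets \<nu> = sets ?s" by (simp add: \<nu>_def)
  show thesis
  proof (rule that[OF C])
    fix f :: "complex ^ 'n \<Rightarrow> ennreal" and E and t :: real
    assume f[measurable]: "f \<in> borel_measurable ?s" and E: "E \<in> sets ?s" and t: "t > 0"
      and av: "\<And>\<zeta>. \<zeta> \<in> E \<Longrightarrow> average_at_least f t \<zeta>"
    have ES: "E \<subseteq> sphere 0 1" using sets.sets_into_space[OF E] by (simp add: space_sphere_measure)
    obtain R where R: "\<And>\<zeta>. \<zeta> \<in> E \<Longrightarrow> 0 < R \<zeta> \<and> R \<zeta> < 1 \<and>
        ennreal (t * measure ?s (nonisotropic_ball \<zeta> (9 * R \<zeta>))) \<le> (\<integral>\<^sup>+\<eta>\<in>nonisotropic_ball \<zeta> (9 * R \<zeta>). f \<eta> \<partial>?s)"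
      using av unfolding average_at_least_def by metis
    define F where "F \<eta> = enn_powr (f \<eta>) p * ennreal (w \<eta>)" for \<eta>
    have Fm[measurable]: "F \<in> borel_measurable ?s" unfolding F_def by measurable
    let ?B = "\<lambda>\<zeta>. nonisotropic_ball \<zeta> (9 * R \<zeta>)"
    \<comment> \<open>The condition on the weight is used on the enlarged ball, with \<open>f\<close> restricted to the ball itself;
      doubling compares the two measures.\<close>
    have single: "ennreal (t powr p) * emeasure \<nu> (nonisotropic_ball \<zeta> (10 * (9 * R \<zeta>)))
        \<le> ennreal C * emeasure (density ?s F) (?B \<zeta>)" if "\<zeta> \<in> E" for \<zeta>
    proof -
      have \<zeta>: "\<zeta> \<in> sphere 0 1" using that ES by blast
      have R\<zeta>: "0 < R \<zeta>" "R \<zeta> < 1" using R[OF that] by auto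
      define b where "b = measure ?s (?B \<zeta>)"
      define b' where "b' = measure ?s (nonisotropic_ball \<zeta> (90 * R \<zeta>))"
      have b: "b > 0" unfolding b_def by (rule measure_nonisotropic_ball_pos[OF \<zeta> R\<zeta>])
      have Bm[measurable]: "?B \<zeta> \<in> sets ?s" by (rule nonisotropic_ball_in_sets)
      have sub: "?B \<zeta> \<subseteq> nonisotropic_ball \<zeta> (90 * R \<zeta>)" using R\<zeta> by (intro nonisotropic_ball_mono) auto
      have bb': "b \<le> b'"
        unfolding b_def b'_def
        by (rule finite_measure.finite_measure_mono[OF finite_sphere_measure sub nonisotropic_ball_in_sets])
      have b'D: "b' \<le> D * b" unfolding b_def b'_def by (rule D(2)[OF \<zeta> R\<zeta>])
      define W where "W = emeasure \<nu> (nonisotropic_ball \<zeta> (90 * R \<zeta>))"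
      have W: "W = (\<integral>\<^sup>+\<eta>\<in>nonisotropic_ball \<zeta> (90 * R \<zeta>). ennreal (w \<eta>) \<partial>?s)"
        unfolding W_def by (rule \<nu>[OF nonisotropic_ball_in_sets])
      define X where "X = emeasure (density ?s F) (?B \<zeta>)"
      have X: "X = (\<integral>\<^sup>+\<eta>\<in>?B \<zeta>. enn_powr (f \<eta>) p * ennreal (w \<eta>) \<partial>?s)"
        unfolding X_def F_def[symmetric] by (rule emeasure_density) auto
      have "ennreal (b powr p) * (ennreal (t powr p) * W) = enn_powr (ennreal (t * b)) p * W"
      proof -
        have "enn_powr (ennreal (t * b)) p = ennreal (t powr p) * ennreal (b powr p)"
          using t b by (subst enn_powr_ennreal) (auto simp: powr_mult ennreal_mult)
        then show ?thesis by (simp add: mult_ac)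
      qed
      also have "\<dots> \<le> enn_powr (\<integral>\<^sup>+\<eta>\<in>?B \<zeta>. f \<eta> \<partial>?s) p * W"
        using R[OF that] p by (intro mult_right_mono enn_powr_mono) (auto simp: b_def)
      also have "\<dots> \<le> ennreal C1 * (enn_powr (emeasure ?s (nonisotropic_ball \<zeta> (90 * R \<zeta>))) p * X)"
        unfolding W X using R\<zeta> b bb' by (intro C1(2)[OF \<zeta> _ _ Bm sub f]) (auto simp: b'_def)
      also have "emeasure ?s (nonisotropic_ball \<zeta> (90 * R \<zeta>)) = ennreal b'"
        unfolding b'_def by (rule emeasure_nonisotropic_ball)
      also have "ennreal C1 * (enn_powr (ennreal b') p * X) \<le> ennreal C1 * (enn_powr (ennreal (D * b)) p * X)"
        using b'D p by (intro mult_left_mono mult_right_mono enn_powr_mono ennreal_leI) auto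
      also have "\<dots> = ennreal (b powr p) * (ennreal C * X)"
      proof -
        have "enn_powr (ennreal (D * b)) p = ennreal (D powr p) * ennreal (b powr p)"
          using D(1) b by (subst enn_powr_ennreal) (auto simp: powr_mult ennreal_mult)
        then show ?thesis using C1(1) by (simp add: C_def ennreal_mult mult_ac)
      qed
      finally have "ennreal (t powr p) * W \<le> ennreal C * X"
        using b by (subst (asm) ennreal_mult_le_mult_iff) auto
      then show ?thesis by (simp add: W_def X_def)
    qed
    have fin: "ennreal (t powr p) * emeasure \<nu> (\<Union>\<zeta>\<in>T. ?B \<zeta>) \<le> ennreal C * (\<integral>\<^sup>+\<eta>. F \<eta> \<partial>?s)"
      if T: "finite T" "T \<subseteq> E" for T
    proof -
      let ?P = "(\<lambda>\<zeta>. (\<zeta>, 9 * R \<zeta>)) ` T"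
      have "\<exists>P'\<subseteq>?P. disjoint_family_on (\<lambda>x. nonisotropic_ball (fst x) (snd x)) P'
        \<and> (\<Union>x\<in>?P. nonisotropic_ball (fst x) (snd x)) \<subseteq> (\<Union>x\<in>P'. nonisotropic_ball (fst x) (10 * snd x))"
        by (rule finite_vitali_selection) (use T R ES in auto)
      then obtain P' where P': "P' \<subseteq> ?P" "disjoint_family_on (\<lambda>x. nonisotropic_ball (fst x) (snd x)) P'"
        "(\<Union>\<zeta>\<in>T. ?B \<zeta>) \<subseteq> (\<Union>x\<in>P'. nonisotropic_ball (fst x) (10 * snd x))"
        by auto
      have finP: "finite P'" using finite_subset[OF P'(1)] T(1) by simp
      have "emeasure \<nu> (\<Union>\<zeta>\<in>T. ?B \<zeta>) \<le> emeasure \<nu> (\<Union>x\<in>P'. nonisotropic_ball (fst x) (10 * snd x))"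
        by (intro emeasure_mono P'(3)) (use finP nonisotropic_ball_in_sets in \<open>auto simp: sets\<nu>\<close>)
      also have "\<dots> \<le> (\<Sum>x\<in>P'. emeasure \<nu> (nonisotropic_ball (fst x) (10 * snd x)))"
        by (rule emeasure_subadditive_finite[OF finP]) (use nonisotropic_ball_in_sets in \<open>auto simp: sets\<nu>\<close>)
      finally have "ennreal (t powr p) * emeasure \<nu> (\<Union>\<zeta>\<in>T. ?B \<zeta>)
          \<le> ennreal (t powr p) * (\<Sum>x\<in>P'. emeasure \<nu> (nonisotropic_ball (fst x) (10 * snd x)))"
        by (rule mult_left_mono) simp
      also have "\<dots> = (\<Sum>x\<in>P'. ennreal (t powr p) * emeasure \<nu> (nonisotropic_ball (fst x) (10 * snd x)))"
        by (rule sum_distrib_left)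
      also have "\<dots> \<le> (\<Sum>x\<in>P'. ennreal C * emeasure (density ?s F) (nonisotropic_ball (fst x) (snd x)))"
      proof (rule sum_mono)
        fix x assume "x \<in> P'"
        then obtain \<zeta> where "\<zeta> \<in> E" "x = (\<zeta>, 9 * R \<zeta>)" using P'(1) T(2) by auto
        then show "ennreal (t powr p) * emeasure \<nu> (nonisotropic_ball (fst x) (10 * snd x))
            \<le> ennreal C * emeasure (density ?s F) (nonisotropic_ball (fst x) (snd x))"
          using single by simp
      qed
      also have "\<dots> = ennreal C * (\<Sum>x\<in>P'. emeasure (density ?s F) (nonisotropic_ball (fst x) (snd x)))"
        by (rule sum_distrib_left[symmetric])
      also have "(\<Sum>x\<in>P'. emeasure (density ?s F) (nonisotropic_ball (fst x) (snd x)))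
          = emeasure (density ?s F) (\<Union>x\<in>P'. nonisotropic_ball (fst x) (snd x))"
        by (rule sum_emeasure[OF _ P'(2) finP]) (use nonisotropic_ball_in_sets in auto)
      also have "\<dots> \<le> emeasure (density ?s F) (space (density ?s F))" by (rule emeasure_space)
      also have "\<dots> = (\<integral>\<^sup>+\<eta>. F \<eta> \<partial>?s)" by (subst emeasure_density) (auto intro!: nn_integral_cong)
      finally show ?thesis by (simp add: mult_left_mono)
    qed
    show "ennreal (t powr p) * (\<integral>\<^sup>+\<eta>\<in>E. ennreal (w \<eta>) \<partial>?s)
      \<le> ennreal C * (\<integral>\<^sup>+\<eta>. enn_powr (f \<eta>) p * ennreal (w \<eta>) \<partial>?s)"
    proof (cases "E = {}")
      case True
      then show ?thesis by simp
    next
      case False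
      \<comment> \<open>The balls are relatively open in the sphere; Lindelof is applied to open sets of the ambient
        space that cut them out.\<close>
      define U where "U \<zeta> = {\<eta>. cmod (1 - hprod \<zeta> \<eta>) < 9 * R \<zeta>}" for \<zeta>
      have "open (U \<zeta>)" for \<zeta>
        unfolding U_def by (intro open_Collect_less continuous_intros continuous_on_hprod)
      then have "\<And>S. S \<in> U ` E \<Longrightarrow> open S" by auto
      then obtain \<F> where \<F>: "\<F> \<subseteq> U ` E" "countable \<F>" "\<Union>\<F> = \<Union>(U ` E)"
        by (rule Lindelof)
      have "countable \<F> \<and> \<F> \<subseteq> U ` E" using \<F>(1,2) by simp
      then obtain E' where E': "countable E'" "E' \<subseteq> E" "\<F> = U ` E'"
        unfolding countable_subset_image by blast
      have cover: "E \<subseteq> (\<Union>\<zeta>\<in>E'. ?B \<zeta>)"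
      proof
        fix \<zeta> assume \<zeta>: "\<zeta> \<in> E"
        have n: "norm \<zeta> = 1" using \<zeta> ES by auto
        have "\<zeta> \<in> U \<zeta>" using R[OF \<zeta>] n by (simp add: U_def hprod_self_unit)
        then have "\<zeta> \<in> \<Union>\<F>" using \<F>(3) \<zeta> by blast
        then obtain \<xi> where "\<xi> \<in> E'" "\<zeta> \<in> U \<xi>" using E'(3) by blast
        then show "\<zeta> \<in> (\<Union>\<zeta>\<in>E'. ?B \<zeta>)" using n by (auto simp: U_def nonisotropic_ball_def)
      qed
      have "E' \<noteq> {}" using cover False by auto
      define e where "e = from_nat_into E'"
      have e: "range e = E'" unfolding e_def by (rule range_from_nat_into[OF \<open>E' \<noteq> {}\<close> E'(1)])
      define A where "A n = (\<Union>\<zeta>\<in>e ` {..<n}. ?B \<zeta>)" for n :: nat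
      have Am: "range A \<subseteq> sets \<nu>"
        using nonisotropic_ball_in_sets by (auto simp: A_def sets\<nu>)
      have "E \<subseteq> (\<Union>n. A n)"
      proof
        fix x assume "x \<in> E"
        then obtain i where "x \<in> ?B (e i)" using cover e by blast
        then have "x \<in> A (Suc i)" by (auto simp: A_def)
        then show "x \<in> (\<Union>n. A n)" by blast
      qed
      then have "emeasure \<nu> E \<le> emeasure \<nu> (\<Union>n. A n)"
        using Am by (intro emeasure_mono) auto
      also have "\<dots> = (SUP n. emeasure \<nu> (A n))"
        by (rule SUP_emeasure_incseq[symmetric, OF Am]) (fastforce simp: incseq_def A_def)
      finally have "ennreal (t powr p) * emeasure \<nu> E \<le> ennreal (t powr p) * (SUP n. emeasure \<nu> (A n))"
        by (rule mult_left_mono) simp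
      also have "\<dots> = (SUP n. ennreal (t powr p) * emeasure \<nu> (A n))"
        by (rule SUP_mult_left_ennreal)
      also have "\<dots> \<le> ennreal C * (\<integral>\<^sup>+\<eta>. F \<eta> \<partial>?s)"
      proof (rule SUP_least)
        fix n
        show "ennreal (t powr p) * emeasure \<nu> (A n) \<le> ennreal C * (\<integral>\<^sup>+\<eta>. F \<eta> \<partial>?s)"
          unfolding A_def by (rule fin) (use e E'(2) in auto)
      qed
      finally show ?thesis by (simp add: \<nu>[OF E] F_def)
    qed
  qed
qed

lemma enn_powr_layer_cake:
  fixes a :: real
  assumes a: "a > 0"
  shows "(\<integral>\<^sup>+t. (if 0 < t \<and> ennreal t < x then ennreal (a * t powr (a - 1)) else 0) \<partial>lborel) = enn_powr x a"
proof -
  define I where "I x = (\<integral>\<^sup>+t. (if 0 < t \<and> ennreal t < x then ennreal (a * t powr (a - 1)) else 0) \<partial>lborel)" for x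
  have fin: "I (ennreal r) = ennreal (r powr a)" if r: "r \<ge> 0" for r
  proof -
    have "I (ennreal r) = (\<integral>\<^sup>+t. ennreal (a * t powr (a - 1)) * indicator {0..r} t \<partial>lborel)"
      unfolding I_def
    proof (rule nn_integral_cong_AE)
      show "AE t in lborel. (if 0 < t \<and> ennreal t < ennreal r then ennreal (a * t powr (a - 1)) else 0)
          = ennreal (a * t powr (a - 1)) * indicator {0..r} t"
        using AE_lborel_singleton[of 0] AE_lborel_singleton[of r]
        by eventually_elim (auto simp: indicator_def ennreal_less_iff)
    qed
    also have "\<dots> = ennreal (a * (r powr (a - 1 + 1) / (a - 1 + 1)))"
    proof (rule nn_integral_has_integral_lebesgue')
      show "((\<lambda>t. a * t powr (a - 1)) has_integral (a * (r powr (a - 1 + 1) / (a - 1 + 1)))) {0..r}"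
        by (intro has_integral_mult_right has_integral_powr_from_0) (use a r in auto)
    qed (use a in auto)
    finally show ?thesis using a by simp
  qed
  have "I x = enn_powr x a"
  proof (cases x)
    case (real r)
    then show ?thesis by (simp add: fin enn_powr_ennreal)
  next
    case top
    have le: "ennreal (r powr a) \<le> I top" if "r \<ge> 0" for r
      unfolding fin[OF that, symmetric] unfolding I_def
      by (intro nn_integral_mono) auto
    have "I top = top"
    proof (cases "I top")
      case (real i)
      then have "ennreal (((i + 1) powr (1 / a)) powr a) \<le> ennreal i" using le[of "(i + 1) powr (1 / a)"] by simp
      then show ?thesis using a real by (simp add: powr_powr)
    qed simp
    then show ?thesis using top by simp
  qed
  then show ?thesis by (simp add: I_def)
qed

text \<open>The part of \<open>f\<close> below half the level contributes at most half of an average exceeding the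
  level, so the weak type inequality may be applied to the part above; integrating over all
  levels gives the exponent \<open>2 * p\<close>.\<close>

lemma weighted_strong_type:
  fixes w :: "complex ^ 'n \<Rightarrow> real"
  assumes p: "p > 1" and Ap: "Ap_weight p w"
  obtains C where "C > 0" "\<And>f h. f \<in> borel_measurable sphere_measure \<Longrightarrow> h \<in> borel_measurable sphere_measure \<Longrightarrow>
    (\<And>\<zeta> t. \<zeta> \<in> sphere 0 1 \<Longrightarrow> t > 0 \<Longrightarrow> ennreal t < h \<zeta> \<Longrightarrow> average_at_least f t \<zeta>) \<Longrightarrow>
    (\<integral>\<^sup>+\<eta>. enn_powr (h \<eta>) (2 * p) * ennreal (w \<eta>) \<partial>sphere_measure)
    \<le> ennreal C * (\<integral>\<^sup>+\<eta>. enn_powr (f \<eta>) (2 * p) * ennreal (w \<eta>) \<partial>sphere_measure)"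
proof -
  let ?s = "sphere_measure :: (complex ^ 'n) measure"
  interpret s: finite_measure ?s by (rule finite_sphere_measure)
  interpret P: pair_sigma_finite ?s "lborel :: real measure" ..
  have wm[measurable]: "w \<in> borel_measurable ?s" by (rule measurable_weight[OF Ap])
  obtain C where C: "C > 0" "\<And>f E t. f \<in> borel_measurable ?s \<Longrightarrow> E \<in> sets ?s \<Longrightarrow> t > 0 \<Longrightarrow>
    (\<And>\<zeta>. \<zeta> \<in> E \<Longrightarrow> average_at_least f t \<zeta>) \<Longrightarrow>
    ennreal (t powr p) * (\<integral>\<^sup>+\<eta>\<in>E. ennreal (w \<eta>) \<partial>?s)
    \<le> ennreal C * (\<integral>\<^sup>+\<eta>. enn_powr (f \<eta>) p * ennreal (w \<eta>) \<partial>?s)"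
    by (rule weighted_weak_type[OF p Ap]) blast
  define k where "k a t x = (if 0 < t \<and> ennreal t < x then ennreal (a * t powr (a - 1)) else 0)" for a t :: real and x
  have layer: "(\<integral>\<^sup>+t. k a t x \<partial>lborel) = enn_powr x a" if "a > 0" for a x
    unfolding k_def by (rule enn_powr_layer_cake[OF that])
  define C' where "C' = C * (2 * 2 powr p) * 2 powr p"
  show thesis
  proof (rule that[of C'])
    show "C' > 0" using C(1) by (simp add: C'_def)
    fix f h :: "complex ^ 'n \<Rightarrow> ennreal"
    assume f[measurable]: "f \<in> borel_measurable ?s" and h[measurable]: "h \<in> borel_measurable ?s"
      and av: "\<And>\<zeta> t. \<zeta> \<in> sphere 0 1 \<Longrightarrow> t > 0 \<Longrightarrow> ennreal t < h \<zeta> \<Longrightarrow> average_at_least f t \<zeta>"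
    define F where "F \<eta> = enn_powr (f \<eta>) p * ennreal (w \<eta>)" for \<eta>
    have [measurable]: "F \<in> borel_measurable ?s" unfolding F_def by measurable
    have hm[measurable]: "(\<lambda>x. k (2 * p) (snd x) (h (fst x))) \<in> borel_measurable (?s \<Otimes>\<^sub>M lborel)"
      unfolding k_def by measurable
    have fm[measurable]: "(\<lambda>x. k p (snd x) (2 * f (fst x))) \<in> borel_measurable (?s \<Otimes>\<^sub>M lborel)"
      unfolding k_def by measurable
    have km[measurable]: "(\<lambda>t. k a t x) \<in> borel_measurable borel" for a x
      unfolding k_def by measurable
    have level: "(\<integral>\<^sup>+\<eta>. k (2 * p) t (h \<eta>) * ennreal (w \<eta>) \<partial>?s)
        \<le> (\<integral>\<^sup>+\<eta>. ennreal (C * (2 * 2 powr p)) * (k p t (2 * f \<eta>) * F \<eta>) \<partial>?s)" for t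
    proof (cases "t > 0")
      case False
      then show ?thesis by (simp add: k_def)
    next
      case True
      define E where "E = {\<zeta> \<in> space ?s. ennreal t < h \<zeta>}"
      have E[measurable]: "E \<in> sets ?s" unfolding E_def by measurable
      \<comment> \<open>The average of \<open>f - ft\<close> is at most \<open>t / 2\<close>, so that of \<open>ft\<close> is at least \<open>t / 2\<close>.\<close>
      define ft where "ft \<eta> = (if ennreal (t / 2) < f \<eta> then f \<eta> else 0)" for \<eta>
      have ftm[measurable]: "ft \<in> borel_measurable ?s" unfolding ft_def by measurable
      have "ennreal ((t / 2) powr p) * (\<integral>\<^sup>+\<eta>\<in>E. ennreal (w \<eta>) \<partial>?s)
          \<le> ennreal C * (\<integral>\<^sup>+\<eta>. enn_powr (ft \<eta>) p * ennreal (w \<eta>) \<partial>?s)"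
      proof (rule C(2)[OF ftm E])
        show "t / 2 > 0" using True by simp
        fix \<zeta> assume "\<zeta> \<in> E"
        then have "\<zeta> \<in> sphere 0 1" "ennreal t < h \<zeta>" by (auto simp: E_def space_sphere_measure)
        from av[OF this(1) True this(2)] obtain R where R: "0 < R" "R < 1"
          "ennreal (t * measure ?s (nonisotropic_ball \<zeta> (9 * R))) \<le> (\<integral>\<^sup>+\<eta>\<in>nonisotropic_ball \<zeta> (9 * R). f \<eta> \<partial>?s)"
          unfolding average_at_least_def by blast
        define B where "B = nonisotropic_ball \<zeta> (9 * R)"
        have [measurable]: "B \<in> sets ?s" unfolding B_def by (rule nonisotropic_ball_in_sets)
        define b where "b = measure ?s B"
        define Y where "Y = (\<integral>\<^sup>+\<eta>\<in>B. ft \<eta> \<partial>?s)"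
        have "ennreal (t * b) \<le> (\<integral>\<^sup>+\<eta>\<in>B. f \<eta> \<partial>?s)" using R(3) by (simp add: b_def B_def)
        also have "\<dots> \<le> (\<integral>\<^sup>+\<eta>. ft \<eta> * indicator B \<eta> + ennreal (t / 2) * indicator B \<eta> \<partial>?s)"
          by (intro nn_integral_mono) (auto simp: ft_def indicator_def not_less)
        also have "\<dots> = Y + ennreal (t / 2) * ennreal b"
          unfolding Y_def
          by (subst nn_integral_add) (auto simp: nn_integral_cmult b_def s.emeasure_eq_measure)
        finally have le: "ennreal (t * b) \<le> Y + ennreal (t / 2) * ennreal b" .
        have b0: "b \<ge> 0" by (simp add: b_def)
        have "ennreal (t / 2 * b) \<le> Y"
        proof (cases Y)
          case (real y)
          have "ennreal (t * b) \<le> ennreal (y + t / 2 * b)"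
          proof -
            have "ennreal (t / 2) * ennreal b = ennreal (t / 2 * b)"
              using True b0 by (intro ennreal_mult[symmetric]) auto
            then show ?thesis using le real True b0 by (simp only: ennreal_plus mult_nonneg_nonneg)
          qed
          then have "t * b \<le> y + t / 2 * b"
            using real True b0 by (subst (asm) ennreal_le_iff) auto
          then show ?thesis using real by (simp add: ennreal_leI)
        qed simp
        then show "average_at_least ft (t / 2) \<zeta>"
          using R by (auto simp: average_at_least_def Y_def b_def B_def)
      qed
      then have weak: "ennreal (2 * p * 2 powr p * t powr (p - 1)) * (ennreal ((t / 2) powr p) * (\<integral>\<^sup>+\<eta>\<in>E. ennreal (w \<eta>) \<partial>?s))
          \<le> ennreal (2 * p * 2 powr p * t powr (p - 1)) * (ennreal C * (\<integral>\<^sup>+\<eta>. enn_powr (ft \<eta>) p * ennreal (w \<eta>) \<partial>?s))"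
        by (rule mult_left_mono) simp
      have "t powr (2 * p - 1) = t powr (p - 1) * t powr p" using True by (simp add: powr_add[symmetric])
      then have "2 * p * 2 powr p * t powr (p - 1) * (t / 2) powr p = 2 * p * t powr (2 * p - 1)"
        using True by (simp add: powr_divide)
      then have eq: "ennreal (2 * p * 2 powr p * t powr (p - 1)) * ennreal ((t / 2) powr p) = ennreal (2 * p * t powr (2 * p - 1))"
        using p by (subst ennreal_mult[symmetric]) auto
      have "(\<integral>\<^sup>+\<eta>. k (2 * p) t (h \<eta>) * ennreal (w \<eta>) \<partial>?s)
          = (\<integral>\<^sup>+\<eta>. ennreal (2 * p * t powr (2 * p - 1)) * (ennreal (w \<eta>) * indicator E \<eta>) \<partial>?s)"
        using True by (intro nn_integral_cong) (auto simp: k_def E_def indicator_def)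
      also have "\<dots> = ennreal (2 * p * t powr (2 * p - 1)) * (\<integral>\<^sup>+\<eta>\<in>E. ennreal (w \<eta>) \<partial>?s)"
        by (rule nn_integral_cmult) measurable
      also have "\<dots> \<le> ennreal (2 * p * 2 powr p * t powr (p - 1)) * (ennreal C * (\<integral>\<^sup>+\<eta>. enn_powr (ft \<eta>) p * ennreal (w \<eta>) \<partial>?s))"
        using weak unfolding eq[symmetric] by (simp only: mult.assoc)
      also have "\<dots> = (\<integral>\<^sup>+\<eta>. ennreal (2 * p * 2 powr p * t powr (p - 1)) * (ennreal C * (enn_powr (ft \<eta>) p * ennreal (w \<eta>))) \<partial>?s)"
        by (simp add: nn_integral_cmult)
      also have "\<dots> = (\<integral>\<^sup>+\<eta>. ennreal (C * (2 * 2 powr p)) * (k p t (2 * f \<eta>) * F \<eta>) \<partial>?s)"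
      proof (rule nn_integral_cong)
        fix \<eta>
        have lev: "ennreal (t / 2) < f \<eta> \<longleftrightarrow> ennreal t < 2 * f \<eta>"
        proof (cases "f \<eta>")
          case (real x)
          have "2 * f \<eta> = ennreal (2 * x)" using real by (simp add: ennreal_mult)
          then show ?thesis using real True by (simp add: ennreal_less_iff mult.commute)
        next
          case top
          then show ?thesis by (simp add: ennreal_mult_top)
        qed
        have "ennreal (2 * p * 2 powr p * t powr (p - 1)) * ennreal C = ennreal (C * (2 * 2 powr p)) * ennreal (p * t powr (p - 1))"
          using p C(1) by (subst (1 2) ennreal_mult[symmetric]) (auto simp: mult_ac)
        then show "ennreal (2 * p * 2 powr p * t powr (p - 1)) * (ennreal C * (enn_powr (ft \<eta>) p * ennreal (w \<eta>)))
            = ennreal (C * (2 * 2 powr p)) * (k p t (2 * f \<eta>) * F \<eta>)"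
          using True by (simp add: ft_def k_def F_def lev mult.assoc[symmetric])
      qed
      finally show ?thesis .
    qed
    have "(\<integral>\<^sup>+\<eta>. enn_powr (h \<eta>) (2 * p) * ennreal (w \<eta>) \<partial>?s)
        = (\<integral>\<^sup>+\<eta>. (\<integral>\<^sup>+t. k (2 * p) t (h \<eta>) * ennreal (w \<eta>) \<partial>lborel) \<partial>?s)"
    proof (rule nn_integral_cong)
      fix \<eta>
      show "enn_powr (h \<eta>) (2 * p) * ennreal (w \<eta>) = (\<integral>\<^sup>+t. k (2 * p) t (h \<eta>) * ennreal (w \<eta>) \<partial>lborel)"
        using p by (subst nn_integral_multc) (auto simp: layer)
    qed
    also have "\<dots> = (\<integral>\<^sup>+t. (\<integral>\<^sup>+\<eta>. k (2 * p) t (h \<eta>) * ennreal (w \<eta>) \<partial>?s) \<partial>lborel)"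
      by (rule P.Fubini'[symmetric]) (use hm in \<open>simp add: case_prod_beta\<close>)
    also have "\<dots> \<le> (\<integral>\<^sup>+t. (\<integral>\<^sup>+\<eta>. ennreal (C * (2 * 2 powr p)) * (k p t (2 * f \<eta>) * F \<eta>) \<partial>?s) \<partial>lborel)"
      by (intro nn_integral_mono level)
    also have "\<dots> = (\<integral>\<^sup>+\<eta>. (\<integral>\<^sup>+t. ennreal (C * (2 * 2 powr p)) * (k p t (2 * f \<eta>) * F \<eta>) \<partial>lborel) \<partial>?s)"
      by (rule P.Fubini') (use fm in \<open>simp add: case_prod_beta\<close>)
    also have "\<dots> = (\<integral>\<^sup>+\<eta>. ennreal C' * (enn_powr (f \<eta>) (2 * p) * ennreal (w \<eta>)) \<partial>?s)"
    proof (rule nn_integral_cong)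
      fix \<eta>
      have "(\<integral>\<^sup>+t. ennreal (C * (2 * 2 powr p)) * (k p t (2 * f \<eta>) * F \<eta>) \<partial>lborel)
          = ennreal (C * (2 * 2 powr p)) * (enn_powr (2 * f \<eta>) p * F \<eta>)"
        using p by (subst nn_integral_cmult, simp, subst nn_integral_multc) (auto simp: layer)
      also have "enn_powr (2 * f \<eta>) p = ennreal (2 powr p) * enn_powr (f \<eta>) p"
        using p enn_powr_ennreal[of 2 p] by (simp add: enn_powr_mult)
      also have "ennreal (C * (2 * 2 powr p)) * (ennreal (2 powr p) * enn_powr (f \<eta>) p * F \<eta>)
          = ennreal (C * (2 * 2 powr p)) * ennreal (2 powr p) * ((enn_powr (f \<eta>) p * enn_powr (f \<eta>) p) * ennreal (w \<eta>))"
        by (simp only: F_def mult_ac)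
      also have "ennreal (C * (2 * 2 powr p)) * ennreal (2 powr p) = ennreal C'"
        unfolding C'_def using C(1) by (intro ennreal_mult[symmetric]) auto
      also have "enn_powr (f \<eta>) p * enn_powr (f \<eta>) p = enn_powr (f \<eta>) (2 * p)"
        using p enn_powr_add[of p p "f \<eta>"] by simp
      finally show "(\<integral>\<^sup>+t. ennreal (C * (2 * 2 powr p)) * (k p t (2 * f \<eta>) * F \<eta>) \<partial>lborel)
          = ennreal C' * (enn_powr (f \<eta>) (2 * p) * ennreal (w \<eta>))" .
    qed
    also have "\<dots> = ennreal C' * (\<integral>\<^sup>+\<eta>. enn_powr (f \<eta>) (2 * p) * ennreal (w \<eta>) \<partial>?s)"
      by (rule nn_integral_cmult) measurable
    finally show "(\<integral>\<^sup>+\<eta>. enn_powr (h \<eta>) (2 * p) * ennreal (w \<eta>) \<partial>?s)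
      \<le> ennreal C' * (\<integral>\<^sup>+\<eta>. enn_powr (f \<eta>) (2 * p) * ennreal (w \<eta>) \<partial>?s)" .
  qed
qed

section \<open>The inclusion\<close>

definition radial_sup :: "real \<Rightarrow> (complex ^ 'n \<Rightarrow> complex) \<Rightarrow> complex ^ 'n \<Rightarrow> ennreal" where
  "radial_sup d G \<zeta> = (SUP r\<in>{0<..<1}. ennreal (cmod (G (r *\<^sub>R \<zeta>)) * (1 - r\<^sup>2) powr d))"

text \<open>A supremum of uncountably many functions is measurable here because each of them is continuous
  on a neighbourhood of the sphere, so that the superlevel sets are relatively open.\<close>

lemma measurable_radial_sup:
  fixes G :: "complex ^ 'n \<Rightarrow> complex"
  assumes cont: "continuous_on (ball 0 1) G"
  shows "radial_sup d G \<in> borel_measurable sphere_measure"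
proof (rule borel_measurableI_greater)
  fix y
  define U where "U r = (\<lambda>\<zeta>. ennreal (cmod (G (r *\<^sub>R \<zeta>)) * (1 - r\<^sup>2) powr d)) -` {y<..} \<inter> ball 0 (1 / r)" for r :: real
  have op: "open (U r)" if "r \<in> {0<..<1}" for r
  proof -
    have "continuous_on (ball 0 (1 / r)) (\<lambda>\<zeta>. G (r *\<^sub>R \<zeta>))"
      using that by (intro continuous_on_compose2[OF cont] continuous_intros) (auto simp: field_simps)
    then have "continuous_on (ball 0 (1 / r)) (\<lambda>\<zeta>. ennreal (cmod (G (r *\<^sub>R \<zeta>)) * (1 - r\<^sup>2) powr d))"
      by (intro continuous_on_ennreal continuous_on_mult continuous_on_norm continuous_on_const)
    then show ?thesis
      unfolding U_def by (subst (asm) continuous_on_open_vimage) auto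
  qed
  have "{\<zeta> \<in> space sphere_measure. y < radial_sup d G \<zeta>} = (\<Union>r\<in>{0<..<1}. U r) \<inter> sphere 0 1"
  proof (rule set_eqI)
    fix \<zeta> :: "complex ^ 'n"
    have "\<zeta> \<in> ball 0 (1 / r)" if "norm \<zeta> = 1" "r \<in> {0<..<1}" for r
      using that by simp
    then show "\<zeta> \<in> {\<zeta> \<in> space sphere_measure. y < radial_sup d G \<zeta>} \<longleftrightarrow> \<zeta> \<in> (\<Union>r\<in>{0<..<1}. U r) \<inter> sphere 0 1"
      by (auto simp: space_sphere_measure radial_sup_def less_SUP_iff U_def)
  qed
  also have "\<dots> \<in> sets sphere_measure"
    using op by (intro borel_Int_sphere_in_sets borel_open open_UN) auto
  finally show "{\<zeta> \<in> space sphere_measure. y < radial_sup d G \<zeta>} \<in> sets sphere_measure" .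
qed

text \<open>The local estimate says that each level exceeded by the square root of the radial supremum is,
  up to a constant, exceeded by an average of the radial integral to the power \<open>1 / (2 * q)\<close>. Passing to square
  roots turns the exponent \<open>p\<close> into the exponent \<open>2 * p\<close> of the strong type inequality.\<close>

lemma radial_sup_integral_finite:
  fixes G :: "complex ^ 'n \<Rightarrow> complex" and w :: "complex ^ 'n \<Rightarrow> real"
  assumes p: "p > 1" and Ap: "Ap_weight p w" and cont: "continuous_on (ball 0 1) G"
    and hol: "line_holomorphic G (ball 0 1)" and q: "q \<ge> 1" and d: "d > 0"
    and fin: "(\<integral>\<^sup>+\<zeta>. enn_powr (radial_integral q d G \<zeta>) (p / q) * ennreal (w \<zeta>) \<partial>sphere_measure) < top"
  shows "(\<integral>\<^sup>+\<zeta>. enn_powr (radial_sup d G \<zeta>) p * ennreal (w \<zeta>) \<partial>sphere_measure) < top"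
proof -
  let ?s = "sphere_measure :: (complex ^ 'n) measure"
  have wm[measurable]: "w \<in> borel_measurable ?s" by (rule measurable_weight[OF Ap])
  have Am[measurable]: "radial_integral q d G \<in> borel_measurable ?s" by (rule measurable_radial_integral[OF cont])
  have Sm[measurable]: "radial_sup d G \<in> borel_measurable ?s" by (rule measurable_radial_sup[OF cont])
  obtain C where C: "C > 0" "\<And>\<zeta> R. \<zeta> \<in> sphere 0 1 \<Longrightarrow> 0 < R \<Longrightarrow> R < 1 \<Longrightarrow>
    ennreal (sqrt (cmod (G ((1 - R) *\<^sub>R \<zeta>))) * R powr (d / 2) * measure ?s (nonisotropic_ball \<zeta> (9 * R)))
    \<le> ennreal C * (\<integral>\<^sup>+\<eta>\<in>nonisotropic_ball \<zeta> (9 * R). enn_powr (radial_integral q d G \<eta>) (1 / (2 * q)) \<partial>?s)"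
    using sqrt_le_nonisotropic_average[OF cont hol q, of d] by blast
  define c where "c = 2 powr (d / 2) * C"
  have c: "c > 0" using C(1) by (simp add: c_def)
  define f where "f \<eta> = ennreal c * enn_powr (radial_integral q d G \<eta>) (1 / (2 * q))" for \<eta>
  define h where "h \<zeta> = enn_powr (radial_sup d G \<zeta>) (1 / 2)" for \<zeta>
  have fm: "f \<in> borel_measurable ?s" unfolding f_def by measurable
  have hm: "h \<in> borel_measurable ?s" unfolding h_def by measurable
  obtain K where K: "K > 0" "\<And>f h. f \<in> borel_measurable ?s \<Longrightarrow> h \<in> borel_measurable ?s \<Longrightarrow>
    (\<And>\<zeta> t. \<zeta> \<in> sphere 0 1 \<Longrightarrow> t > 0 \<Longrightarrow> ennreal t < h \<zeta> \<Longrightarrow> average_at_least f t \<zeta>) \<Longrightarrow>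
    (\<integral>\<^sup>+\<eta>. enn_powr (h \<eta>) (2 * p) * ennreal (w \<eta>) \<partial>?s)
    \<le> ennreal K * (\<integral>\<^sup>+\<eta>. enn_powr (f \<eta>) (2 * p) * ennreal (w \<eta>) \<partial>?s)"
    by (rule weighted_strong_type[OF p Ap]) blast
  have "(\<integral>\<^sup>+\<eta>. enn_powr (h \<eta>) (2 * p) * ennreal (w \<eta>) \<partial>?s)
    \<le> ennreal K * (\<integral>\<^sup>+\<eta>. enn_powr (f \<eta>) (2 * p) * ennreal (w \<eta>) \<partial>?s)"
  proof (rule K(2)[OF fm hm])
    fix \<zeta> and t :: real assume \<zeta>: "\<zeta> \<in> sphere 0 1" and t: "t > 0" and th: "ennreal t < h \<zeta>"
    have "ennreal (t\<^sup>2) < radial_sup d G \<zeta>"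
    proof (rule ccontr)
      assume "\<not> ?thesis"
      then have "h \<zeta> \<le> enn_powr (ennreal (t\<^sup>2)) (1 / 2)"
        unfolding h_def by (intro enn_powr_mono) auto
      also have "\<dots> = ennreal t" using t by (simp add: enn_powr_ennreal powr_half_sqrt)
      finally show False using th by simp
    qed
    then obtain r where r: "0 < r" "r < 1" "ennreal (t\<^sup>2) < ennreal (cmod (G (r *\<^sub>R \<zeta>)) * (1 - r\<^sup>2) powr d)"
      by (auto simp: radial_sup_def less_SUP_iff)
    define R where "R = 1 - r"
    define g where "g = cmod (G (r *\<^sub>R \<zeta>))"
    have R: "0 < R" "R < 1" "1 - R = r" using r by (auto simp: R_def)
    have r2: "0 < 1 - r\<^sup>2" using r by (simp add: power_less_one_iff)
    have "1 - r\<^sup>2 = R * (1 + r)" by (simp add: R_def power2_eq_square algebra_simps)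
    also have "\<dots> \<le> R * 2" using r R by (intro mult_left_mono) auto
    finally have r2R: "1 - r\<^sup>2 \<le> 2 * R" by simp
    have "t\<^sup>2 < g * (1 - r\<^sup>2) powr d" using r(3) by (simp add: g_def ennreal_less_iff)
    then have "t < sqrt (g * (1 - r\<^sup>2) powr d)" by (rule real_less_rsqrt)
    also have "\<dots> = sqrt g * (1 - r\<^sup>2) powr (d / 2)"
      using r2 by (simp add: real_sqrt_mult powr_half_sqrt[symmetric] powr_powr)
    also have "\<dots> \<le> sqrt g * (2 * R) powr (d / 2)"
      using r2 r2R d by (intro mult_left_mono powr_mono2) (auto simp: g_def)
    also have "\<dots> = 2 powr (d / 2) * (sqrt g * R powr (d / 2))"
      using R by (simp add: powr_mult)
    finally have tle: "t \<le> 2 powr (d / 2) * (sqrt g * R powr (d / 2))" by simp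
    define B where "B = nonisotropic_ball \<zeta> (9 * R)"
    have [measurable]: "B \<in> sets ?s" unfolding B_def by (rule nonisotropic_ball_in_sets)
    have "ennreal (t * measure ?s B) \<le> ennreal (2 powr (d / 2) * (sqrt g * R powr (d / 2)) * measure ?s B)"
      using tle by (intro ennreal_leI mult_right_mono) auto
    also have "\<dots> = ennreal (2 powr (d / 2)) * ennreal (sqrt g * R powr (d / 2) * measure ?s B)"
      by (subst ennreal_mult[symmetric]) (auto simp: g_def mult_ac)
    also have "\<dots> \<le> ennreal (2 powr (d / 2)) * (ennreal C * (\<integral>\<^sup>+\<eta>\<in>B. enn_powr (radial_integral q d G \<eta>) (1 / (2 * q)) \<partial>?s))"
      using C(2)[OF \<zeta> R(1,2)] unfolding R(3) by (intro mult_left_mono) (auto simp: g_def B_def)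
    also have "\<dots> = ennreal c * (\<integral>\<^sup>+\<eta>\<in>B. enn_powr (radial_integral q d G \<eta>) (1 / (2 * q)) \<partial>?s)"
      using C(1) by (simp add: c_def ennreal_mult mult.assoc)
    also have "\<dots> = (\<integral>\<^sup>+\<eta>. ennreal c * (enn_powr (radial_integral q d G \<eta>) (1 / (2 * q)) * indicator B \<eta>) \<partial>?s)"
      by (rule nn_integral_cmult[symmetric]) measurable
    finally have "ennreal (t * measure ?s B) \<le> (\<integral>\<^sup>+\<eta>\<in>B. f \<eta> \<partial>?s)"
      by (simp add: f_def mult.assoc)
    then show "average_at_least f t \<zeta>"
      using R unfolding average_at_least_def B_def by blast
  qed
  moreover have "enn_powr (h \<eta>) (2 * p) = enn_powr (radial_sup d G \<eta>) p" for \<eta>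
    by (simp add: h_def enn_powr_enn_powr)
  moreover have "enn_powr (f \<eta>) (2 * p) = ennreal (c powr (2 * p)) * enn_powr (radial_integral q d G \<eta>) (p / q)" for \<eta>
    using p c by (simp add: f_def enn_powr_mult enn_powr_enn_powr enn_powr_ennreal)
  ultimately have "(\<integral>\<^sup>+\<eta>. enn_powr (radial_sup d G \<eta>) p * ennreal (w \<eta>) \<partial>?s)
      \<le> ennreal K * (\<integral>\<^sup>+\<eta>. ennreal (c powr (2 * p)) * (enn_powr (radial_integral q d G \<eta>) (p / q) * ennreal (w \<eta>)) \<partial>?s)"
    by (simp add: mult.assoc)
  also have "\<dots> = ennreal K * (ennreal (c powr (2 * p)) * (\<integral>\<^sup>+\<eta>. enn_powr (radial_integral q d G \<eta>) (p / q) * ennreal (w \<eta>) \<partial>?s))"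
    by (subst nn_integral_cmult) auto
  also have "\<dots> < top" using fin by (simp add: ennreal_mult_less_top)
  finally show ?thesis .
qed

lemma radial_integral_le_sup:
  fixes G :: "complex ^ 'n \<Rightarrow> complex"
  assumes cont: "continuous_on (ball 0 1) G" and \<zeta>: "\<zeta> \<in> sphere 0 1" and q: "0 < q0" "q0 < q1"
  shows "radial_integral q1 d G \<zeta> \<le> enn_powr (radial_sup d G \<zeta>) (q1 - q0) * radial_integral q0 d G \<zeta>"
proof -
  let ?H = "\<lambda>x. indicator (ball 0 1) x *\<^sub>R G x"
  have n: "norm \<zeta> = 1" using \<zeta> by simp
  have Hm: "?H \<in> borel_measurable borel" by (rule measurable_extended_by_zero[OF cont])
  have "(\<lambda>\<rho> :: real. \<rho> *\<^sub>R \<zeta>) \<in> borel_measurable borel" by measurable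
  from measurable_compose[OF this Hm]
  have [measurable]: "(\<lambda>\<rho>. ?H (\<rho> *\<^sub>R \<zeta>)) \<in> borel_measurable borel" .
  let ?e = "\<lambda>q \<rho>. ennreal (cmod (?H (\<rho> *\<^sub>R \<zeta>)) powr q * (1 - \<rho>\<^sup>2) powr (d * q - 1)) * indicator {0<..<1} \<rho>"
  have "radial_integral q1 d G \<zeta> = radial_integral q1 d ?H \<zeta>"
    by (rule radial_integral_cong[OF \<zeta>]) simp
  also have "\<dots> \<le> (\<integral>\<^sup>+\<rho>. enn_powr (radial_sup d G \<zeta>) (q1 - q0) * ?e q0 \<rho> \<partial>lborel)"
    unfolding radial_integral_def
  proof (rule nn_integral_mono)
    fix \<rho> :: real
    show "?e q1 \<rho> \<le> enn_powr (radial_sup d G \<zeta>) (q1 - q0) * ?e q0 \<rho>"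
    proof (cases "\<rho> \<in> {0<..<1}")
      case True
      define g where "g = cmod (G (\<rho> *\<^sub>R \<zeta>))"
      define y where "y = 1 - \<rho>\<^sup>2"
      have y: "y > 0" using True by (simp add: y_def power_less_one_iff)
      have g: "g \<ge> 0" by (simp add: g_def)
      have H: "cmod (?H (\<rho> *\<^sub>R \<zeta>)) = g" using True n by (simp add: g_def)
      have "g powr q1 = g powr (q1 - q0) * g powr q0"
        using g by (cases "g = 0") (auto simp: powr_add[symmetric])
      moreover have "y powr (d * q1 - 1) = (y powr d) powr (q1 - q0) * y powr (d * q0 - 1)"
        using y by (simp add: powr_powr powr_add[symmetric] algebra_simps)
      ultimately have "g powr q1 * y powr (d * q1 - 1)
          = (g * y powr d) powr (q1 - q0) * (g powr q0 * y powr (d * q0 - 1))"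
        using g by (simp add: powr_mult mult_ac)
      then have "ennreal (g powr q1 * y powr (d * q1 - 1))
          = ennreal ((g * y powr d) powr (q1 - q0)) * ennreal (g powr q0 * y powr (d * q0 - 1))"
        by (simp only: ennreal_mult powr_ge_zero mult_nonneg_nonneg)
      also have "ennreal ((g * y powr d) powr (q1 - q0)) = enn_powr (ennreal (g * y powr d)) (q1 - q0)"
        using g by (intro enn_powr_ennreal[symmetric]) simp
      also have "enn_powr (ennreal (g * y powr d)) (q1 - q0) * ennreal (g powr q0 * y powr (d * q0 - 1))
          \<le> enn_powr (radial_sup d G \<zeta>) (q1 - q0) * ennreal (g powr q0 * y powr (d * q0 - 1))"
        using q True unfolding radial_sup_def g_def y_def
        by (intro mult_right_mono enn_powr_mono SUP_upper) auto
      finally show ?thesis using True unfolding H by (simp add: y_def)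
    qed simp
  qed
  also have "\<dots> = enn_powr (radial_sup d G \<zeta>) (q1 - q0) * radial_integral q0 d ?H \<zeta>"
    unfolding radial_integral_def by (rule nn_integral_cmult) measurable
  also have "radial_integral q0 d ?H \<zeta> = radial_integral q0 d G \<zeta>"
    by (rule radial_integral_cong[OF \<zeta>]) simp
  finally show ?thesis .
qed

lemma HF_norm_infinity:
  "HF_norm p \<infinity> s w f < \<infinity> \<longleftrightarrow>
    (\<integral>\<^sup>+\<zeta>. enn_powr (radial_sup (int_plus s - s) (radial_power (int_plus s) f) \<zeta>) p * ennreal (w \<zeta>) \<partial>sphere_measure) < top"
  by (simp add: HF_norm_def enn_powr_less_top radial_sup_def)

lemma HF_norm_finite:
  assumes "q \<noteq> \<infinity>"
  shows "HF_norm p q s w f < \<infinity> \<longleftrightarrow>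
    (\<integral>\<^sup>+\<zeta>. enn_powr (radial_integral (enn2real q) (int_plus s - s) (radial_power (int_plus s) f) \<zeta>) (p / enn2real q)
      * ennreal (w \<zeta>) \<partial>sphere_measure) < top"
  using assms by (simp add: HF_norm_def enn_powr_less_top radial_integral_def Let_def)

theorem theorem2p10:
  fixes p s :: real and q0 q1 :: ennreal and w :: "complex ^ 'n \<Rightarrow> real"
  assumes "1 < p" and "1 \<le> q0" and "q0 \<le> q1" and "0 \<le> s"
    and "Ap_weight p w"
  shows "HF p q0 s w \<subseteq> HF p q1 s w"
proof
  fix f assume "f \<in> HF p q0 s w"
  then have f: "holomorphic_ball f" and norm0: "HF_norm p q0 s w f < \<infinity>" by (auto simp: HF_def)
  let ?s = "sphere_measure :: (complex ^ 'n) measure"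
  define d where "d = int_plus s - s"
  have d: "d > 0" unfolding d_def int_plus_def by linarith
  define G where "G = radial_power (int_plus s) f"
  have cont: "continuous_on (ball 0 1) G" unfolding G_def
    by (intro continuous_on_radial_power continuous_on_if_holomorphic_ball line_holomorphic_if_holomorphic_ball f)
  have hol: "line_holomorphic G (ball 0 1)" unfolding G_def
    by (intro line_holomorphic_radial_power continuous_on_if_holomorphic_ball line_holomorphic_if_holomorphic_ball f)
  have wm[measurable]: "w \<in> borel_measurable ?s" by (rule measurable_weight[OF assms(5)])
  have "HF_norm p q1 s w f < \<infinity>"
  proof (cases "q0 = \<infinity>")
    case True
    then have "q1 = q0" using assms(3) by (simp add: top_unique)
    then show ?thesis using norm0 by simp
  next
    case q0: False
    define a where "a = enn2real q0"
    have a: "q0 = ennreal a" "a \<ge> 1" using q0 assms(2) by (cases q0; simp add: a_def)+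
    have fin: "(\<integral>\<^sup>+\<zeta>. enn_powr (radial_integral a d G \<zeta>) (p / a) * ennreal (w \<zeta>) \<partial>?s) < top"
      using norm0 HF_norm_finite[OF q0, where p = p and s = s and w = w and f = f] by (simp add: a_def d_def G_def)
    have sup: "(\<integral>\<^sup>+\<zeta>. enn_powr (radial_sup d G \<zeta>) p * ennreal (w \<zeta>) \<partial>?s) < top"
      by (rule radial_sup_integral_finite[OF assms(1,5) cont hol a(2) d fin])
    show ?thesis
    proof (cases "q1 = \<infinity>")
      case True
      then show ?thesis using sup HF_norm_infinity[of p s w f] by (simp add: d_def G_def)
    next
      case q1: False
      define b where "b = enn2real q1"
      have b: "q1 = ennreal b" "b \<ge> 0" using q1 by (cases q1; simp add: b_def)+
      have ab: "a \<le> b" using assms(3) a b by (simp add: ennreal_le_iff)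
      show ?thesis
      proof (cases "a = b")
        case True
        then show ?thesis using norm0 a b by simp
      next
        case False
        then have ab: "0 < a" "a < b" using ab a(2) by auto
        define \<theta> where "\<theta> = a / b"
        have \<theta>: "0 < \<theta>" "\<theta> < 1" using ab by (auto simp: \<theta>_def)
        have [measurable]: "radial_integral a d G \<in> borel_measurable ?s" "radial_sup d G \<in> borel_measurable ?s"
          by (rule measurable_radial_integral[OF cont] measurable_radial_sup[OF cont])+
        have pointwise: "enn_powr (radial_integral b d G \<zeta>) (p / b)
            \<le> enn_powr (radial_sup d G \<zeta>) p + enn_powr (radial_integral a d G \<zeta>) (p / a)"
          if "\<zeta> \<in> space ?s" for \<zeta>
        proof -
          have \<zeta>: "\<zeta> \<in> sphere 0 1" using that by (simp add: space_sphere_measure)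
          have "enn_powr (radial_integral b d G \<zeta>) (p / b)
              \<le> enn_powr (enn_powr (radial_sup d G \<zeta>) (b - a) * radial_integral a d G \<zeta>) (p / b)"
            using assms(1) ab by (intro enn_powr_mono radial_integral_le_sup[OF cont \<zeta>]) auto
          also have "\<dots> = enn_powr (radial_sup d G \<zeta>) ((b - a) * (p / b)) * enn_powr (radial_integral a d G \<zeta>) (p / b)"
            using assms(1) ab by (simp add: enn_powr_mult enn_powr_enn_powr)
          also have "\<dots> = enn_powr (enn_powr (radial_sup d G \<zeta>) p) (1 - \<theta>) * enn_powr (enn_powr (radial_integral a d G \<zeta>) (p / a)) \<theta>"
          proof -
            have "(b - a) * (p / b) = p * (1 - \<theta>)" "p / b = p / a * \<theta>"
              using ab by (auto simp: \<theta>_def field_simps)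
            then show ?thesis by (simp only: enn_powr_enn_powr)
          qed
          also have "\<dots> \<le> enn_powr (radial_sup d G \<zeta>) p + enn_powr (radial_integral a d G \<zeta>) (p / a)"
            by (rule enn_powr_interpolate[OF \<theta>])
          finally show ?thesis .
        qed
        have "(\<integral>\<^sup>+\<zeta>. enn_powr (radial_integral b d G \<zeta>) (p / b) * ennreal (w \<zeta>) \<partial>?s)
            \<le> (\<integral>\<^sup>+\<zeta>. enn_powr (radial_sup d G \<zeta>) p * ennreal (w \<zeta>)
                + enn_powr (radial_integral a d G \<zeta>) (p / a) * ennreal (w \<zeta>) \<partial>?s)"
          using pointwise by (intro nn_integral_mono) (simp add: distrib_right[symmetric] mult_right_mono)
        also have "\<dots> = (\<integral>\<^sup>+\<zeta>. enn_powr (radial_sup d G \<zeta>) p * ennreal (w \<zeta>) \<partial>?s)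
            + (\<integral>\<^sup>+\<zeta>. enn_powr (radial_integral a d G \<zeta>) (p / a) * ennreal (w \<zeta>) \<partial>?s)"
          by (rule nn_integral_add) measurable
        also have "\<dots> < top" using sup fin by simp
        finally show ?thesis using HF_norm_finite[OF q1, where p = p and s = s and w = w and f = f] by (simp add: b_def d_def G_def)
      qed
    qed
  qed
  then show "f \<in> HF p q1 s w" using f by (simp add: HF_def)
qed

end
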